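(* Let $E$ be a directed graph (with no restriction on the cardinality of its vertex and edge sets) such that the graph $C^*$-algebra $C^*(E)$ is AF. If $C^*(E)$ has a unique irreducible representation up to unitary equivalence, then there is a (not necessarily separable) Hilbert space $\mathcal{H}$ such that $C^*(E) \cong K(\mathcal{H})$, the $C^*$-algebra of compact operators on $\mathcal{H}$.
   Context: Graphs. A directed graph $E = (E^0, E^1, r, s)$ consists of a set $E^0$ of vertices, a set $E^1$ of edges, and range and source maps $r, s : E^1 \to E^0$. The sets $E^0$, $E^1$ may have arbitrary cardinality; $E^0$ is nonempty. A vertex $v$ is regular if $s^{-1}(v)$ is finite and nonempty. Graph $C^*$-algebra. A Cuntz-Krieger $E$-family is a collection $\{s_e, p_v : e \in E^1, v \in E^0\}$ in a $C^*$-algebra such that the $p_v$ are mutually orthogonal projections and the $s_e$ are partial isometries with mutually orthogonal ranges satisfying: (CK1) $s_e^* s_e = p_{r(e)}$ for all $e \in E^1$; (CK2) $s_e s_e^* \le p_{s(e)}$ for all $e \in E^1$; (CK3) $p_v = \sum_{s(e) = v} s_e s_e^*$ for every regular vertex $v$. $C^*(E)$ is the universal $C^*$-algebra generated by a Cuntz-Krieger $E$-family. AF. A $C^*$-algebra is AF if it is a direct limit of a directed system (not necessarily a sequence) of finite-dimensional $C^*$-algebras; in particular it may be non-separable. Representations. A representation of a $C^*$-algebra $A$ is a $*$-homomorphism $\pi : A \to B(\mathcal{H})$ for a Hilbert space $\mathcal{H}$; it is irreducible if it is nonzero and its only closed invariant subspaces are $\{0\}$ and $\mathcal{H}$. Representations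 $\pi : A \to B(\mathcal{H}_\pi)$ and $\rho : A \to B(\mathcal{H}_\rho)$ are unitarily equivalent if there is a unitary $U : \mathcal{H}_\pi \to \mathcal{H}_\rho$ with $\pi(a) = U^* \rho(a) U$ for all $a \in A$. $A$ has a unique irreducible representation up to unitary equivalence if any two irreducible representations of $A$ are unitarily equivalent. *)

theory Defs
  imports
    "HOL-Analysis.Analysis"
    "HOL-Algebra.Module"
    "Graph_Theory.Digraph"
begin

text \<open>
  C*-algebras and Hilbert spaces are carrier-based structures, so that one can quantify over them
  inside a formula. Both extend the record of HOL-Algebra modules, over the ring of complex numbers.
  The field \<open>one\<close> is never used (C*-algebras need not be unital), and for Hilbert
  spaces neither is the field \<open>mult\<close>.
\<close>

definition complex_ring :: "complex ring" where
  "complex_ring = \<lparr>carrier = UNIV, mult = (*), one = 1, zero = 0, add = (+)\<rparr>"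

text \<open>The value 0 outside the carrier is needed because the locale \<open>Metric_space\<close> asks for
  nonnegativity and symmetry on the whole type.\<close>

definition norm_dist :: "('a, 'm) ring_scheme \<Rightarrow> ('a \<Rightarrow> real) \<Rightarrow> 'a \<Rightarrow> 'a \<Rightarrow> real" where
  "norm_dist V N x y = (if x \<in> carrier V \<and> y \<in> carrier V then N (x \<ominus>\<^bsub>V\<^esub> y) else 0)"

definition norm_topology :: "('a, 'm) ring_scheme \<Rightarrow> ('a \<Rightarrow> real) \<Rightarrow> 'a topology" where
  "norm_topology V N = Metric_space.mtopology (carrier V) (norm_dist V N)"


section \<open>C*-algebras\<close>

record 'a cstar = "(complex, 'a) module" +
  star :: "'a \<Rightarrow> 'a"
  alg_norm :: "'a \<Rightarrow> real"

locale cstar_algebra = module complex_ring A for A :: "'a cstar" (structure) +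
  assumes mult_closed: "\<lbrakk>x \<in> carrier A; y \<in> carrier A\<rbrakk> \<Longrightarrow> x \<otimes> y \<in> carrier A"
    and mult_assoc: "\<lbrakk>x \<in> carrier A; y \<in> carrier A; z \<in> carrier A\<rbrakk>
      \<Longrightarrow> (x \<otimes> y) \<otimes> z = x \<otimes> (y \<otimes> z)"
    and mult_distrib_right: "\<lbrakk>x \<in> carrier A; y \<in> carrier A; z \<in> carrier A\<rbrakk>
      \<Longrightarrow> (x \<oplus> y) \<otimes> z = x \<otimes> z \<oplus> y \<otimes> z"
    and mult_distrib_left: "\<lbrakk>x \<in> carrier A; y \<in> carrier A; z \<in> carrier A\<rbrakk>
      \<Longrightarrow> x \<otimes> (y \<oplus> z) = x \<otimes> y \<oplus> x \<otimes> z"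
    and smult_mult_left: "\<lbrakk>x \<in> carrier A; y \<in> carrier A\<rbrakk> \<Longrightarrow> (c \<odot> x) \<otimes> y = c \<odot> (x \<otimes> y)"
    and smult_mult_right: "\<lbrakk>x \<in> carrier A; y \<in> carrier A\<rbrakk> \<Longrightarrow> x \<otimes> (c \<odot> y) = c \<odot> (x \<otimes> y)"
    and star_closed: "x \<in> carrier A \<Longrightarrow> star A x \<in> carrier A"
    and star_star: "x \<in> carrier A \<Longrightarrow> star A (star A x) = x"
    and star_add: "\<lbrakk>x \<in> carrier A; y \<in> carrier A\<rbrakk> \<Longrightarrow> star A (x \<oplus> y) = star A x \<oplus> star A y"
    and star_smult: "x \<in> carrier A \<Longrightarrow> star A (c \<odot> x) = cnj c \<odot> star A x"
    and star_mult: "\<lbrakk>x \<in> carrier A; y \<in> carrier A\<rbrakk> \<Longrightarrow> star A (x \<otimes> y) = star A y \<otimes> star A x"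
    and norm_nonneg: "x \<in> carrier A \<Longrightarrow> 0 \<le> alg_norm A x"
    and norm_eq_0_iff: "x \<in> carrier A \<Longrightarrow> alg_norm A x = 0 \<longleftrightarrow> x = \<zero>"
    and norm_triangle: "\<lbrakk>x \<in> carrier A; y \<in> carrier A\<rbrakk>
      \<Longrightarrow> alg_norm A (x \<oplus> y) \<le> alg_norm A x + alg_norm A y"
    and norm_smult: "x \<in> carrier A \<Longrightarrow> alg_norm A (c \<odot> x) = cmod c * alg_norm A x"
    and norm_mult: "\<lbrakk>x \<in> carrier A; y \<in> carrier A\<rbrakk>
      \<Longrightarrow> alg_norm A (x \<otimes> y) \<le> alg_norm A x * alg_norm A y"
    and cstar_identity: "x \<in> carrier A \<Longrightarrow> alg_norm A (star A x \<otimes> x) = (alg_norm A x)\<^sup>2"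
    and complete: "Metric_space.mcomplete (carrier A) (norm_dist A (alg_norm A))"

definition star_hom :: "'a cstar \<Rightarrow> 'b cstar \<Rightarrow> ('a \<Rightarrow> 'b) \<Rightarrow> bool" where
  "star_hom A B h \<longleftrightarrow>
     h \<in> carrier A \<rightarrow> carrier B \<and>
     (\<forall>x\<in>carrier A. \<forall>y\<in>carrier A. h (x \<oplus>\<^bsub>A\<^esub> y) = h x \<oplus>\<^bsub>B\<^esub> h y) \<and>
     (\<forall>c. \<forall>x\<in>carrier A. h (c \<odot>\<^bsub>A\<^esub> x) = c \<odot>\<^bsub>B\<^esub> h x) \<and>
     (\<forall>x\<in>carrier A. \<forall>y\<in>carrier A. h (x \<otimes>\<^bsub>A\<^esub> y) = h x \<otimes>\<^bsub>B\<^esub> h y) \<and>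
     (\<forall>x\<in>carrier A. h (star A x) = star B (h x))"

definition star_isomorphic :: "'a cstar \<Rightarrow> 'b cstar \<Rightarrow> bool" where
  "star_isomorphic A B \<longleftrightarrow> (\<exists>h. star_hom A B h \<and> bij_betw h (carrier A) (carrier B))"

definition cstar_subalgebra :: "'a set \<Rightarrow> 'a cstar \<Rightarrow> bool" where
  "cstar_subalgebra S A \<longleftrightarrow>
     submodule S complex_ring A \<and>
     (\<forall>x\<in>S. \<forall>y\<in>S. x \<otimes>\<^bsub>A\<^esub> y \<in> S) \<and> (\<forall>x\<in>S. star A x \<in> S) \<and>
     closedin (norm_topology A (alg_norm A)) S"

definition generates_cstar :: "'a set \<Rightarrow> 'a cstar \<Rightarrow> bool" where
  "generates_cstar X A \<longleftrightarrow>
     X \<subseteq> carrier A \<and> (\<forall>S. cstar_subalgebra S A \<and> X \<subseteq> S \<longrightarrow> S = carrier A)"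

definition projection :: "'a cstar \<Rightarrow> 'a \<Rightarrow> bool" where
  "projection A p \<longleftrightarrow> p \<in> carrier A \<and> p \<otimes>\<^bsub>A\<^esub> p = p \<and> star A p = p"

definition partial_isometry :: "'a cstar \<Rightarrow> 'a \<Rightarrow> bool" where
  "partial_isometry A s \<longleftrightarrow> s \<in> carrier A \<and> s \<otimes>\<^bsub>A\<^esub> star A s \<otimes>\<^bsub>A\<^esub> s = s"

definition cstar_le :: "'a cstar \<Rightarrow> 'a \<Rightarrow> 'a \<Rightarrow> bool" where
  "cstar_le A x y \<longleftrightarrow>
     x \<in> carrier A \<and> y \<in> carrier A \<and> star A x = x \<and> star A y = y \<and>
     (\<exists>c\<in>carrier A. y \<ominus>\<^bsub>A\<^esub> x = star A c \<otimes>\<^bsub>A\<^esub> c)"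


section \<open>Graph C*-algebras\<close>

text \<open>In the digraph records of the imported library the source map is \<open>tail\<close> and the range map is \<open>head\<close>.\<close>

definition regular_vertex :: "('v, 'e) pre_digraph \<Rightarrow> 'v \<Rightarrow> bool" where
  "regular_vertex E v \<longleftrightarrow> v \<in> verts E \<and> finite (out_arcs E v) \<and> out_arcs E v \<noteq> {}"

definition cuntz_krieger_family ::
  "('v, 'e) pre_digraph \<Rightarrow> 'a cstar \<Rightarrow> ('e \<Rightarrow> 'a) \<Rightarrow> ('v \<Rightarrow> 'a) \<Rightarrow> bool" where
  "cuntz_krieger_family E A s p \<longleftrightarrow>
     (\<forall>v\<in>verts E. projection A (p v)) \<and>
     (\<forall>v\<in>verts E. \<forall>w\<in>verts E. v \<noteq> w \<longrightarrow> p v \<otimes>\<^bsub>A\<^esub> p w = \<zero>\<^bsub>A\<^esub>) \<and>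
     (\<forall>e\<in>arcs E. partial_isometry A (s e)) \<and>
     (\<forall>e\<in>arcs E. \<forall>f\<in>arcs E. e \<noteq> f \<longrightarrow>
        (s e \<otimes>\<^bsub>A\<^esub> star A (s e)) \<otimes>\<^bsub>A\<^esub> (s f \<otimes>\<^bsub>A\<^esub> star A (s f)) = \<zero>\<^bsub>A\<^esub>) \<and>
     (\<forall>e\<in>arcs E. star A (s e) \<otimes>\<^bsub>A\<^esub> s e = p (head E e)) \<and>
     (\<forall>e\<in>arcs E. cstar_le A (s e \<otimes>\<^bsub>A\<^esub> star A (s e)) (p (tail E e))) \<and>
     (\<forall>v. regular_vertex E v \<longrightarrow>
        p v = (\<Oplus>\<^bsub>A\<^esub>e\<in>out_arcs E v. s e \<otimes>\<^bsub>A\<^esub> star A (s e)))"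

text \<open>
  HOL cannot quantify over all types inside a formula, so ``all Hilbert spaces'' and ``all
  C*-algebras'' have to be read as ``all those whose carrier lies in a fixed, sufficiently large
  type''. Let \<open>\<kappa>\<close> be the infinite cardinality of \<open>('v + 'e) list\<close>.
  A C*-algebra generated by a Cuntz-Krieger family of a graph on \<open>'v\<close>, \<open>'e\<close>
  has a dense subset of size at most \<open>\<kappa>\<close>, hence acts faithfully on
  a Hilbert space with a dense subset of size at most \<open>\<kappa>\<close>; its irreducible (so cyclic)
  representations live on such spaces as well. Such a Hilbert space is isomorphic to
  \<open>\<ell>\<^sup>2(X)\<close> for some \<open>X \<subseteq> ('v + 'e) list\<close>, a set of functions in the
  type \<open>hilbert_carrier\<close> below; its operators lie in \<open>operator_carrier\<close>.
  So no C*-algebra or Hilbert space that matters is lost by the restriction to these types.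
\<close>

type_synonym ('v, 'e) hilbert_carrier = "('v + 'e) list \<Rightarrow> complex"
type_synonym ('v, 'e) operator_carrier = "('v, 'e) hilbert_carrier \<Rightarrow> ('v, 'e) hilbert_carrier"

text \<open>\<open>A\<close>, together with the family \<open>s\<close>, \<open>p\<close>, is (a model of) \<open>C\<^sup>*(E)\<close>. Uniqueness of
  the mediating homomorphism follows from generation.\<close>

definition graph_cstar_algebra ::
  "('v, 'e) pre_digraph \<Rightarrow> 'a cstar \<Rightarrow> ('e \<Rightarrow> 'a) \<Rightarrow> ('v \<Rightarrow> 'a) \<Rightarrow> bool" where
  "graph_cstar_algebra E A s p \<longleftrightarrow>
     cstar_algebra A \<and> cuntz_krieger_family E A s p \<and>
     generates_cstar (s ` arcs E \<union> p ` verts E) A \<and>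
     (\<forall>(B :: ('v, 'e) operator_carrier cstar) t q.
        cstar_algebra B \<and> cuntz_krieger_family E B t q \<longrightarrow>
        (\<exists>h. star_hom A B h \<and> (\<forall>e\<in>arcs E. h (s e) = t e) \<and> (\<forall>v\<in>verts E. h (p v) = q v)))"


section \<open>AF algebras\<close>

definition finite_dimensional :: "'a cstar \<Rightarrow> bool" where
  "finite_dimensional A \<longleftrightarrow>
     (\<exists>X. finite X \<and> X \<subseteq> carrier A \<and>
        (\<forall>x\<in>carrier A. \<exists>c. x = (\<Oplus>\<^bsub>A\<^esub>b\<in>X. c b \<odot>\<^bsub>A\<^esub> b)))"

definition directed_system ::
  "'i set \<Rightarrow> 'i rel \<Rightarrow> ('i \<Rightarrow> 'c cstar) \<Rightarrow> ('i \<Rightarrow> 'i \<Rightarrow> 'c \<Rightarrow> 'c) \<Rightarrow> bool" where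
  "directed_system I r D \<phi> \<longleftrightarrow>
     I \<noteq> {} \<and> preorder_on I r \<and> (\<forall>i\<in>I. \<forall>j\<in>I. \<exists>k\<in>I. (i, k) \<in> r \<and> (j, k) \<in> r) \<and>
     (\<forall>i\<in>I. cstar_algebra (D i)) \<and>
     (\<forall>(i, j)\<in>r. star_hom (D i) (D j) (\<phi> i j)) \<and>
     (\<forall>i\<in>I. \<forall>x\<in>carrier (D i). \<phi> i i x = x) \<and>
     (\<forall>i j k. (i, j) \<in> r \<and> (j, k) \<in> r \<longrightarrow>
        (\<forall>x\<in>carrier (D i). \<phi> j k (\<phi> i j x) = \<phi> i k x))"

definition cocone ::
  "'i set \<Rightarrow> 'i rel \<Rightarrow> ('i \<Rightarrow> 'c cstar) \<Rightarrow> ('i \<Rightarrow> 'i \<Rightarrow> 'c \<Rightarrow> 'c) \<Rightarrow> 'b cstar \<Rightarrow> ('i \<Rightarrow> 'c \<Rightarrow> 'b) \<Rightarrow> bool" where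
  "cocone I r D \<phi> B \<psi> \<longleftrightarrow>
     cstar_algebra B \<and> (\<forall>i\<in>I. star_hom (D i) B (\<psi> i)) \<and>
     (\<forall>(i, j)\<in>r. \<forall>x\<in>carrier (D i). \<psi> j (\<phi> i j x) = \<psi> i x)"

text \<open>
  The direct limit in the category of C*-algebras. The type of the test algebras \<open>B\<close> contains
  copies of \<open>A\<close> itself and of the C*-algebraic limit of the system, as every element of that limit
  is the limit of a sequence of elements of the union of the images of the \<open>D i\<close>. Hence the
  universal property among these \<open>B\<close> is the full one.
\<close>

definition direct_limit ::
  "'i set \<Rightarrow> 'i rel \<Rightarrow> ('i \<Rightarrow> 'c cstar) \<Rightarrow> ('i \<Rightarrow> 'i \<Rightarrow> 'c \<Rightarrow> 'c) \<Rightarrow> 'a cstar \<Rightarrow> ('i \<Rightarrow> 'c \<Rightarrow> 'a) \<Rightarrow> bool" where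
  "direct_limit I r D \<phi> A \<iota> \<longleftrightarrow>
     cocone I r D \<phi> A \<iota> \<and>
     (\<forall>(B :: (nat \<Rightarrow> 'a + 'i \<times> 'c) cstar) \<psi>. cocone I r D \<phi> B \<psi> \<longrightarrow>
        (\<exists>h. star_hom A B h \<and> (\<forall>i\<in>I. \<forall>x\<in>carrier (D i). h (\<iota> i x) = \<psi> i x) \<and>
             (\<forall>h'. star_hom A B h' \<and> (\<forall>i\<in>I. \<forall>x\<in>carrier (D i). h' (\<iota> i x) = \<psi> i x) \<longrightarrow>
                (\<forall>a\<in>carrier A. h' a = h a))))"

text \<open>The type arguments hold the index set and the algebras of the directed system. As a
  hypothesis with arbitrary \<open>'i\<close>, \<open>'c\<close> this covers directed systems of any size.\<close>

definition AF_algebra :: "'i itself \<Rightarrow> 'c itself \<Rightarrow> 'a cstar \<Rightarrow> bool" where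
  "AF_algebra index_type algebra_type A \<longleftrightarrow>
     (\<exists>(I :: 'i set) r (D :: 'i \<Rightarrow> 'c cstar) \<phi> \<iota>.
        directed_system I r D \<phi> \<and> (\<forall>i\<in>I. finite_dimensional (D i)) \<and> direct_limit I r D \<phi> A \<iota>)"


section \<open>Hilbert spaces and their operators\<close>

record 'h hilbert = "(complex, 'h) module" +
  ip :: "'h \<Rightarrow> 'h \<Rightarrow> complex"

definition hnorm :: "'h hilbert \<Rightarrow> 'h \<Rightarrow> real" where
  "hnorm H x = sqrt (Re (ip H x x))"

locale hilbert_space = module complex_ring H for H :: "'h hilbert" (structure) +
  assumes ip_add_left: "\<lbrakk>x \<in> carrier H; y \<in> carrier H; z \<in> carrier H\<rbrakk>
      \<Longrightarrow> ip H (x \<oplus> y) z = ip H x z + ip H y z"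
    and ip_smult_left: "\<lbrakk>x \<in> carrier H; y \<in> carrier H\<rbrakk> \<Longrightarrow> ip H (c \<odot> x) y = c * ip H x y"
    and ip_cnj: "\<lbrakk>x \<in> carrier H; y \<in> carrier H\<rbrakk> \<Longrightarrow> ip H y x = cnj (ip H x y)"
    and ip_pos: "\<lbrakk>x \<in> carrier H; x \<noteq> \<zero>\<rbrakk> \<Longrightarrow> 0 < Re (ip H x x)"
    and complete: "Metric_space.mcomplete (carrier H) (norm_dist H (hnorm H))"

text \<open>Operators are extensional functions, so that operators agreeing on the carrier are equal.\<close>

definition bounded_operators :: "'h hilbert \<Rightarrow> 'k hilbert \<Rightarrow> ('h \<Rightarrow> 'k) set" where
  "bounded_operators H K =
     {T \<in> carrier H \<rightarrow>\<^sub>E carrier K.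
        (\<forall>x\<in>carrier H. \<forall>y\<in>carrier H. T (x \<oplus>\<^bsub>H\<^esub> y) = T x \<oplus>\<^bsub>K\<^esub> T y) \<and>
        (\<forall>c. \<forall>x\<in>carrier H. T (c \<odot>\<^bsub>H\<^esub> x) = c \<odot>\<^bsub>K\<^esub> T x) \<and>
        (\<exists>M. \<forall>x\<in>carrier H. hnorm K (T x) \<le> M * hnorm H x)}"

definition adjoint_operator :: "'h hilbert \<Rightarrow> 'k hilbert \<Rightarrow> ('h \<Rightarrow> 'k) \<Rightarrow> 'k \<Rightarrow> 'h" where
  "adjoint_operator H K T =
     (\<lambda>y\<in>carrier K. THE x. x \<in> carrier H \<and> (\<forall>z\<in>carrier H. ip K (T z) y = ip H z x))"

definition unitary_operator :: "'h hilbert \<Rightarrow> 'k hilbert \<Rightarrow> ('h \<Rightarrow> 'k) \<Rightarrow> bool" where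
  "unitary_operator H K U \<longleftrightarrow>
     U \<in> bounded_operators H K \<and>
     (\<forall>x\<in>carrier H. adjoint_operator H K U (U x) = x) \<and>
     (\<forall>y\<in>carrier K. U (adjoint_operator H K U y) = y)"

definition operator_norm :: "'h hilbert \<Rightarrow> 'k hilbert \<Rightarrow> ('h \<Rightarrow> 'k) \<Rightarrow> real" where
  "operator_norm H K T = (SUP x\<in>{x \<in> carrier H. hnorm H x \<le> 1}. hnorm K (T x))"

definition bounded_operator_algebra :: "'h hilbert \<Rightarrow> ('h \<Rightarrow> 'h) cstar" where
  "bounded_operator_algebra H =
     \<lparr>carrier = bounded_operators H H,
      mult = (\<lambda>S T. \<lambda>x\<in>carrier H. S (T x)),
      one = (\<lambda>x\<in>carrier H. x),
      zero = (\<lambda>x\<in>carrier H. \<zero>\<^bsub>H\<^esub>),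
      add = (\<lambda>S T. \<lambda>x\<in>carrier H. S x \<oplus>\<^bsub>H\<^esub> T x),
      smult = (\<lambda>c T. \<lambda>x\<in>carrier H. c \<odot>\<^bsub>H\<^esub> T x),
      star = adjoint_operator H H,
      alg_norm = operator_norm H H\<rparr>"

definition compact_operators :: "'h hilbert \<Rightarrow> ('h \<Rightarrow> 'h) set" where
  "compact_operators H =
     {T \<in> bounded_operators H H.
        compactin (norm_topology H (hnorm H))
          (norm_topology H (hnorm H) closure_of (T ` {x \<in> carrier H. hnorm H x \<le> 1}))}"

definition compact_operator_algebra :: "'h hilbert \<Rightarrow> ('h \<Rightarrow> 'h) cstar" where
  "compact_operator_algebra H = (bounded_operator_algebra H)\<lparr>carrier := compact_operators H\<rparr>"


section \<open>Representations\<close>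

definition representation :: "'a cstar \<Rightarrow> 'h hilbert \<Rightarrow> ('a \<Rightarrow> 'h \<Rightarrow> 'h) \<Rightarrow> bool" where
  "representation A H \<pi> \<longleftrightarrow> hilbert_space H \<and> star_hom A (bounded_operator_algebra H) \<pi>"

definition irreducible_representation :: "'a cstar \<Rightarrow> 'h hilbert \<Rightarrow> ('a \<Rightarrow> 'h \<Rightarrow> 'h) \<Rightarrow> bool" where
  "irreducible_representation A H \<pi> \<longleftrightarrow>
     representation A H \<pi> \<and>
     (\<exists>a\<in>carrier A. \<pi> a \<noteq> \<zero>\<^bsub>bounded_operator_algebra H\<^esub>) \<and>
     (\<forall>M. submodule M complex_ring H \<and> closedin (norm_topology H (hnorm H)) M \<and>
          (\<forall>a\<in>carrier A. \<pi> a ` M \<subseteq> M) \<longrightarrow> M = {\<zero>\<^bsub>H\<^esub>} \<or> M = carrier H)"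

definition unitarily_equivalent ::
  "'a cstar \<Rightarrow> 'h hilbert \<Rightarrow> ('a \<Rightarrow> 'h \<Rightarrow> 'h) \<Rightarrow> 'k hilbert \<Rightarrow> ('a \<Rightarrow> 'k \<Rightarrow> 'k) \<Rightarrow> bool" where
  "unitarily_equivalent A H \<pi> K \<rho> \<longleftrightarrow>
     (\<exists>U. unitary_operator H K U \<and>
        (\<forall>a\<in>carrier A. \<forall>x\<in>carrier H. \<pi> a x = adjoint_operator H K U (\<rho> a (U x))))"

text \<open>The type argument holds the Hilbert spaces that are quantified over.\<close>

definition unique_irreducible_representation :: "'h itself \<Rightarrow> 'a cstar \<Rightarrow> bool" where
  "unique_irreducible_representation space_type A \<longleftrightarrow>
     (\<forall>(H :: 'h hilbert) \<pi> (K :: 'h hilbert) \<rho>.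
        irreducible_representation A H \<pi> \<and> irreducible_representation A K \<rho> \<longrightarrow>
        unitarily_equivalent A H \<pi> K \<rho>)"

end

theory Submission
  imports Defs
begin

text \<open>
  Every boundary path of \<open>E\<close> (an infinite path, or a finite one that ends at a singular vertex) gives
  an irreducible representation of \<open>C\<^sup>*(E)\<close> on \<open>\<ell>\<^sup>2\<close> of its shift-tail equivalence class, and
  inequivalent paths give inequivalent representations; on a cycle the edges can moreover be twisted
  by a phase. So uniqueness of the irreducible representation forces \<open>E\<close> to have no cycles and a
  single class of boundary paths. Hence no vertex emits infinitely many edges, and there is a vertex
  \<open>w\<close> beyond which paths never branch. Then \<open>p w\<close> is a minimal projection: the paths that merge
  with the one starting at \<open>w\<close> index a system of matrix units. Every \<open>p v\<close> lies in their closed span,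
  because otherwise one could follow a boundary path from \<open>v\<close> all of whose vertices have their
  projections outside the span, and it would not merge with the path from \<open>w\<close>. Finally, a
  C*-algebra that is the closed span of matrix units is isomorphic to the compact operators.
\<close>

section \<open>Normed modules over the complex numbers\<close>

text \<open>Boundary paths may be infinite, while the hypothesis speaks of Hilbert spaces of
  functions on lists over \<open>'v + 'e\<close>. So a path is given by a rule \<open>nx\<close>
  that picks an edge at each vertex, and the members of its class are coded by finite lists.
  Inequivalence rests on one mechanism. The basis vector of the path at a vertex \<open>u\<close> is
  fixed by the range projection of its first edge, so all paths in the support of its image under an
  intertwiner begin with that edge. Shifting both sides turns a nonzero coefficient into a common
  vertex from which the two rules agree (\<open>spines_merge\<close>). Apart from acyclicity, where
  phases are compared, each conclusion about the graph comes from two rules that cannot agree. The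
  same bookkeeping, applied to the projection onto an invariant subspace, gives irreducibility. To
  recognize the compact operators, a representation has to be isometric, and no spectral theory is
  at hand: contractivity comes from a square root found as a fixed point, the reverse bound from the
  C*-identity on finite matrix algebras, and density does the rest.\<close>

lemma complex_ring_simps [simp]:
  "carrier complex_ring = UNIV" "a \<otimes>\<^bsub>complex_ring\<^esub> b = a * b" "\<one>\<^bsub>complex_ring\<^esub> = 1"
  "\<zero>\<^bsub>complex_ring\<^esub> = 0" "a \<oplus>\<^bsub>complex_ring\<^esub> b = a + b"
  by (simp_all add: complex_ring_def)

lemma cring_complex_ring: "cring complex_ring"
proof (rule cringI)
  show "abelian_group complex_ring"
  proof (rule abelian_groupI)
    fix x :: complex
    show "\<exists>y\<in>carrier complex_ring. y \<oplus>\<^bsub>complex_ring\<^esub> x = \<zero>\<^bsub>complex_ring\<^esub>"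
      by (rule bexI[of _ "- x"]) auto
  qed auto
  show "Group.comm_monoid complex_ring"
    by (rule comm_monoidI) auto
qed (auto simp: distrib_right)

lemma complex_ring_a_inv [simp]: "\<ominus>\<^bsub>complex_ring\<^esub> a = - a"
proof -
  interpret cring complex_ring by (rule cring_complex_ring)
  show ?thesis using minus_equality[of "- a" a] by simp
qed

text \<open>Limits, closures and spans occur in C*-algebras, in Hilbert spaces and in algebras of
  operators; this interface treats all three at once.\<close>

locale normed_module = module complex_ring V
  for V :: "(complex, 'a, 'm) module_scheme" (structure) +
  fixes N :: "'a \<Rightarrow> real"
  assumes N_nonneg: "x \<in> carrier V \<Longrightarrow> 0 \<le> N x"
    and N_eq_0_iff: "x \<in> carrier V \<Longrightarrow> N x = 0 \<longleftrightarrow> x = \<zero>"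
    and N_triangle: "\<lbrakk>x \<in> carrier V; y \<in> carrier V\<rbrakk> \<Longrightarrow> N (x \<oplus> y) \<le> N x + N y"
    and N_smult: "x \<in> carrier V \<Longrightarrow> N (c \<odot> x) = cmod c * N x"
begin

lemma smult_in [simp, intro]: "x \<in> carrier V \<Longrightarrow> c \<odot> x \<in> carrier V"
  using smult_closed by simp

lemma minus_in [simp, intro]: "\<lbrakk>x \<in> carrier V; y \<in> carrier V\<rbrakk> \<Longrightarrow> x \<ominus> y \<in> carrier V"
  by (rule M.minus_closed)

lemma smult_add: "\<lbrakk>x \<in> carrier V; y \<in> carrier V\<rbrakk> \<Longrightarrow> c \<odot> (x \<oplus> y) = c \<odot> x \<oplus> c \<odot> y"
  using smult_r_distr by simp

lemma add_smult: "x \<in> carrier V \<Longrightarrow> (c + d) \<odot> x = c \<odot> x \<oplus> d \<odot> x"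
  using smult_l_distr[of c d x] by simp

lemma mult_smult: "x \<in> carrier V \<Longrightarrow> (c * d) \<odot> x = c \<odot> (d \<odot> x)"
  using smult_assoc1[of c d x] by simp

lemma one_smult [simp]: "x \<in> carrier V \<Longrightarrow> 1 \<odot> x = x"
  using smult_one[of x] by simp

lemma zero_smult [simp]: "x \<in> carrier V \<Longrightarrow> 0 \<odot> x = \<zero>"
  using smult_l_null[of x] by simp

lemma smult_zero [simp]: "c \<odot> \<zero> = \<zero>"
  using smult_r_null[of c] by simp

lemma neg_smult: "x \<in> carrier V \<Longrightarrow> (- c) \<odot> x = \<ominus> (c \<odot> x)"
  using smult_l_minus[of c x] by simp

lemma inv_eq_smult: "x \<in> carrier V \<Longrightarrow> \<ominus> x = (- 1) \<odot> x"
  using neg_smult[of x 1] by simp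

lemma minus_eq_smult: "\<lbrakk>x \<in> carrier V; y \<in> carrier V\<rbrakk> \<Longrightarrow> x \<ominus> y = x \<oplus> (- 1) \<odot> y"
  by (simp add: M.minus_eq inv_eq_smult)

lemma smult_minus: "\<lbrakk>x \<in> carrier V; y \<in> carrier V\<rbrakk> \<Longrightarrow> c \<odot> (x \<ominus> y) = c \<odot> x \<ominus> c \<odot> y"
  by (simp add: minus_eq_smult smult_add mult_smult[symmetric])

lemma minus_zero [simp]: "x \<in> carrier V \<Longrightarrow> x \<ominus> \<zero> = x"
  by (simp add: minus_eq_smult)

lemma minus_self [simp]: "x \<in> carrier V \<Longrightarrow> x \<ominus> x = \<zero>"
  by (simp add: M.minus_eq M.r_neg)

lemma minus_add_cancel: "\<lbrakk>x \<in> carrier V; y \<in> carrier V\<rbrakk> \<Longrightarrow> (x \<ominus> y) \<oplus> y = x"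
  by (simp add: M.minus_eq M.a_assoc M.l_neg)

lemma minus_eq_zero_iff [simp]: "\<lbrakk>x \<in> carrier V; y \<in> carrier V\<rbrakk> \<Longrightarrow> x \<ominus> y = \<zero> \<longleftrightarrow> x = y"
  using minus_add_cancel[of x y] by auto

lemma minus_add_minus:
  "\<lbrakk>x \<in> carrier V; y \<in> carrier V; z \<in> carrier V\<rbrakk> \<Longrightarrow> (x \<ominus> y) \<oplus> (y \<ominus> z) = x \<ominus> z"
  by (simp add: M.minus_eq M.a_assoc M.r_neg1)

lemma add_minus_add:
  "\<lbrakk>x \<in> carrier V; y \<in> carrier V; z \<in> carrier V; w \<in> carrier V\<rbrakk>
    \<Longrightarrow> (x \<oplus> y) \<ominus> (z \<oplus> w) = (x \<ominus> z) \<oplus> (y \<ominus> w)"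
  by (simp add: minus_eq_smult smult_add M.a_ac)

lemma minus_swap: "\<lbrakk>x \<in> carrier V; y \<in> carrier V\<rbrakk> \<Longrightarrow> y \<ominus> x = (- 1) \<odot> (x \<ominus> y)"
  by (simp add: minus_eq_smult smult_add mult_smult[symmetric] M.a_comm)

lemma minus_minus_minus:
  assumes "x \<in> carrier V" "y \<in> carrier V" "z \<in> carrier V"
  shows "(x \<ominus> y) \<ominus> (x \<ominus> z) = z \<ominus> y"
proof -
  have "(x \<ominus> y) \<ominus> (x \<ominus> z) = (x \<ominus> y) \<oplus> (z \<ominus> x)"
    using assms by (simp add: minus_eq_smult[of "x \<ominus> y" "x \<ominus> z"] minus_swap[symmetric])
  also have "\<dots> = z \<ominus> y"
    using assms by (simp add: M.a_comm[of "x \<ominus> y"] minus_add_minus)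
  finally show ?thesis .
qed

lemma N_zero [simp]: "N \<zero> = 0"
  by (simp add: N_eq_0_iff)

lemma N_minus_commute: "\<lbrakk>x \<in> carrier V; y \<in> carrier V\<rbrakk> \<Longrightarrow> N (x \<ominus> y) = N (y \<ominus> x)"
  by (subst minus_swap) (simp_all add: N_smult)

lemma N_minus_triangle:
  "\<lbrakk>x \<in> carrier V; y \<in> carrier V; z \<in> carrier V\<rbrakk> \<Longrightarrow> N (x \<ominus> z) \<le> N (x \<ominus> y) + N (y \<ominus> z)"
  using N_triangle[of "x \<ominus> y" "y \<ominus> z"] by (simp add: minus_add_minus)

lemma N_le_minus: "\<lbrakk>x \<in> carrier V; y \<in> carrier V\<rbrakk> \<Longrightarrow> N x \<le> N (x \<ominus> y) + N y"
  using N_triangle[of "x \<ominus> y" y] by (simp add: minus_add_cancel)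

lemma N_add_minus_add_le:
  "\<lbrakk>x \<in> carrier V; y \<in> carrier V; z \<in> carrier V; w \<in> carrier V\<rbrakk>
    \<Longrightarrow> N ((x \<oplus> y) \<ominus> (z \<oplus> w)) \<le> N (x \<ominus> z) + N (y \<ominus> w)"
  by (simp add: add_minus_add N_triangle)

lemma N_finsum_le:
  assumes "finite F" "f \<in> F \<rightarrow> carrier V"
  shows "N (finsum V f F) \<le> (\<Sum>i\<in>F. N (f i))"
  using assms
proof (induction F)
  case (insert i F)
  then have "N (finsum V f (insert i F)) \<le> N (f i) + N (finsum V f F)"
    by (subst finsum_insert) (auto intro!: N_triangle finsum_closed)
  with insert show ?case by simp
qed simp

lemma metric: "Metric_space (carrier V) (norm_dist V N)"
proof
  fix x y z
  show "0 \<le> norm_dist V N x y"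
    by (simp add: norm_dist_def N_nonneg)
  show "norm_dist V N x y = norm_dist V N y x"
    by (simp add: norm_dist_def N_minus_commute)
  show "x \<in> carrier V \<Longrightarrow> y \<in> carrier V \<Longrightarrow> norm_dist V N x y = 0 \<longleftrightarrow> x = y"
    by (simp add: norm_dist_def N_eq_0_iff)
  show "\<lbrakk>x \<in> carrier V; y \<in> carrier V; z \<in> carrier V\<rbrakk>
      \<Longrightarrow> norm_dist V N x z \<le> norm_dist V N x y + norm_dist V N y z"
    by (simp add: norm_dist_def N_minus_triangle)
qed

sublocale Metric_space "carrier V" "norm_dist V N"
  by (rule metric)

lemma norm_dist_eq: "\<lbrakk>x \<in> carrier V; y \<in> carrier V\<rbrakk> \<Longrightarrow> norm_dist V N x y = N (x \<ominus> y)"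
  by (simp add: norm_dist_def)

lemma mcomplete_iff:
  "mcomplete \<longleftrightarrow>
    (\<forall>\<sigma> :: nat \<Rightarrow> 'a. (\<forall>n. \<sigma> n \<in> carrier V) \<and>
         (\<forall>\<epsilon>>0. \<exists>k. \<forall>m\<ge>k. \<forall>n\<ge>k. N (\<sigma> m \<ominus> \<sigma> n) < \<epsilon>) \<longrightarrow>
       (\<exists>l\<in>carrier V. \<forall>\<epsilon>>0. \<exists>k. \<forall>n\<ge>k. N (\<sigma> n \<ominus> l) < \<epsilon>))"
proof -
  have 1: "MCauchy \<sigma> \<longleftrightarrow> (\<forall>n. \<sigma> n \<in> carrier V) \<and>
         (\<forall>\<epsilon>>0. \<exists>k. \<forall>m\<ge>k. \<forall>n\<ge>k. N (\<sigma> m \<ominus> \<sigma> n) < \<epsilon>)" for \<sigma>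
  proof (cases "\<forall>n. \<sigma> n \<in> carrier V")
    case True
    then show ?thesis
      by (auto simp: MCauchy_def norm_dist_eq)
  qed (auto simp: MCauchy_def)
  have 2: "(\<exists>l. limitin mtopology \<sigma> l sequentially) \<longleftrightarrow>
      (\<exists>l\<in>carrier V. \<forall>\<epsilon>>0. \<exists>k. \<forall>n\<ge>k. N (\<sigma> n \<ominus> l) < \<epsilon>)" if "\<forall>n. \<sigma> n \<in> carrier V" for \<sigma>
  proof -
    have "limitin mtopology \<sigma> l sequentially \<longleftrightarrow>
        l \<in> carrier V \<and> (\<forall>\<epsilon>>0. \<exists>k. \<forall>n\<ge>k. N (\<sigma> n \<ominus> l) < \<epsilon>)" for l
      using that by (auto simp: limitin_metric eventually_sequentially norm_dist_def)
    then show ?thesis by blast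
  qed
  show ?thesis
    unfolding mcomplete_def by (rule all_cong1, rule imp_cong, rule 1, rule 2, blast)
qed

lemma closedin_iff:
  "closedin (norm_topology V N) S \<longleftrightarrow>
    S \<subseteq> carrier V \<and> (\<forall>x\<in>carrier V. (\<forall>\<epsilon>>0. \<exists>y\<in>S. N (x \<ominus> y) < \<epsilon>) \<longrightarrow> x \<in> S)"
proof (cases "S \<subseteq> carrier V")
  case True
  have "disjnt S (mball x r) \<longleftrightarrow> \<not> (\<exists>y\<in>S. N (x \<ominus> y) < r)" if "x \<in> carrier V" for x r
    using that True by (auto simp: disjnt_iff norm_dist_eq subset_iff)
  then have "(\<forall>x. x \<in> carrier V - S \<longrightarrow> (\<exists>r>0. disjnt S (mball x r))) \<longleftrightarrow>
      (\<forall>x\<in>carrier V. x \<notin> S \<longrightarrow> (\<exists>r>0. \<not> (\<exists>y\<in>S. N (x \<ominus> y) < r)))"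
    by (metis (no_types, lifting) Diff_iff)
  then show ?thesis
    unfolding norm_topology_def closedin_metric using True by blast
qed (auto simp: norm_topology_def closedin_metric)

definition closure_set :: "'a set \<Rightarrow> 'a set" where
  "closure_set S = {x \<in> carrier V. \<forall>\<epsilon>>0. \<exists>y\<in>S. N (x \<ominus> y) < \<epsilon>}"

lemma closure_setI: "\<lbrakk>x \<in> carrier V; \<And>\<epsilon>. \<epsilon> > 0 \<Longrightarrow> \<exists>y\<in>S. N (x \<ominus> y) < \<epsilon>\<rbrakk> \<Longrightarrow> x \<in> closure_set S"
  by (simp add: closure_set_def)

lemma closure_setD: "\<lbrakk>x \<in> closure_set S; \<epsilon> > 0\<rbrakk> \<Longrightarrow> \<exists>y\<in>S. N (x \<ominus> y) < \<epsilon>"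
  by (simp add: closure_set_def)

lemma closure_set_carrier: "x \<in> closure_set S \<Longrightarrow> x \<in> carrier V"
  by (simp add: closure_set_def)

lemma closure_set_superset: "S \<subseteq> carrier V \<Longrightarrow> S \<subseteq> closure_set S"
  by (auto simp: closure_set_def intro!: bexI)

lemma closure_set_idem:
  assumes "S \<subseteq> carrier V"
  shows "closure_set (closure_set S) = closure_set S"
proof
  show "closure_set (closure_set S) \<subseteq> closure_set S"
  proof
    fix x assume x: "x \<in> closure_set (closure_set S)"
    show "x \<in> closure_set S"
    proof (rule closure_setI)
      show xc: "x \<in> carrier V" using x by (rule closure_set_carrier)
      fix \<epsilon> :: real assume "\<epsilon> > 0"
      then obtain y where y: "y \<in> closure_set S" "N (x \<ominus> y) < \<epsilon>/2"
        using closure_setD[OF x, of "\<epsilon>/2"] by auto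
      obtain z where z: "z \<in> S" "N (y \<ominus> z) < \<epsilon>/2"
        using closure_setD[OF y(1), of "\<epsilon>/2"] \<open>\<epsilon> > 0\<close> by auto
      have "N (x \<ominus> z) < \<epsilon>"
        using N_minus_triangle[of x y z] xc closure_set_carrier[OF y(1)] y(2) z assms by auto
      with z(1) show "\<exists>y\<in>S. N (x \<ominus> y) < \<epsilon>" by blast
    qed
  qed
  show "closure_set S \<subseteq> closure_set (closure_set S)"
    by (rule closure_set_superset) (auto simp: closure_set_def)
qed

lemma closedin_closure_set:
  assumes "S \<subseteq> carrier V"
  shows "closedin (norm_topology V N) (closure_set S)"
  unfolding closedin_iff using closure_set_idem[OF assms] by (auto simp: closure_set_def)

lemma closure_set_subset_closed:
  assumes "closedin (norm_topology V N) T" "S \<subseteq> T"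
  shows "closure_set S \<subseteq> T"
  using assms unfolding closedin_iff closure_set_def by blast

text \<open>A Lipschitz map carries approximations of \<open>x\<close> to approximations of
  \<open>f x\<close>. It is enough that \<open>f\<close> sends \<open>S\<close> into the closure of
  \<open>T\<close>, because closing twice adds nothing.\<close>

lemma closure_set_image:
  assumes S: "S \<subseteq> carrier V" and T: "T \<subseteq> carrier V"
    and f: "\<And>x. x \<in> carrier V \<Longrightarrow> f x \<in> carrier V"
    and L: "\<And>x y. \<lbrakk>x \<in> carrier V; y \<in> carrier V\<rbrakk> \<Longrightarrow> N (f x \<ominus> f y) \<le> L * N (x \<ominus> y)"
    and fS: "\<And>x. x \<in> S \<Longrightarrow> f x \<in> closure_set T"
    and x: "x \<in> closure_set S"
  shows "f x \<in> closure_set T"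
proof -
  have xc: "x \<in> carrier V" using x by (rule closure_set_carrier)
  have "f x \<in> closure_set (closure_set T)"
  proof (rule closure_setI)
    show "f x \<in> carrier V" using xc f by simp
    fix \<epsilon> :: real assume e: "\<epsilon> > 0"
    \<comment> \<open>\<open>L\<close> may be 0, for instance as \<open>cmod c\<close> for
      \<open>c = 0\<close>, and one divides by \<open>K\<close>.\<close>
    define K where "K = max L 1"
    have K: "K > 0" by (simp add: K_def)
    obtain y where y: "y \<in> S" "N (x \<ominus> y) < \<epsilon> / K"
      using closure_setD[OF x, of "\<epsilon> / K"] e K by auto
    have yc: "y \<in> carrier V" using y(1) S by auto
    have "N (f x \<ominus> f y) \<le> L * N (x \<ominus> y)" using L xc yc by simp
    also have "\<dots> \<le> K * N (x \<ominus> y)"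
      using xc yc by (intro mult_right_mono) (auto simp: K_def N_nonneg)
    also have "\<dots> < \<epsilon>" using y(2) K by (simp add: field_simps)
    finally show "\<exists>z\<in>closure_set T. N (f x \<ominus> z) < \<epsilon>" using fS y(1) by blast
  qed
  then show ?thesis using closure_set_idem[OF T] by simp
qed

text \<open>Inductive, so that facts about spans are proved by rule induction; for a finite family,
  coefficients are recovered in \<open>lin_span_finsum\<close>.\<close>

inductive_set lin_span :: "'a set \<Rightarrow> 'a set" for G where
  zero: "\<zero> \<in> lin_span G"
| base: "g \<in> G \<Longrightarrow> g \<in> lin_span G"
| add: "\<lbrakk>x \<in> lin_span G; y \<in> lin_span G\<rbrakk> \<Longrightarrow> x \<oplus> y \<in> lin_span G"
| smult: "x \<in> lin_span G \<Longrightarrow> c \<odot> x \<in> lin_span G"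

lemma lin_span_carrier: "\<lbrakk>G \<subseteq> carrier V; x \<in> lin_span G\<rbrakk> \<Longrightarrow> x \<in> carrier V"
  by (rotate_tac 1, induction rule: lin_span.induct) auto

lemma lin_span_mono:
  assumes "G \<subseteq> G'" shows "lin_span G \<subseteq> lin_span G'"
proof
  fix x assume "x \<in> lin_span G"
  then show "x \<in> lin_span G'"
    by induction (use assms in \<open>auto intro: lin_span.intros\<close>)
qed

text \<open>Allows an estimate on the span of all matrix units to be made inside the
  finite-dimensional algebra spanned by finitely many of them.\<close>

lemma lin_span_finite_subset:
  assumes "x \<in> lin_span G"
  shows "\<exists>F. finite F \<and> F \<subseteq> G \<and> x \<in> lin_span F"
  using assms
proof induction
  case (add x y)
  then obtain F F' where "finite F" "F \<subseteq> G" "x \<in> lin_span F" "finite F'" "F' \<subseteq> G" "y \<in> lin_span F'"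
    by blast
  moreover from this have "x \<in> lin_span (F \<union> F')" "y \<in> lin_span (F \<union> F')"
    using lin_span_mono[of F "F \<union> F'"] lin_span_mono[of F' "F \<union> F'"] by auto
  ultimately show ?case
    by (intro exI[of _ "F \<union> F'"]) (auto intro: lin_span.add)
qed (auto intro: lin_span.intros)

lemma submodule_closure_span:
  assumes G: "G \<subseteq> carrier V"
  shows "submodule (closure_set (lin_span G)) complex_ring V"
proof -
  have sp: "lin_span G \<subseteq> carrier V" using lin_span_carrier[OF G] by auto
  have sm: "c \<odot> x \<in> closure_set (lin_span G)" if x: "x \<in> closure_set (lin_span G)" for c x
    by (rule closure_set_image[OF sp sp _ _ _ x, of _ "cmod c"])
      (auto simp: smult_minus[symmetric] N_smult intro: subsetD[OF closure_set_superset[OF sp]] lin_span.smult)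
  show ?thesis
  proof (rule submoduleI)
    show "closure_set (lin_span G) \<subseteq> carrier V" by (auto simp: closure_set_def)
    show "\<zero> \<in> closure_set (lin_span G)"
      using closure_set_superset[OF sp] lin_span.zero by auto
    show "\<ominus> a \<in> closure_set (lin_span G)" if "a \<in> closure_set (lin_span G)" for a
      using sm[OF that, of "- 1"] closure_set_carrier[OF that] by (simp add: inv_eq_smult)
    show "c \<odot> x \<in> closure_set (lin_span G)" if "x \<in> closure_set (lin_span G)" for c x
      using sm that .
    fix x y assume x: "x \<in> closure_set (lin_span G)" and y: "y \<in> closure_set (lin_span G)"
    show "x \<oplus> y \<in> closure_set (lin_span G)"
    proof (rule closure_setI)
      show "x \<oplus> y \<in> carrier V" using x y closure_set_carrier by auto
      fix \<epsilon> :: real assume "\<epsilon> > 0"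
      then obtain x' y' where xy': "x' \<in> lin_span G" "N (x \<ominus> x') < \<epsilon>/2" "y' \<in> lin_span G" "N (y \<ominus> y') < \<epsilon>/2"
        using closure_setD[OF x, of "\<epsilon>/2"] closure_setD[OF y, of "\<epsilon>/2"] by auto
      then have "N ((x \<oplus> y) \<ominus> (x' \<oplus> y')) < \<epsilon>"
        using N_add_minus_add_le[of x y x' y'] sp x y closure_set_carrier by fastforce
      then show "\<exists>z\<in>lin_span G. N ((x \<oplus> y) \<ominus> z) < \<epsilon>" using xy' lin_span.add by blast
    qed
  qed
qed

lemma closed_submodule_contains_span:
  assumes "submodule M complex_ring V" "G \<subseteq> M"
  shows "lin_span G \<subseteq> M"
proof
  fix x assume "x \<in> lin_span G"
  then show "x \<in> M"
  proof induction
    case zero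
    then show ?case
      using submoduleE(2-5)[OF assms(1)] submoduleE(1)[OF assms(1)] by (metis all_not_in_conv smult_l_null UNIV_I
        complex_ring_simps(1) subsetD)
  qed (use submoduleE[OF assms(1)] assms(2) in auto)
qed

end


section \<open>C*-algebras\<close>

sublocale cstar_algebra \<subseteq> normed_module A "alg_norm A"
  by unfold_locales (auto simp: norm_nonneg norm_eq_0_iff norm_triangle norm_smult)

context cstar_algebra
begin

lemmas mult_in [simp, intro] = mult_closed
lemmas star_in [simp, intro] = star_closed
lemmas star_star' [simp] = star_star

lemma mult_zero [simp]: "x \<in> carrier A \<Longrightarrow> x \<otimes> \<zero> = \<zero>"
  using smult_mult_right[of x \<zero> 0] by simp

lemma zero_mult [simp]: "x \<in> carrier A \<Longrightarrow> \<zero> \<otimes> x = \<zero>"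
  using smult_mult_left[of \<zero> x 0] by simp

lemma star_zero [simp]: "star A \<zero> = \<zero>"
  using star_smult[of \<zero> 0] by simp

lemma mult_minus_right: "\<lbrakk>x \<in> carrier A; y \<in> carrier A; z \<in> carrier A\<rbrakk> \<Longrightarrow> x \<otimes> (y \<ominus> z) = x \<otimes> y \<ominus> x \<otimes> z"
  by (simp add: minus_eq_smult mult_distrib_left smult_mult_right)

lemma mult_minus_left: "\<lbrakk>x \<in> carrier A; y \<in> carrier A; z \<in> carrier A\<rbrakk> \<Longrightarrow> (x \<ominus> y) \<otimes> z = x \<otimes> z \<ominus> y \<otimes> z"
  by (simp add: minus_eq_smult mult_distrib_right smult_mult_left)

lemma star_minus: "\<lbrakk>x \<in> carrier A; y \<in> carrier A\<rbrakk> \<Longrightarrow> star A (x \<ominus> y) = star A x \<ominus> star A y"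
  by (simp add: minus_eq_smult star_add star_smult)

text \<open>By the C*-identity and submultiplicativity the norm of \<open>x\<close> is at most that
  of its adjoint; applied to the adjoint, this gives equality.\<close>

lemma norm_star: assumes "x \<in> carrier A" shows "alg_norm A (star A x) = alg_norm A x"
proof -
  have le: "alg_norm A x \<le> alg_norm A (star A x)" if x: "x \<in> carrier A" for x
  proof (cases "alg_norm A x = 0")
    case True then show ?thesis using x norm_nonneg[of "star A x"] by simp
  next
    case False
    then have pos: "alg_norm A x > 0" using norm_nonneg[OF x] by simp
    have "alg_norm A x * alg_norm A x \<le> alg_norm A (star A x) * alg_norm A x"
      using cstar_identity[OF x] norm_mult[of "star A x" x] x by (simp add: power2_eq_square)
    then show ?thesis using pos by simp
  qed
  show ?thesis using le[OF assms] le[of "star A x"] assms by simp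
qed

text \<open>In the unitization the equation says \<open>(1 - y)\<^sup>2 = 1 - a\<close>. It is solved as a fixed point of
  \<open>y \<mapsto> (a + y\<^sup>2) / 2\<close>, a contraction of the ball of radius \<open>1 - sqrt (1 - \<parallel>a\<parallel>)\<close>.\<close>

lemma one_minus_sqrt:
  assumes a: "a \<in> carrier A" "star A a = a" "alg_norm A a < 1"
  obtains y where "y \<in> carrier A" "star A y = y" "y \<oplus> y = a \<oplus> y \<otimes> y"
proof -
  define r where "r = alg_norm A a"
  define \<rho> where "\<rho> = 1 - sqrt (1 - r)"
  define f where "f y = (1/2) \<odot> (a \<oplus> y \<otimes> y)" for y
  define B where "B = {y \<in> carrier A. star A y = y \<and> alg_norm A y \<le> \<rho>}"
  have r: "0 \<le> r" "r < 1" using a norm_nonneg by (auto simp: r_def)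
  have \<rho>: "0 \<le> \<rho>" "\<rho> < 1" using r by (auto simp: \<rho>_def)
  have "(1 - \<rho>)\<^sup>2 = 1 - r" using r by (simp add: \<rho>_def)
  \<comment> \<open>\<open>\<rho>\<close> is the smaller root of
    \<open>t\<^sup>2 - 2 * t + r\<close>, that is, a fixed point of the scalar version of
    \<open>f\<close>; this is why \<open>f\<close> maps \<open>B\<close> into itself.\<close>
  then have r_eq: "r + \<rho> * \<rho> = 2 * \<rho>" by (simp add: power2_eq_square algebra_simps)
  have f_in: "f y \<in> B" if "y \<in> B" for y
  proof -
    have y: "y \<in> carrier A" "star A y = y" "alg_norm A y \<le> \<rho>" using that by (auto simp: B_def)
    have "alg_norm A (a \<oplus> y \<otimes> y) \<le> r + alg_norm A (y \<otimes> y)"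
      unfolding r_def using a y by (intro norm_triangle) auto
    also have "\<dots> \<le> r + \<rho> * \<rho>"
      using norm_mult[of y y] mult_mono[of "alg_norm A y" \<rho> "alg_norm A y" \<rho>] y \<rho> norm_nonneg[of y] by simp
    finally have "alg_norm A (f y) \<le> \<rho>"
      using a y r_eq by (simp add: f_def norm_smult)
    then show ?thesis using a y by (simp add: B_def f_def star_smult star_add star_mult)
  qed
  have contr: "alg_norm A (f y \<ominus> f z) \<le> \<rho> * alg_norm A (y \<ominus> z)" if "y \<in> B" "z \<in> B" for y z
  proof -
    have yz: "y \<in> carrier A" "z \<in> carrier A" "alg_norm A y \<le> \<rho>" "alg_norm A z \<le> \<rho>" using that by (auto simp: B_def)
    \<comment> \<open>A difference of squares without commutativity: the middle terms
      \<open>y \<otimes> z\<close> cancel.\<close>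
    have eq: "(a \<oplus> y \<otimes> y) \<ominus> (a \<oplus> z \<otimes> z) = y \<otimes> (y \<ominus> z) \<oplus> (y \<ominus> z) \<otimes> z"
      using a yz by (simp add: add_minus_add mult_minus_left mult_minus_right minus_add_minus)
    have "alg_norm A (y \<otimes> (y \<ominus> z) \<oplus> (y \<ominus> z) \<otimes> z)
        \<le> alg_norm A y * alg_norm A (y \<ominus> z) + alg_norm A (y \<ominus> z) * alg_norm A z"
      using yz by (intro order_trans[OF norm_triangle] add_mono norm_mult) auto
    also have "\<dots> \<le> \<rho> * alg_norm A (y \<ominus> z) + alg_norm A (y \<ominus> z) * \<rho>"
      using yz norm_nonneg[of "y \<ominus> z"] by (intro add_mono mult_mono) (auto simp: \<rho> norm_nonneg)
    finally have "alg_norm A ((a \<oplus> y \<otimes> y) \<ominus> (a \<oplus> z \<otimes> z)) \<le> 2 * (\<rho> * alg_norm A (y \<ominus> z))"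
      unfolding eq by simp
    moreover have "f y \<ominus> f z = (1/2) \<odot> ((a \<oplus> y \<otimes> y) \<ominus> (a \<oplus> z \<otimes> z))"
      using a yz by (simp add: f_def smult_minus)
    ultimately show ?thesis using a yz by (simp add: norm_smult)
  qed
  \<comment> \<open>Both conditions in \<open>B\<close> survive limits: the norm is continuous, and
    so is the star, being isometric by \<open>norm_star\<close>.\<close>
  have clos: "closedin mtopology B"
  proof -
    have "x \<in> B" if x: "x \<in> carrier A" and ap: "\<forall>\<epsilon>>0. \<exists>y\<in>B. alg_norm A (x \<ominus> y) < \<epsilon>" for x
    proof -
      have "alg_norm A x \<le> \<rho> + \<epsilon>" if "\<epsilon> > 0" for \<epsilon>
      proof -
        obtain y where y: "y \<in> B" "alg_norm A (x \<ominus> y) < \<epsilon>" using ap \<open>\<epsilon> > 0\<close> by blast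
        then show ?thesis using N_le_minus[of x y] x by (auto simp: B_def)
      qed
      then have "alg_norm A x \<le> \<rho>" by (rule field_le_epsilon)
      moreover have "alg_norm A (star A x \<ominus> x) \<le> 0 + \<epsilon>" if "\<epsilon> > 0" for \<epsilon>
      proof -
        obtain y where y: "y \<in> B" "alg_norm A (x \<ominus> y) < \<epsilon>/2" using ap \<open>\<epsilon> > 0\<close> half_gt_zero by blast
        have yc: "y \<in> carrier A" "star A y = y" using y by (auto simp: B_def)
        have "alg_norm A (star A x \<ominus> y) = alg_norm A (x \<ominus> y)"
          using norm_star[of "x \<ominus> y"] x yc by (simp add: star_minus)
        then show ?thesis
          using N_minus_triangle[of "star A x" y x] x yc y N_minus_commute[of x y] by simp
      qed
      then have "alg_norm A (star A x \<ominus> x) \<le> 0" by (rule field_le_epsilon)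
      then have "star A x \<ominus> x = \<zero>" using x norm_nonneg[of "star A x \<ominus> x"] N_eq_0_iff[of "star A x \<ominus> x"] by simp
      then have "star A x = x" using x by simp
      ultimately show ?thesis using x by (simp add: B_def)
    qed
    then show ?thesis
      using closedin_iff[of B] unfolding norm_topology_def by (auto simp: B_def)
  qed
  interpret B: Submetric "carrier A" "norm_dist A (alg_norm A)" B
    by unfold_locales (auto simp: B_def)
  have "B.sub.mcomplete"
    using B.closedin_mcomplete_imp_mcomplete clos complete by blast
  moreover have "\<zero> \<in> B" using \<rho> by (simp add: B_def)
  moreover have "norm_dist A (alg_norm A) (f x) (f y) \<le> \<rho> * norm_dist A (alg_norm A) x y" if "x \<in> B" "y \<in> B" for x y
    using that contr[OF that] f_in[OF that(1)] f_in[OF that(2)] by (auto simp: norm_dist_def B_def)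
  ultimately obtain y where y: "y \<in> B" "f y = y"
    using B.sub.Banach_fixedpoint_thm[of f \<rho>] f_in \<rho> by blast
  then have yc: "y \<in> carrier A" "star A y = y" by (auto simp: B_def)
  have "y \<oplus> y = 2 \<odot> f y" using yc y(2) add_smult[of y 1 1] by simp
  also have "\<dots> = a \<oplus> y \<otimes> y"
    using a yc by (simp add: f_def mult_smult[symmetric])
  finally show thesis using that yc by blast
qed

end


section \<open>Limits of sequences\<close>

context normed_module
begin

lemma complete_tendsto:
  fixes \<sigma> :: "nat \<Rightarrow> 'a"
  assumes "mcomplete" and c: "\<And>n. \<sigma> n \<in> carrier V"
    and "\<And>\<epsilon>. \<epsilon> > 0 \<Longrightarrow> \<exists>k. \<forall>m\<ge>k. \<forall>n\<ge>k. N (\<sigma> m \<ominus> \<sigma> n) < \<epsilon>"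
  obtains l where "l \<in> carrier V" "(\<lambda>n. N (\<sigma> n \<ominus> l)) \<longlonglongrightarrow> 0"
proof -
  obtain l where l: "l \<in> carrier V" "\<forall>\<epsilon>>0. \<exists>k. \<forall>n\<ge>k. N (\<sigma> n \<ominus> l) < \<epsilon>"
    using assms mcomplete_iff by blast
  have "(\<lambda>n. N (\<sigma> n \<ominus> l)) \<longlonglongrightarrow> 0"
    unfolding LIMSEQ_iff using l c by (simp add: N_nonneg)
  with l(1) show thesis using that by blast
qed

lemma tendsto_unique_limit:
  assumes "\<And>n. \<sigma> n \<in> carrier V" "l \<in> carrier V" "l' \<in> carrier V"
    and "(\<lambda>n::nat. N (\<sigma> n \<ominus> l)) \<longlonglongrightarrow> 0" "(\<lambda>n. N (\<sigma> n \<ominus> l')) \<longlonglongrightarrow> 0"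
  shows "l = l'"
proof -
  have "(\<lambda>n. N (\<sigma> n \<ominus> l) + N (\<sigma> n \<ominus> l')) \<longlonglongrightarrow> 0 + 0"
    using assms by (intro tendsto_add)
  moreover have "N (l \<ominus> l') \<le> N (\<sigma> n \<ominus> l) + N (\<sigma> n \<ominus> l')" for n
    using N_minus_triangle[of l "\<sigma> n" l'] N_minus_commute[of l "\<sigma> n"] assms by simp
  ultimately have "N (l \<ominus> l') \<le> 0"
    using LIMSEQ_le_const[of _ 0 "N (l \<ominus> l')"] by auto
  then show ?thesis using N_nonneg[of "l \<ominus> l'"] N_eq_0_iff[of "l \<ominus> l'"] assms by simp
qed

lemma tendsto_add_limit:
  assumes "\<And>n. \<sigma> n \<in> carrier V" "\<And>n. \<tau> n \<in> carrier V" "l \<in> carrier V" "l' \<in> carrier V"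
    and "(\<lambda>n::nat. N (\<sigma> n \<ominus> l)) \<longlonglongrightarrow> 0" "(\<lambda>n. N (\<tau> n \<ominus> l')) \<longlonglongrightarrow> 0"
  shows "(\<lambda>n. N ((\<sigma> n \<oplus> \<tau> n) \<ominus> (l \<oplus> l'))) \<longlonglongrightarrow> 0"
proof (rule tendsto_sandwich[of "\<lambda>_. 0" _ _ "\<lambda>n. N (\<sigma> n \<ominus> l) + N (\<tau> n \<ominus> l')"])
  show "(\<lambda>n. N (\<sigma> n \<ominus> l) + N (\<tau> n \<ominus> l')) \<longlonglongrightarrow> 0"
    using tendsto_add[OF assms(5,6)] by simp
qed (use assms in \<open>auto simp: N_nonneg N_add_minus_add_le\<close>)

lemma tendsto_smult_limit:
  assumes "\<And>n. \<sigma> n \<in> carrier V" "l \<in> carrier V" "(\<lambda>n::nat. N (\<sigma> n \<ominus> l)) \<longlonglongrightarrow> 0"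
  shows "(\<lambda>n. N (c \<odot> \<sigma> n \<ominus> c \<odot> l)) \<longlonglongrightarrow> 0"
  using tendsto_mult_right_zero[OF assms(3), of "cmod c"] assms
  by (simp add: smult_minus[symmetric] N_smult)

end


section \<open>Hilbert spaces\<close>

text \<open>Completeness is left out: the norm of \<open>ell2 X\<close> and its properties have to
  be available before that space is shown to be complete.\<close>

locale inner_product_module = module complex_ring H for H :: "'h hilbert" (structure) +
  assumes ip_add_l: "\<lbrakk>x \<in> carrier H; y \<in> carrier H; z \<in> carrier H\<rbrakk>
      \<Longrightarrow> ip H (x \<oplus> y) z = ip H x z + ip H y z"
    and ip_smult_l: "\<lbrakk>x \<in> carrier H; y \<in> carrier H\<rbrakk> \<Longrightarrow> ip H (c \<odot> x) y = c * ip H x y"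
    and ip_commute: "\<lbrakk>x \<in> carrier H; y \<in> carrier H\<rbrakk> \<Longrightarrow> ip H y x = cnj (ip H x y)"
    and ip_pos_def: "\<lbrakk>x \<in> carrier H; x \<noteq> \<zero>\<rbrakk> \<Longrightarrow> 0 < Re (ip H x x)"
begin

lemma ip_add_right: "\<lbrakk>x \<in> carrier H; y \<in> carrier H; z \<in> carrier H\<rbrakk> \<Longrightarrow> ip H x (y \<oplus> z) = ip H x y + ip H x z"
  using ip_commute[of x "y \<oplus> z"] ip_commute[of x y] ip_commute[of x z] ip_add_l[of y z x]
  by (metis M.a_closed complex_cnj_add complex_cnj_cnj)

lemma smult_H [simp, intro]: "x \<in> carrier H \<Longrightarrow> c \<odot> x \<in> carrier H"
  using smult_closed by simp

lemma ip_smult_right: "\<lbrakk>x \<in> carrier H; y \<in> carrier H\<rbrakk> \<Longrightarrow> ip H x (c \<odot> y) = cnj c * ip H x y"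
  using ip_commute[of x "c \<odot> y"] ip_commute[of x y] ip_smult_l[of y x c]
  by (metis complex_cnj_cnj complex_cnj_mult smult_H)

lemma ip_zero_left [simp]: "x \<in> carrier H \<Longrightarrow> ip H \<zero> x = 0"
  using ip_smult_l[of \<zero> x 0] smult_l_null[of \<zero>] by simp

lemma ip_zero_right [simp]: "x \<in> carrier H \<Longrightarrow> ip H x \<zero> = 0"
  using ip_commute[of \<zero> x] by simp

lemma Im_ip_self [simp]: "x \<in> carrier H \<Longrightarrow> Im (ip H x x) = 0"
  using ip_commute[of x x] by (simp add: complex_eq_iff)

lemma Re_ip_self_nonneg: "x \<in> carrier H \<Longrightarrow> 0 \<le> Re (ip H x x)"
  using ip_pos_def[of x] by (cases "x = \<zero>") auto

lemma hnorm_nonneg: "x \<in> carrier H \<Longrightarrow> 0 \<le> hnorm H x"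
  by (simp add: hnorm_def Re_ip_self_nonneg)

lemma hnorm_square: "x \<in> carrier H \<Longrightarrow> (hnorm H x)\<^sup>2 = Re (ip H x x)"
  by (simp add: hnorm_def Re_ip_self_nonneg)

lemma ip_self: "x \<in> carrier H \<Longrightarrow> ip H x x = complex_of_real ((hnorm H x)\<^sup>2)"
  by (simp add: complex_eq_iff hnorm_square)

lemma hnorm_eq_0: "x \<in> carrier H \<Longrightarrow> hnorm H x = 0 \<longleftrightarrow> x = \<zero>"
  using ip_pos_def[of x] by (cases "x = \<zero>") (auto simp: hnorm_def)

lemma hnorm_smult: assumes "x \<in> carrier H" shows "hnorm H (c \<odot> x) = cmod c * hnorm H x"
proof -
  have "ip H (c \<odot> x) (c \<odot> x) = (c * cnj c) * ip H x x"
    using assms by (simp add: ip_smult_l ip_smult_right)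
  then have "Re (ip H (c \<odot> x) (c \<odot> x)) = (cmod c)\<^sup>2 * Re (ip H x x)"
    by (simp add: complex_norm_square[symmetric] del: of_real_power)
  then show ?thesis by (simp add: hnorm_def real_sqrt_mult)
qed

lemma hnorm_square_add:
  assumes "x \<in> carrier H" "y \<in> carrier H"
  shows "(hnorm H (x \<oplus> y))\<^sup>2 = (hnorm H x)\<^sup>2 + 2 * Re (ip H x y) + (hnorm H y)\<^sup>2"
  using assms ip_commute[of x y] by (simp add: hnorm_square ip_add_l ip_add_right)

text \<open>Pythagoras for \<open>x\<close> and its component along \<open>y\<close>, which the
  added multiple of \<open>y\<close> removes. It yields \<open>Cauchy_Schwarz\<close>, and in
  \<open>orthogonal_projection\<close> it turns minimality into orthogonality.\<close>

lemma hnorm_square_add_projection: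
  assumes x: "x \<in> carrier H" and y: "y \<in> carrier H" "y \<noteq> \<zero>"
  shows "(hnorm H (x \<oplus> (- ip H x y / ip H y y) \<odot> y))\<^sup>2 = (hnorm H x)\<^sup>2 - (cmod (ip H x y))\<^sup>2 / (hnorm H y)\<^sup>2"
proof -
  define c where "c = - ip H x y / ip H y y"
  have ny: "hnorm H y \<noteq> 0" using y hnorm_eq_0 by simp
  have c: "c = - ip H x y / complex_of_real ((hnorm H y)\<^sup>2)" using y by (simp add: c_def ip_self)
  have cn: "cmod c = cmod (ip H x y) / (hnorm H y)\<^sup>2"
    by (simp add: c norm_divide norm_power)
  have cc: "cnj c = complex_of_real (- 1 / (hnorm H y)\<^sup>2) * cnj (ip H x y)" by (simp add: c)
  have "cnj c * ip H x y = complex_of_real (- 1 / (hnorm H y)\<^sup>2) * (ip H x y * cnj (ip H x y))"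
    unfolding cc by (simp only: mult_ac)
  also have "\<dots> = complex_of_real (- 1 / (hnorm H y)\<^sup>2 * (cmod (ip H x y))\<^sup>2)"
    by (simp only: complex_norm_square[symmetric] of_real_mult)
  finally have "Re (cnj c * ip H x y) = - (cmod (ip H x y))\<^sup>2 / (hnorm H y)\<^sup>2"
    by (simp only: Re_complex_of_real) simp
  then have "Re (ip H x (c \<odot> y)) = - (cmod (ip H x y))\<^sup>2 / (hnorm H y)\<^sup>2"
    using x y by (simp only: ip_smult_right)
  moreover have "(hnorm H (c \<odot> y))\<^sup>2 = (cmod (ip H x y))\<^sup>2 / (hnorm H y)\<^sup>2"
    using y ny by (simp add: hnorm_smult cn power_mult_distrib power_divide power2_eq_square)
  ultimately show ?thesis
    using hnorm_square_add[of x "c \<odot> y"] x y unfolding c_def[symmetric] by simp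
qed

lemma Cauchy_Schwarz:
  assumes "x \<in> carrier H" "y \<in> carrier H"
  shows "cmod (ip H x y) \<le> hnorm H x * hnorm H y"
proof (cases "y = \<zero>")
  case True then show ?thesis using assms hnorm_nonneg by simp
next
  case False
  then have "hnorm H y \<noteq> 0" using assms hnorm_eq_0 by simp
  have "(cmod (ip H x y))\<^sup>2 / (hnorm H y)\<^sup>2 \<le> (hnorm H x)\<^sup>2"
    using hnorm_square_add_projection[OF assms False] zero_le_power2 by (metis diff_ge_0_iff_ge)
  then have "(cmod (ip H x y))\<^sup>2 \<le> (hnorm H x * hnorm H y)\<^sup>2"
    using \<open>hnorm H y \<noteq> 0\<close> by (simp add: pos_divide_le_eq power_mult_distrib)
  then show ?thesis by (rule power2_le_imp_le) (use assms hnorm_nonneg in simp)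
qed

end

sublocale inner_product_module \<subseteq> normed_module H "hnorm H"
proof
  fix x y assume xy: "x \<in> carrier H" "y \<in> carrier H"
  have "Re (ip H x y) \<le> hnorm H x * hnorm H y"
    using Cauchy_Schwarz[OF xy] complex_Re_le_cmod order_trans by blast
  then have "(hnorm H (x \<oplus> y))\<^sup>2 \<le> (hnorm H x + hnorm H y)\<^sup>2"
    using hnorm_square_add[OF xy] by (simp add: power2_sum)
  then show "hnorm H (x \<oplus> y) \<le> hnorm H x + hnorm H y"
    by (rule power2_le_imp_le) (use xy hnorm_nonneg in simp)
qed (auto simp: hnorm_nonneg hnorm_eq_0 hnorm_smult)

context inner_product_module
begin

lemma ip_minus_left: "\<lbrakk>x \<in> carrier H; y \<in> carrier H; z \<in> carrier H\<rbrakk> \<Longrightarrow> ip H (x \<ominus> y) z = ip H x z - ip H y z"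
  by (simp add: minus_eq_smult ip_add_l ip_smult_l)

lemma ip_minus_right: "\<lbrakk>x \<in> carrier H; y \<in> carrier H; z \<in> carrier H\<rbrakk> \<Longrightarrow> ip H x (y \<ominus> z) = ip H x y - ip H x z"
  by (simp add: minus_eq_smult ip_add_right ip_smult_right)

lemma ip_ext_right:
  assumes "x \<in> carrier H" "y \<in> carrier H" "\<And>z. z \<in> carrier H \<Longrightarrow> ip H z x = ip H z y"
  shows "x = y"
proof -
  have "ip H (x \<ominus> y) (x \<ominus> y) = 0"
    using assms by (simp add: ip_minus_right)
  then have "x \<ominus> y = \<zero>" using ip_pos_def[of "x \<ominus> y"] assms by auto
  then show ?thesis using assms by simp
qed

lemma hnorm_square_minus:
  assumes "x \<in> carrier H" "y \<in> carrier H"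
  shows "(hnorm H (x \<ominus> y))\<^sup>2 = (hnorm H x)\<^sup>2 - 2 * Re (ip H x y) + (hnorm H y)\<^sup>2"
  using hnorm_square_add[of x "(- 1) \<odot> y"] assms
  by (simp add: minus_eq_smult ip_smult_right hnorm_smult)

lemma parallelogram:
  assumes "x \<in> carrier H" "y \<in> carrier H"
  shows "(hnorm H (x \<oplus> y))\<^sup>2 + (hnorm H (x \<ominus> y))\<^sup>2 = 2 * (hnorm H x)\<^sup>2 + 2 * (hnorm H y)\<^sup>2"
  using hnorm_square_add[OF assms] hnorm_square_minus[OF assms] by simp

end

sublocale hilbert_space \<subseteq> inner_product_module
  by unfold_locales (auto simp: ip_add_left ip_smult_left ip_pos intro: ip_cnj)

context hilbert_space
begin

theorem orthogonal_projection:
  assumes M: "submodule M complex_ring H" and cl: "closedin (norm_topology H (hnorm H)) M"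
    and x: "x \<in> carrier H"
  obtains m where "m \<in> M" "\<And>z. z \<in> M \<Longrightarrow> ip H (x \<ominus> m) z = 0"
proof -
  note Mm = submoduleE[OF M]
  have Mc: "m \<in> M \<Longrightarrow> m \<in> carrier H" for m using Mm(1) by auto
  define S where "S = (\<lambda>m. (hnorm H (x \<ominus> m))\<^sup>2) ` M"
  define d where "d = Inf S"
  have S: "S \<noteq> {}" "bdd_below S" using Mm(2) by (auto simp: S_def intro!: bdd_belowI[of _ 0])
  have d_le: "d \<le> (hnorm H (x \<ominus> m))\<^sup>2" if "m \<in> M" for m
    unfolding d_def using S that by (intro cInf_lower) (auto simp: S_def)
  have "\<exists>m. m \<in> M \<and> (hnorm H (x \<ominus> m))\<^sup>2 < d + 1 / Suc n" for n
  proof -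
    have "Inf S < d + 1 / Suc n" by (simp add: d_def)
    from cInf_lessD[OF S(1) this] show ?thesis by (auto simp: S_def)
  qed
  then obtain \<mu> where \<mu>: "\<And>n. \<mu> n \<in> M" "\<And>n. (hnorm H (x \<ominus> \<mu> n))\<^sup>2 < d + 1 / Suc n"
    using choice[of "\<lambda>n m. m \<in> M \<and> (hnorm H (x \<ominus> m))\<^sup>2 < d + 1 / Suc n"] by blast
  \<comment> \<open>The midpoint of \<open>\<mu> i\<close> and \<open>\<mu> j\<close> lies in
    \<open>M\<close>, so its squared distance from \<open>x\<close> is at least \<open>d\<close>;
    the parallelogram law for \<open>x \<ominus> \<mu> i\<close> and
    \<open>x \<ominus> \<mu> j\<close> then makes the sequence Cauchy.\<close>
  have diff: "(hnorm H (\<mu> i \<ominus> \<mu> j))\<^sup>2 \<le> 2 / Suc i + 2 / Suc j" for i j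
  proof -
    define a b where "a = x \<ominus> \<mu> i" and "b = x \<ominus> \<mu> j"
    have ab: "a \<in> carrier H" "b \<in> carrier H" using x Mc \<mu> by (auto simp: a_def b_def)
    have "b \<ominus> a = \<mu> i \<ominus> \<mu> j"
      using x Mc[OF \<mu>(1)] by (simp add: a_def b_def minus_minus_minus)
    moreover have "b \<oplus> a = 2 \<odot> (x \<ominus> (1/2) \<odot> (\<mu> i \<oplus> \<mu> j))"
      using x Mc[OF \<mu>(1)] add_smult[of x 1 1]
      by (simp add: a_def b_def minus_eq_smult smult_add mult_smult[symmetric] M.a_ac)
    ultimately have "(hnorm H (\<mu> i \<ominus> \<mu> j))\<^sup>2 + 4 * (hnorm H (x \<ominus> (1/2) \<odot> (\<mu> i \<oplus> \<mu> j)))\<^sup>2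
        = 2 * (hnorm H b)\<^sup>2 + 2 * (hnorm H a)\<^sup>2"
      using parallelogram[of b a] ab x Mc[OF \<mu>(1)] by (simp add: hnorm_smult power_mult_distrib)
    moreover have "d \<le> (hnorm H (x \<ominus> (1/2) \<odot> (\<mu> i \<oplus> \<mu> j)))\<^sup>2"
      using \<mu> Mm by (intro d_le) auto
    ultimately show ?thesis using \<mu>(2)[of i] \<mu>(2)[of j] by (simp add: a_def b_def)
  qed
  have "\<exists>k. \<forall>i\<ge>k. \<forall>j\<ge>k. hnorm H (\<mu> i \<ominus> \<mu> j) < \<epsilon>" if "\<epsilon> > 0" for \<epsilon>
  proof -
    obtain k where k: "1 / Suc k < \<epsilon>\<^sup>2 / 4" using nat_approx_posE[of "\<epsilon>\<^sup>2 / 4"] \<open>\<epsilon> > 0\<close> by auto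
    have "hnorm H (\<mu> i \<ominus> \<mu> j) < \<epsilon>" if "i \<ge> k" "j \<ge> k" for i j
    proof (rule power_less_imp_less_base[of _ 2])
      have "1 / real (Suc i) \<le> 1 / Suc k" "1 / real (Suc j) \<le> 1 / Suc k"
        using that by (auto intro!: divide_left_mono)
      then show "(hnorm H (\<mu> i \<ominus> \<mu> j))\<^sup>2 < \<epsilon>\<^sup>2" using diff[of i j] k by simp
    qed (use \<open>\<epsilon> > 0\<close> in simp)
    then show ?thesis by blast
  qed
  then obtain m where m: "m \<in> carrier H" "(\<lambda>n. hnorm H (\<mu> n \<ominus> m)) \<longlonglongrightarrow> 0"
    using complete_tendsto[OF complete, of \<mu>] Mc \<mu>(1) by blast
  have mM: "m \<in> M"
  proof -
    have "\<exists>y\<in>M. hnorm H (m \<ominus> y) < \<epsilon>" if "\<epsilon> > 0" for \<epsilon>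
    proof -
      have "\<forall>\<^sub>F n in sequentially. hnorm H (\<mu> n \<ominus> m) < \<epsilon>"
        using m(2) that by (rule order_tendstoD)
      then obtain n where "hnorm H (\<mu> n \<ominus> m) < \<epsilon>" by (auto simp: eventually_sequentially)
      then show ?thesis using \<mu>(1) Mc m(1) by (intro bexI[of _ "\<mu> n"]) (auto simp: N_minus_commute)
    qed
    then show ?thesis using cl m(1) unfolding closedin_iff by blast
  qed
  define w where "w = x \<ominus> m"
  have wc: "w \<in> carrier H" using x m by (simp add: w_def)
  have "hnorm H w \<le> sqrt d"
  proof (rule LIMSEQ_le_const)
    have "(\<lambda>n. sqrt (d + 1 / real (Suc n)) + hnorm H (\<mu> n \<ominus> m)) \<longlonglongrightarrow> sqrt (d + 0) + 0"
      by (intro tendsto_intros m(2) LIMSEQ_Suc[OF lim_1_over_n])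
    then show "(\<lambda>n. sqrt (d + 1 / real (Suc n)) + hnorm H (\<mu> n \<ominus> m)) \<longlonglongrightarrow> sqrt d" by simp
    have "hnorm H w \<le> sqrt (d + 1 / real (Suc n)) + hnorm H (\<mu> n \<ominus> m)" for n
    proof -
      have "hnorm H (x \<ominus> \<mu> n) \<le> sqrt (d + 1 / real (Suc n))"
        using \<mu>(2)[of n] x Mc[OF \<mu>(1)] by (intro real_le_rsqrt) simp
      then show ?thesis
        using N_minus_triangle[of x "\<mu> n" m] x m Mc[OF \<mu>(1)] by (simp add: w_def)
    qed
    then show "\<exists>k. \<forall>n\<ge>k. hnorm H w \<le> sqrt (d + 1 / real (Suc n)) + hnorm H (\<mu> n \<ominus> m)" by blast
  qed
  moreover have "0 \<le> d" unfolding d_def using S(1) by (intro cInf_greatest) (auto simp: S_def)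
  ultimately have wd: "(hnorm H w)\<^sup>2 \<le> d"
    using power_mono[of "hnorm H w" "sqrt d" 2] hnorm_nonneg[OF wc] by simp
  have "ip H w z = 0" if z: "z \<in> M" for z
  proof (cases "z = \<zero>")
    case True then show ?thesis using wc by simp
  next
    case False
    \<comment> \<open>With this \<open>c\<close> the point \<open>m \<oplus> c \<odot> z\<close> is
      the best correction of \<open>m\<close> in the direction of \<open>z\<close>; if
      \<open>ip H w z\<close> were not 0, it would be closer to \<open>x\<close> than
      \<open>d\<close> permits.\<close>
    define c where "c = ip H w z / ip H z z"
    have "m \<oplus> c \<odot> z \<in> M" using mM z Mm by auto
    then have "d \<le> (hnorm H (x \<ominus> (m \<oplus> c \<odot> z)))\<^sup>2" by (rule d_le)
    also have "x \<ominus> (m \<oplus> c \<odot> z) = w \<oplus> (- c) \<odot> z"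
      using x m Mc z by (simp add: w_def minus_eq_smult smult_add mult_smult[symmetric] M.a_assoc)
    also have "(hnorm H (w \<oplus> (- c) \<odot> z))\<^sup>2 = (hnorm H w)\<^sup>2 - (cmod (ip H w z))\<^sup>2 / (hnorm H z)\<^sup>2"
      using hnorm_square_add_projection[of w z] wc z Mc False by (simp add: c_def)
    finally have "(cmod (ip H w z))\<^sup>2 / (hnorm H z)\<^sup>2 \<le> 0" using wd by simp
    moreover have "(hnorm H z)\<^sup>2 > 0" using hnorm_eq_0 Mc z False by simp
    ultimately show ?thesis by (simp add: divide_le_0_iff)
  qed
  with mM show thesis using that by (simp add: w_def)
qed

theorem Riesz_representation:
  assumes add: "\<And>x y. \<lbrakk>x \<in> carrier H; y \<in> carrier H\<rbrakk> \<Longrightarrow> \<phi> (x \<oplus> y) = \<phi> x + \<phi> y"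
    and smul: "\<And>c x. x \<in> carrier H \<Longrightarrow> \<phi> (c \<odot> x) = c * \<phi> x"
    and bdd: "\<And>x. x \<in> carrier H \<Longrightarrow> cmod (\<phi> x) \<le> B * hnorm H x"
  obtains y where "y \<in> carrier H" "\<And>x. x \<in> carrier H \<Longrightarrow> \<phi> x = ip H x y"
proof (cases "\<forall>x\<in>carrier H. \<phi> x = 0")
  case True
  then show ?thesis using that[of \<zero>] by simp
next
  case False
  then obtain x0 where x0: "x0 \<in> carrier H" "\<phi> x0 \<noteq> 0" by blast
  define K where "K = {x \<in> carrier H. \<phi> x = 0}"
  have minus: "\<phi> (x \<ominus> y) = \<phi> x - \<phi> y" if "x \<in> carrier H" "y \<in> carrier H" for x y
    using that by (simp add: minus_eq_smult add smul)
  have \<phi>0: "\<phi> \<zero> = 0" using smul[of \<zero> 0] by simp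
  have K: "submodule K complex_ring H"
    by (rule submoduleI) (auto simp: K_def \<phi>0 add smul inv_eq_smult)
  have cl: "closedin (norm_topology H (hnorm H)) K"
    unfolding closedin_iff
  proof (intro conjI ballI impI)
    fix x assume x: "x \<in> carrier H" and ap: "\<forall>\<epsilon>>0. \<exists>y\<in>K. hnorm H (x \<ominus> y) < \<epsilon>"
    have "cmod (\<phi> x) \<le> 0 + e" if "e > 0" for e
    proof -
      define B' where "B' = max B 1"
      have B': "B' > 0" "B \<le> B'" by (auto simp: B'_def)
      obtain y where y: "y \<in> K" "hnorm H (x \<ominus> y) < e / B'"
        using ap \<open>e > 0\<close> B' divide_pos_pos by blast
      have yc: "y \<in> carrier H" "\<phi> y = 0" using y by (auto simp: K_def)
      have "cmod (\<phi> x) = cmod (\<phi> (x \<ominus> y))" using minus x yc by simp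
      also have "\<dots> \<le> B * hnorm H (x \<ominus> y)" using bdd x yc by simp
      also have "\<dots> \<le> B' * hnorm H (x \<ominus> y)" using B' x yc by (intro mult_right_mono) (auto simp: hnorm_nonneg)
      also have "\<dots> \<le> e" using y B' by (simp add: field_simps)
      finally show ?thesis by simp
    qed
    then have "cmod (\<phi> x) \<le> 0" by (rule field_le_epsilon)
    then show "x \<in> K" using x by (simp add: K_def)
  qed (auto simp: K_def)
  obtain m where m: "m \<in> K" "\<And>z. z \<in> K \<Longrightarrow> ip H (x0 \<ominus> m) z = 0"
    using orthogonal_projection[OF K cl x0(1)] by blast
  define w where "w = x0 \<ominus> m"
  have wc: "w \<in> carrier H" and w\<phi>: "\<phi> w \<noteq> 0"
    using m(1) x0 minus by (auto simp: w_def K_def)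
  have w0: "ip H w w \<noteq> 0"
    using w\<phi> ip_pos[OF wc] \<phi>0 by (cases "w = \<zero>") auto
  show ?thesis
  proof (rule that)
    show "cnj (\<phi> w / ip H w w) \<odot> w \<in> carrier H" using wc by simp
    fix x assume x: "x \<in> carrier H"
    \<comment> \<open>The functional vanishes on this combination, which is therefore orthogonal to
      \<open>w\<close>; solving for \<open>\<phi> x\<close> explains the scalar in the
      witness.\<close>
    have "\<phi> w \<odot> x \<ominus> \<phi> x \<odot> w \<in> K"
      using x wc by (simp add: K_def minus smul)
    then have "ip H w (\<phi> w \<odot> x \<ominus> \<phi> x \<odot> w) = 0" using m(2) by (simp add: w_def)
    then have "ip H (\<phi> w \<odot> x \<ominus> \<phi> x \<odot> w) w = 0"
      using ip_cnj[of w "\<phi> w \<odot> x \<ominus> \<phi> x \<odot> w"] x wc by simp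
    then have "\<phi> w * ip H x w = \<phi> x * ip H w w"
      using x wc by (simp add: ip_minus_left ip_smult_left)
    then show "\<phi> x = ip H x (cnj (\<phi> w / ip H w w) \<odot> w)"
      using x wc w0 by (simp add: ip_smult_right field_simps)
  qed
qed

end


section \<open>The C*-algebra of bounded operators\<close>

lemma bounded_operator_algebra_simps [simp]:
  "carrier (bounded_operator_algebra H) = bounded_operators H H"
  "S \<otimes>\<^bsub>bounded_operator_algebra H\<^esub> T = (\<lambda>x\<in>carrier H. S (T x))"
  "\<zero>\<^bsub>bounded_operator_algebra H\<^esub> = (\<lambda>x\<in>carrier H. \<zero>\<^bsub>H\<^esub>)"
  "S \<oplus>\<^bsub>bounded_operator_algebra H\<^esub> T = (\<lambda>x\<in>carrier H. S x \<oplus>\<^bsub>H\<^esub> T x)"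
  "c \<odot>\<^bsub>bounded_operator_algebra H\<^esub> T = (\<lambda>x\<in>carrier H. c \<odot>\<^bsub>H\<^esub> T x)"
  "star (bounded_operator_algebra H) = adjoint_operator H H"
  "alg_norm (bounded_operator_algebra H) = operator_norm H H"
  by (simp_all add: bounded_operator_algebra_def)

context hilbert_space
begin

abbreviation \<B> where "\<B> \<equiv> bounded_operators H H"
abbreviation adj where "adj \<equiv> adjoint_operator H H"
abbreviation opnorm where "opnorm \<equiv> operator_norm H H"

lemma bounded_operatorsI:
  assumes "T \<in> extensional (carrier H)" "\<And>x. x \<in> carrier H \<Longrightarrow> T x \<in> carrier H"
    and "\<And>x y. \<lbrakk>x \<in> carrier H; y \<in> carrier H\<rbrakk> \<Longrightarrow> T (x \<oplus> y) = T x \<oplus> T y"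
    and "\<And>c x. x \<in> carrier H \<Longrightarrow> T (c \<odot> x) = c \<odot> T x"
    and "\<And>x. x \<in> carrier H \<Longrightarrow> hnorm H (T x) \<le> B * hnorm H x"
  shows "T \<in> \<B>"
  using assms unfolding bounded_operators_def PiE_def by (auto intro!: exI[of _ B])

lemma bop_in [simp]: "\<lbrakk>T \<in> \<B>; x \<in> carrier H\<rbrakk> \<Longrightarrow> T x \<in> carrier H"
  by (auto simp: bounded_operators_def)

lemma bop_add: "\<lbrakk>T \<in> \<B>; x \<in> carrier H; y \<in> carrier H\<rbrakk> \<Longrightarrow> T (x \<oplus> y) = T x \<oplus> T y"
  by (auto simp: bounded_operators_def)

lemma bop_smult: "\<lbrakk>T \<in> \<B>; x \<in> carrier H\<rbrakk> \<Longrightarrow> T (c \<odot> x) = c \<odot> T x"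
  by (auto simp: bounded_operators_def)

lemma bop_zero: "T \<in> \<B> \<Longrightarrow> T \<zero> = \<zero>"
  using bop_smult[of T \<zero> 0] by simp

lemma bop_minus: "\<lbrakk>T \<in> \<B>; x \<in> carrier H; y \<in> carrier H\<rbrakk> \<Longrightarrow> T (x \<ominus> y) = T x \<ominus> T y"
  by (simp add: minus_eq_smult bop_add bop_smult)

lemma bop_ext: "\<lbrakk>S \<in> \<B>; T \<in> \<B>; \<And>x. x \<in> carrier H \<Longrightarrow> S x = T x\<rbrakk> \<Longrightarrow> S = T"
  by (rule PiE_ext[of S "carrier H" "\<lambda>_. carrier H"]) (auto simp: bounded_operators_def)

lemma bop_bound:
  assumes "T \<in> \<B>"
  shows "\<exists>B>0. \<forall>x\<in>carrier H. hnorm H (T x) \<le> B * hnorm H x"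
proof -
  obtain M where M: "\<forall>x\<in>carrier H. hnorm H (T x) \<le> M * hnorm H x"
    using assms by (auto simp: bounded_operators_def)
  have "hnorm H (T x) \<le> max M 1 * hnorm H x" if "x \<in> carrier H" for x
  proof -
    have "hnorm H (T x) \<le> M * hnorm H x" using M that by blast
    also have "\<dots> \<le> max M 1 * hnorm H x"
      using that by (intro mult_right_mono) (auto simp: hnorm_nonneg)
    finally show ?thesis .
  qed
  then show ?thesis by (intro exI[of _ "max M 1"]) simp
qed

lemma opnorm_bdd: assumes "T \<in> \<B>" shows "bdd_above ((\<lambda>x. hnorm H (T x)) ` {x \<in> carrier H. hnorm H x \<le> 1})"
proof -
  obtain B where B: "B > 0" "\<And>x. x \<in> carrier H \<Longrightarrow> hnorm H (T x) \<le> B * hnorm H x" using bop_bound[OF assms] by blast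
  have "hnorm H (T x) \<le> B" if "x \<in> carrier H" "hnorm H x \<le> 1" for x
  proof -
    have "B * hnorm H x \<le> B * 1" using that B(1) by (intro mult_left_mono) auto
    then show ?thesis using B(2)[OF that(1)] by simp
  qed
  then show ?thesis by (intro bdd_aboveI2) auto
qed

lemma opnorm_nonneg: assumes "T \<in> \<B>" shows "0 \<le> opnorm T"
proof -
  have "hnorm H (T \<zero>) \<le> opnorm T"
    unfolding operator_norm_def using opnorm_bdd[OF assms] by (intro cSUP_upper) auto
  then show ?thesis using assms by (simp add: bop_zero)
qed

lemma opnorm_bound: assumes "T \<in> \<B>" "x \<in> carrier H" shows "hnorm H (T x) \<le> opnorm T * hnorm H x"
proof (cases "x = \<zero>")
  case True then show ?thesis using assms by (simp add: bop_zero)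
next
  case False
  define n where "n = hnorm H x"
  have n: "n > 0" using False hnorm_eq_0 hnorm_nonneg assms by (simp add: n_def less_le)
  have "hnorm H (T (complex_of_real (1/n) \<odot> x)) \<le> opnorm T"
    unfolding operator_norm_def using opnorm_bdd[OF assms(1)] assms n
    by (intro cSUP_upper) (auto simp: hnorm_smult n_def[symmetric] norm_divide)
  then show ?thesis
    using assms n by (simp add: bop_smult hnorm_smult norm_divide n_def[symmetric] field_simps)
qed

lemma opnorm_le:
  assumes "0 \<le> B" "\<And>x. x \<in> carrier H \<Longrightarrow> hnorm H (T x) \<le> B * hnorm H x"
  shows "opnorm T \<le> B"
  unfolding operator_norm_def
proof (rule cSUP_least)
  show "{x \<in> carrier H. hnorm H x \<le> 1} \<noteq> {}" by (auto intro: exI[of _ \<zero>])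
  fix x assume "x \<in> {x \<in> carrier H. hnorm H x \<le> 1}"
  then have x: "x \<in> carrier H" "hnorm H x \<le> 1" by auto
  show "hnorm H (T x) \<le> B"
    using assms(2)[OF x(1)] mult_left_mono[OF x(2) assms(1)] by simp
qed

lemma zero_bop: "(\<lambda>x\<in>carrier H. \<zero>) \<in> \<B>"
  by (rule bounded_operatorsI[where B=0]) auto

lemma add_bop: assumes "S \<in> \<B>" "T \<in> \<B>" shows "(\<lambda>x\<in>carrier H. S x \<oplus> T x) \<in> \<B>"
proof (rule bounded_operatorsI[where B="opnorm S + opnorm T"])
  fix x assume "x \<in> carrier H"
  then show "hnorm H ((\<lambda>x\<in>carrier H. S x \<oplus> T x) x) \<le> (opnorm S + opnorm T) * hnorm H x"
    using N_triangle[of "S x" "T x"] opnorm_bound[OF assms(1)] opnorm_bound[OF assms(2)] assms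
    by (simp add: distrib_right) (smt (verit))
qed (use assms in \<open>auto simp: bop_add bop_smult M.a_ac smult_add\<close>)

lemma smult_bop: assumes "T \<in> \<B>" shows "(\<lambda>x\<in>carrier H. c \<odot> T x) \<in> \<B>"
proof (rule bounded_operatorsI[where B="cmod c * opnorm T"])
  fix x assume "x \<in> carrier H"
  then show "hnorm H ((\<lambda>x\<in>carrier H. c \<odot> T x) x) \<le> (cmod c * opnorm T) * hnorm H x"
    using mult_left_mono[OF opnorm_bound[OF assms], of x "cmod c"] assms by (simp add: hnorm_smult mult.assoc)
qed (use assms in \<open>auto simp: bop_add bop_smult smult_add mult_smult[symmetric] mult.commute\<close>)

lemma comp_bound: "\<lbrakk>S \<in> \<B>; T \<in> \<B>; x \<in> carrier H\<rbrakk> \<Longrightarrow> hnorm H (S (T x)) \<le> opnorm S * opnorm T * hnorm H x"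
  using opnorm_bound[of S "T x"] mult_left_mono[OF opnorm_bound[of T x], of "opnorm S"]
    opnorm_nonneg[of S] by (simp add: mult.assoc)

lemma comp_bop: assumes "S \<in> \<B>" "T \<in> \<B>" shows "(\<lambda>x\<in>carrier H. S (T x)) \<in> \<B>"
  by (rule bounded_operatorsI[where B="opnorm S * opnorm T"])
    (use assms in \<open>auto simp: bop_add bop_smult comp_bound\<close>)

text \<open>Justifies the \<open>THE\<close> in \<open>adjoint_operator\<close>: the functional that
  sends \<open>z\<close> to \<open>ip H (T z) y\<close> is bounded, so it is represented by a
  vector, and inner products determine that vector.\<close>

lemma adj_ex1:
  assumes T: "T \<in> \<B>" and y: "y \<in> carrier H"
  shows "\<exists>!x. x \<in> carrier H \<and> (\<forall>z\<in>carrier H. ip H (T z) y = ip H z x)"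
proof -
  have "cmod (ip H (T z) y) \<le> (opnorm T * hnorm H y) * hnorm H z" if z: "z \<in> carrier H" for z
    using Cauchy_Schwarz[of "T z" y] mult_right_mono[OF opnorm_bound[OF T z], of "hnorm H y"] T y z
    by (simp add: hnorm_nonneg mult_ac)
  then obtain x where x: "x \<in> carrier H" "\<And>z. z \<in> carrier H \<Longrightarrow> ip H (T z) y = ip H z x"
    by (rule Riesz_representation[of "\<lambda>z. ip H (T z) y" "opnorm T * hnorm H y", rotated 2])
      (use T y in \<open>auto simp: bop_add bop_smult ip_add_left ip_smult_left\<close>)
  show ?thesis
  proof (rule ex1I[of _ x])
    fix x' assume "x' \<in> carrier H \<and> (\<forall>z\<in>carrier H. ip H (T z) y = ip H z x')"
    then show "x' = x" using x by (intro ip_ext_right) auto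
  qed (use x in auto)
qed

lemma adj_characterization:
  assumes "T \<in> \<B>" "y \<in> carrier H"
  shows "adj T y \<in> carrier H \<and> (\<forall>z\<in>carrier H. ip H (T z) y = ip H z (adj T y))"
proof -
  define P where "P x \<longleftrightarrow> x \<in> carrier H \<and> (\<forall>z\<in>carrier H. ip H (T z) y = ip H z x)" for x
  have "P (The P)"
    using theI'[OF adj_ex1[OF assms]] unfolding P_def .
  moreover have "adj T y = The P"
    using assms by (simp only: adjoint_operator_def restrict_apply' P_def[abs_def])
  ultimately show ?thesis unfolding P_def by metis
qed

lemma adj_in [simp]: "\<lbrakk>T \<in> \<B>; y \<in> carrier H\<rbrakk> \<Longrightarrow> adj T y \<in> carrier H"
  using adj_characterization by blast

lemma ip_adj: "\<lbrakk>T \<in> \<B>; x \<in> carrier H; y \<in> carrier H\<rbrakk> \<Longrightarrow> ip H x (adj T y) = ip H (T x) y"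
  using adj_characterization[of T y] by simp

lemma ip_adj_left: "\<lbrakk>T \<in> \<B>; x \<in> carrier H; y \<in> carrier H\<rbrakk> \<Longrightarrow> ip H (adj T x) y = ip H x (T y)"
  using ip_adj[of T y x] ip_cnj[of y "adj T x"] ip_cnj[of "T y" x] by simp

lemma adj_eqI:
  assumes "T \<in> \<B>" "S \<in> \<B>" "\<And>x y. \<lbrakk>x \<in> carrier H; y \<in> carrier H\<rbrakk> \<Longrightarrow> ip H (T x) y = ip H x (S y)"
  shows "adj T = S"
proof (rule PiE_ext[of _ "carrier H" "\<lambda>_. carrier H"])
  show "adj T \<in> carrier H \<rightarrow>\<^sub>E carrier H"
    using assms adj_in unfolding adjoint_operator_def by (auto simp: adjoint_operator_def)
  show "S \<in> carrier H \<rightarrow>\<^sub>E carrier H" using assms by (auto simp: bounded_operators_def)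
  fix y assume "y \<in> carrier H"
  then show "adj T y = S y" using assms by (intro ip_ext_right) (auto simp: ip_adj)
qed

text \<open>With \<open>a\<close> the norm of \<open>adj T x\<close>, Cauchy-Schwarz gives
  \<open>a * a \<le> opnorm T * a * hnorm H x\<close>, and \<open>a\<close> cancels unless it is
  0.\<close>

lemma adj_bound: assumes T: "T \<in> \<B>" and x: "x \<in> carrier H" shows "hnorm H (adj T x) \<le> opnorm T * hnorm H x"
proof -
  define a where "a = hnorm H (adj T x)"
  have "ip H (T (adj T x)) x = complex_of_real (a\<^sup>2)"
    using ip_adj[of T "adj T x" x] ip_self[of "adj T x"] T x by (simp add: a_def)
  then have "a * a = cmod (ip H (T (adj T x)) x)"
    by (simp only: norm_of_real) (simp add: power2_eq_square)
  also have "\<dots> \<le> hnorm H (T (adj T x)) * hnorm H x" using T x by (intro Cauchy_Schwarz) auto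
  also have "\<dots> \<le> (opnorm T * a) * hnorm H x"
    using T x unfolding a_def by (intro mult_right_mono opnorm_bound) (auto simp: hnorm_nonneg)
  finally have "a * a \<le> (opnorm T * hnorm H x) * a" by (simp add: mult_ac)
  moreover have "0 \<le> a" using T x by (simp add: a_def hnorm_nonneg)
  moreover have "0 \<le> opnorm T * hnorm H x" using T x by (simp add: hnorm_nonneg opnorm_nonneg)
  ultimately show ?thesis unfolding a_def[symmetric] by (cases "a = 0") auto
qed

lemma adj_bop: assumes T: "T \<in> \<B>" shows "adj T \<in> \<B>"
proof (rule bounded_operatorsI[where B="opnorm T"])
  show "adj T \<in> extensional (carrier H)" by (simp add: adjoint_operator_def)
  fix x y assume xy: "x \<in> carrier H" "y \<in> carrier H"
  show "adj T (x \<oplus> y) = adj T x \<oplus> adj T y"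
    using T xy by (intro ip_ext_right) (auto simp: ip_adj ip_add_right)
next
  fix c x assume "x \<in> carrier H"
  then show "adj T (c \<odot> x) = c \<odot> adj T x"
    using T by (intro ip_ext_right) (auto simp: ip_adj ip_smult_right)
qed (use T in \<open>auto simp: adj_bound\<close>)

lemma adj_adj: "T \<in> \<B> \<Longrightarrow> adj (adj T) = T"
  by (rule adj_eqI) (auto simp: adj_bop ip_adj_left)

text \<open>One inequality is \<open>adj_bound\<close>; the other holds because
  \<open>(hnorm H (T x))\<^sup>2\<close> is the inner product of \<open>x\<close> with
  \<open>adj T (T x)\<close>.\<close>

lemma opnorm_adj_comp: assumes T: "T \<in> \<B>" shows "opnorm (\<lambda>x\<in>carrier H. adj T (T x)) = (opnorm T)\<^sup>2"
proof (rule antisym)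
  show "opnorm (\<lambda>x\<in>carrier H. adj T (T x)) \<le> (opnorm T)\<^sup>2"
  proof (rule opnorm_le)
    fix x assume x: "x \<in> carrier H"
    have "hnorm H (adj T (T x)) \<le> opnorm T * hnorm H (T x)" using T x by (intro adj_bound) auto
    also have "\<dots> \<le> opnorm T * (opnorm T * hnorm H x)"
      using T x by (intro mult_left_mono opnorm_bound opnorm_nonneg)
    finally show "hnorm H ((\<lambda>x\<in>carrier H. adj T (T x)) x) \<le> (opnorm T)\<^sup>2 * hnorm H x"
      using x by (simp add: power2_eq_square mult_ac)
  qed simp
  define P where "P = (\<lambda>x\<in>carrier H. adj T (T x))"
  have P: "P \<in> \<B>" unfolding P_def using T adj_bop comp_bop by blast
  have "opnorm T \<le> sqrt (opnorm P)"
  proof (rule opnorm_le)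
    fix x assume x: "x \<in> carrier H"
    have "(hnorm H (T x))\<^sup>2 = Re (ip H x (P x))"
      using T x by (simp add: P_def ip_adj hnorm_square)
    also have "\<dots> \<le> cmod (ip H x (P x))" by (rule complex_Re_le_cmod)
    also have "\<dots> \<le> hnorm H x * hnorm H (P x)" using P x by (intro Cauchy_Schwarz) auto
    also have "\<dots> \<le> hnorm H x * (opnorm P * hnorm H x)"
      using P x by (intro mult_left_mono opnorm_bound) (auto simp: hnorm_nonneg)
    also have "\<dots> = (sqrt (opnorm P) * hnorm H x)\<^sup>2"
      using opnorm_nonneg[OF P] by (simp add: power_mult_distrib) (simp add: power2_eq_square mult_ac)
    finally show "hnorm H (T x) \<le> sqrt (opnorm P) * hnorm H x"
      by (rule power2_le_imp_le) (use x P in \<open>simp add: opnorm_nonneg hnorm_nonneg\<close>)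
  qed (simp add: opnorm_nonneg P)
  from power_mono[OF this opnorm_nonneg[OF T], of 2]
  show "(opnorm T)\<^sup>2 \<le> opnorm (\<lambda>x\<in>carrier H. adj T (T x))"
    using opnorm_nonneg[OF P] by (simp add: P_def[symmetric])
qed

lemma module_bop: "module complex_ring (bounded_operator_algebra H)"
proof (rule moduleI[OF cring_complex_ring])
  let ?B = "bounded_operator_algebra H"
  show "abelian_group ?B"
  proof (rule abelian_groupI)
    fix S assume "S \<in> carrier ?B"
    then have S: "S \<in> \<B>" by simp
    show "\<exists>T\<in>carrier ?B. T \<oplus>\<^bsub>?B\<^esub> S = \<zero>\<^bsub>?B\<^esub>"
      using S smult_bop[OF S, of "- 1"]
      by (intro bexI[of _ "\<lambda>x\<in>carrier H. (- 1) \<odot> S x"])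
        (auto simp: fun_eq_iff inv_eq_smult[symmetric] M.l_neg)
    show "\<zero>\<^bsub>?B\<^esub> \<oplus>\<^bsub>?B\<^esub> S = S"
      using S zero_bop add_bop[OF zero_bop S] by (intro bop_ext) simp_all
  qed (auto simp: zero_bop add_bop M.a_ac fun_eq_iff)
  fix S assume "S \<in> carrier ?B"
  then have S: "S \<in> \<B>" by simp
  show "\<one>\<^bsub>complex_ring\<^esub> \<odot>\<^bsub>?B\<^esub> S = S"
    using S smult_bop by (intro bop_ext) auto
qed (auto simp: smult_bop add_smult smult_add mult_smult fun_eq_iff)

lemma opnorm_normed_module: "normed_module (bounded_operator_algebra H) opnorm"
proof -
  interpret B: module complex_ring "bounded_operator_algebra H" by (rule module_bop)
  show ?thesis
  proof
    fix S T c assume "S \<in> carrier (bounded_operator_algebra H)"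
    then have S: "S \<in> \<B>" by simp
    show "0 \<le> opnorm S" using S by (rule opnorm_nonneg)
    show "opnorm S = 0 \<longleftrightarrow> S = \<zero>\<^bsub>bounded_operator_algebra H\<^esub>"
    proof
      assume "opnorm S = 0"
      then have "S x = \<zero>" if "x \<in> carrier H" for x
        using opnorm_bound[OF S that] hnorm_nonneg[of "S x"] hnorm_eq_0[of "S x"] S that by simp
      then show "S = \<zero>\<^bsub>bounded_operator_algebra H\<^esub>" using S zero_bop by (intro bop_ext) auto
    next
      assume "S = \<zero>\<^bsub>bounded_operator_algebra H\<^esub>"
      then show "opnorm S = 0" using opnorm_le[of 0 S] opnorm_nonneg[OF S] by simp
    qed
    have *: "opnorm (\<lambda>x\<in>carrier H. c \<odot> S x) \<le> cmod c * opnorm S" if S: "S \<in> \<B>" for c S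
      by (rule opnorm_le)
        (use S opnorm_bound[OF S] in \<open>auto simp: hnorm_smult opnorm_nonneg mult.assoc intro!: mult_left_mono\<close>)
    show "opnorm (c \<odot>\<^bsub>bounded_operator_algebra H\<^esub> S) = cmod c * opnorm S"
    proof (cases "c = 0")
      case True then show ?thesis using *[OF S, of c] opnorm_nonneg[OF smult_bop[OF S, of c]] by simp
    next
      case False
      have "(\<lambda>x\<in>carrier H. (1/c) \<odot> (\<lambda>x\<in>carrier H. c \<odot> S x) x) = S"
        using S False smult_bop[OF smult_bop[OF S]] by (intro bop_ext) (auto simp: mult_smult[symmetric])
      then have "opnorm S \<le> cmod (1/c) * opnorm (\<lambda>x\<in>carrier H. c \<odot> S x)"
        using *[OF smult_bop[OF S], of "1/c" c] by simp
      then have "cmod c * opnorm S \<le> opnorm (\<lambda>x\<in>carrier H. c \<odot> S x)"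
        using False by (simp add: norm_divide field_simps)
      then show ?thesis using *[OF S, of c] by simp
    qed
    assume "T \<in> carrier (bounded_operator_algebra H)"
    then have T: "T \<in> \<B>" by simp
    show "opnorm (S \<oplus>\<^bsub>bounded_operator_algebra H\<^esub> T) \<le> opnorm S + opnorm T"
    proof (rule opnorm_le)
      fix x assume x: "x \<in> carrier H"
      have "hnorm H (S x \<oplus> T x) \<le> hnorm H (S x) + hnorm H (T x)" using S T x by (intro N_triangle) auto
      also have "\<dots> \<le> opnorm S * hnorm H x + opnorm T * hnorm H x"
        using S T x by (intro add_mono opnorm_bound)
      finally show "hnorm H ((S \<oplus>\<^bsub>bounded_operator_algebra H\<^esub> T) x) \<le> (opnorm S + opnorm T) * hnorm H x"
        using x by (simp add: distrib_right)
    qed (use S T in \<open>simp add: opnorm_nonneg\<close>)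
  qed
qed

sublocale B: normed_module "bounded_operator_algebra H" opnorm
  by (rule opnorm_normed_module)

lemma bop_minus_apply:
  assumes "S \<in> \<B>" "T \<in> \<B>" "x \<in> carrier H"
  shows "(S \<ominus>\<^bsub>bounded_operator_algebra H\<^esub> T) x = S x \<ominus> T x"
  using assms by (simp add: B.minus_eq_smult minus_eq_smult)

lemma bop_complete: "B.mcomplete"
  unfolding B.mcomplete_iff
proof (intro allI impI, elim conjE)
  fix \<sigma> :: "nat \<Rightarrow> 'h \<Rightarrow> 'h"
  assume "\<forall>n. \<sigma> n \<in> carrier (bounded_operator_algebra H)"
  then have \<sigma>: "\<And>n. \<sigma> n \<in> \<B>" by simp
  assume Cauchy: "\<forall>\<epsilon>>0. \<exists>k. \<forall>m\<ge>k. \<forall>n\<ge>k. opnorm (\<sigma> m \<ominus>\<^bsub>bounded_operator_algebra H\<^esub> \<sigma> n) < \<epsilon>"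
  have bd: "hnorm H (\<sigma> m x \<ominus> \<sigma> n x) \<le> opnorm (\<sigma> m \<ominus>\<^bsub>bounded_operator_algebra H\<^esub> \<sigma> n) * hnorm H x"
    if "x \<in> carrier H" for m n x
    using opnorm_bound[of "\<sigma> m \<ominus>\<^bsub>bounded_operator_algebra H\<^esub> \<sigma> n" x] B.minus_in[of "\<sigma> m" "\<sigma> n"] \<sigma> that
    by (simp add: bop_minus_apply)
  have Cx: "\<exists>k. \<forall>m\<ge>k. \<forall>n\<ge>k. hnorm H (\<sigma> m x \<ominus> \<sigma> n x) < \<epsilon>" if x: "x \<in> carrier H" and "\<epsilon> > 0" for x \<epsilon>
  proof -
    have pos: "hnorm H x + 1 > 0" using hnorm_nonneg[OF x] by simp
    then obtain k where k: "\<forall>m\<ge>k. \<forall>n\<ge>k. opnorm (\<sigma> m \<ominus>\<^bsub>bounded_operator_algebra H\<^esub> \<sigma> n) < \<epsilon> / (hnorm H x + 1)"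
      using Cauchy \<open>\<epsilon> > 0\<close> divide_pos_pos by blast
    have "hnorm H (\<sigma> m x \<ominus> \<sigma> n x) < \<epsilon>" if "m \<ge> k" "n \<ge> k" for m n
    proof -
      have "hnorm H (\<sigma> m x \<ominus> \<sigma> n x) \<le> \<epsilon> / (hnorm H x + 1) * hnorm H x"
        using k that by (intro order_trans[OF bd[OF x]] mult_right_mono hnorm_nonneg x) (auto intro: less_imp_le)
      also have "\<dots> < \<epsilon>" using pos \<open>\<epsilon> > 0\<close> hnorm_nonneg[OF x] by (simp add: field_simps)
      finally show ?thesis .
    qed
    then show ?thesis by blast
  qed
  have "\<exists>l. x \<in> carrier H \<longrightarrow> l \<in> carrier H \<and> (\<lambda>n. hnorm H (\<sigma> n x \<ominus> l)) \<longlonglongrightarrow> 0" for x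
    using complete_tendsto[OF complete, of "\<lambda>n. \<sigma> n x"] \<sigma> Cx by (metis bop_in)
  then obtain L0 where L0: "\<And>x. x \<in> carrier H \<Longrightarrow> L0 x \<in> carrier H"
    "\<And>x. x \<in> carrier H \<Longrightarrow> (\<lambda>n. hnorm H (\<sigma> n x \<ominus> L0 x)) \<longlonglongrightarrow> 0"
    using choice[of "\<lambda>x l. x \<in> carrier H \<longrightarrow> l \<in> carrier H \<and> (\<lambda>n. hnorm H (\<sigma> n x \<ominus> l)) \<longlonglongrightarrow> 0"] by blast
  \<comment> \<open>Operators are extensional, so the pointwise limit is cut off outside the
    carrier.\<close>
  define L where "L = restrict L0 (carrier H)"
  \<comment> \<open>Letting \<open>m\<close> tend to infinity in the Cauchy estimate keeps the bound
    uniform on the unit ball, which upgrades pointwise convergence to convergence in norm.\<close>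
  have close: "hnorm H (\<sigma> n x \<ominus> L0 x) \<le> \<epsilon> * hnorm H x"
    if k: "\<forall>m\<ge>k. \<forall>n\<ge>k. opnorm (\<sigma> m \<ominus>\<^bsub>bounded_operator_algebra H\<^esub> \<sigma> n) < \<epsilon>" and n: "n \<ge> k" and x: "x \<in> carrier H" for k \<epsilon> n x
  proof (rule LIMSEQ_le_const)
    show "(\<lambda>m. \<epsilon> * hnorm H x + hnorm H (\<sigma> m x \<ominus> L0 x)) \<longlonglongrightarrow> \<epsilon> * hnorm H x"
      using tendsto_add[OF tendsto_const L0(2)[OF x]] by simp
    have "hnorm H (\<sigma> n x \<ominus> L0 x) \<le> \<epsilon> * hnorm H x + hnorm H (\<sigma> m x \<ominus> L0 x)" if "m \<ge> k" for m
    proof -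
      have "hnorm H (\<sigma> n x \<ominus> \<sigma> m x) \<le> \<epsilon> * hnorm H x"
        using k n that by (intro order_trans[OF bd[OF x]] mult_right_mono hnorm_nonneg x) (auto intro: less_imp_le)
      then show ?thesis using N_minus_triangle[of "\<sigma> n x" "\<sigma> m x" "L0 x"] \<sigma> x L0(1) by simp
    qed
    then show "\<exists>k. \<forall>m\<ge>k. hnorm H (\<sigma> n x \<ominus> L0 x) \<le> \<epsilon> * hnorm H x + hnorm H (\<sigma> m x \<ominus> L0 x)" by blast
  qed
  have L: "L \<in> \<B>"
  proof -
    obtain k where k: "\<forall>m\<ge>k. \<forall>n\<ge>k. opnorm (\<sigma> m \<ominus>\<^bsub>bounded_operator_algebra H\<^esub> \<sigma> n) < 1"
      using Cauchy zero_less_one by blast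
    show ?thesis
    proof (rule bounded_operatorsI[where B="opnorm (\<sigma> k) + 1"])
      fix x y assume xy: "x \<in> carrier H" "y \<in> carrier H"
      have "L0 (x \<oplus> y) = L0 x \<oplus> L0 y"
      proof (rule tendsto_unique_limit[of "\<lambda>n. \<sigma> n (x \<oplus> y)"])
        show "(\<lambda>n. hnorm H (\<sigma> n (x \<oplus> y) \<ominus> (L0 x \<oplus> L0 y))) \<longlonglongrightarrow> 0"
          using tendsto_add_limit[of "\<lambda>n. \<sigma> n x" "\<lambda>n. \<sigma> n y" "L0 x" "L0 y"] \<sigma> xy L0 by (simp add: bop_add)
      qed (use \<sigma> xy L0 in auto)
      then show "L (x \<oplus> y) = L x \<oplus> L y" using xy by (simp add: L_def)
    next
      fix c x assume x: "x \<in> carrier H"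
      have "L0 (c \<odot> x) = c \<odot> L0 x"
      proof (rule tendsto_unique_limit[of "\<lambda>n. \<sigma> n (c \<odot> x)"])
        show "(\<lambda>n. hnorm H (\<sigma> n (c \<odot> x) \<ominus> (c \<odot> L0 x))) \<longlonglongrightarrow> 0"
          using tendsto_smult_limit[of "\<lambda>n. \<sigma> n x" "L0 x" c] \<sigma> x L0 by (simp add: bop_smult)
      qed (use \<sigma> x L0 in auto)
      then show "L (c \<odot> x) = c \<odot> L x" using x by (simp add: L_def)
    next
      fix x assume x: "x \<in> carrier H"
      show "hnorm H (L x) \<le> (opnorm (\<sigma> k) + 1) * hnorm H x"
        using close[OF k, of k x] N_le_minus[of "L0 x" "\<sigma> k x"] N_minus_commute[of "L0 x" "\<sigma> k x"]
          opnorm_bound[OF \<sigma> x, of k] x L0 \<sigma> by (simp add: L_def distrib_right)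
    qed (auto simp: L_def L0)
  qed
  show "\<exists>l\<in>carrier (bounded_operator_algebra H). \<forall>\<epsilon>>0. \<exists>k. \<forall>n\<ge>k. opnorm (\<sigma> n \<ominus>\<^bsub>bounded_operator_algebra H\<^esub> l) < \<epsilon>"
  proof (intro bexI[of _ L] allI impI)
    fix \<epsilon> :: real assume "\<epsilon> > 0"
    then obtain k where k: "\<forall>m\<ge>k. \<forall>n\<ge>k. opnorm (\<sigma> m \<ominus>\<^bsub>bounded_operator_algebra H\<^esub> \<sigma> n) < \<epsilon>/2"
      using Cauchy half_gt_zero by blast
    have "opnorm (\<sigma> n \<ominus>\<^bsub>bounded_operator_algebra H\<^esub> L) < \<epsilon>" if "n \<ge> k" for n
    proof -
      have "opnorm (\<sigma> n \<ominus>\<^bsub>bounded_operator_algebra H\<^esub> L) \<le> \<epsilon>/2"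
      proof (rule opnorm_le)
        fix x assume x: "x \<in> carrier H"
        show "hnorm H ((\<sigma> n \<ominus>\<^bsub>bounded_operator_algebra H\<^esub> L) x) \<le> \<epsilon>/2 * hnorm H x"
          unfolding bop_minus_apply[OF \<sigma> L x] using close[OF k that x] x by (simp add: L_def)
      qed (use \<open>\<epsilon> > 0\<close> in simp)
      then show ?thesis using \<open>\<epsilon> > 0\<close> by simp
    qed
    then show "\<exists>k. \<forall>n\<ge>k. opnorm (\<sigma> n \<ominus>\<^bsub>bounded_operator_algebra H\<^esub> L) < \<epsilon>" by blast
  qed (use L in simp)
qed

theorem cstar_bounded_operator_algebra: "cstar_algebra (bounded_operator_algebra H)"
proof
  let ?B = "bounded_operator_algebra H"
  fix S T assume "S \<in> carrier ?B"
  then have S: "S \<in> \<B>" by simp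
  show "star ?B S \<in> carrier ?B" using S by (simp add: adj_bop)
  show "star ?B (star ?B S) = S" using S by (simp add: adj_adj)
  show "star ?B (c \<odot>\<^bsub>?B\<^esub> S) = cnj c \<odot>\<^bsub>?B\<^esub> star ?B S" for c
    using S by (auto intro!: adj_eqI simp: adj_bop smult_bop ip_smult_left ip_smult_right ip_adj)
  show "alg_norm ?B (star ?B S \<otimes>\<^bsub>?B\<^esub> S) = (alg_norm ?B S)\<^sup>2"
    using S by (simp add: opnorm_adj_comp)
  show "0 \<le> alg_norm ?B S" using S by (simp add: opnorm_nonneg)
  show "alg_norm ?B S = 0 \<longleftrightarrow> S = \<zero>\<^bsub>?B\<^esub>" using B.N_eq_0_iff[of S] S by simp
  show "alg_norm ?B (c \<odot>\<^bsub>?B\<^esub> S) = cmod c * alg_norm ?B S" for c using B.N_smult[of S] S by simp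
  assume "T \<in> carrier ?B"
  then have T: "T \<in> \<B>" by simp
  show "S \<otimes>\<^bsub>?B\<^esub> T \<in> carrier ?B" using S T by (simp add: comp_bop)
  show "star ?B (S \<oplus>\<^bsub>?B\<^esub> T) = star ?B S \<oplus>\<^bsub>?B\<^esub> star ?B T"
    using S T by (auto intro!: adj_eqI simp: adj_bop add_bop ip_add_left ip_add_right ip_adj)
  show "star ?B (S \<otimes>\<^bsub>?B\<^esub> T) = star ?B T \<otimes>\<^bsub>?B\<^esub> star ?B S"
    using S T by (auto intro!: adj_eqI simp: adj_bop comp_bop ip_adj)
  show "(c \<odot>\<^bsub>?B\<^esub> S) \<otimes>\<^bsub>?B\<^esub> T = c \<odot>\<^bsub>?B\<^esub> (S \<otimes>\<^bsub>?B\<^esub> T)" for c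
    using S T by (auto simp: fun_eq_iff)
  show "S \<otimes>\<^bsub>?B\<^esub> (c \<odot>\<^bsub>?B\<^esub> T) = c \<odot>\<^bsub>?B\<^esub> (S \<otimes>\<^bsub>?B\<^esub> T)" for c
    using S T by (auto simp: fun_eq_iff bop_smult)
  show "alg_norm ?B (S \<oplus>\<^bsub>?B\<^esub> T) \<le> alg_norm ?B S + alg_norm ?B T" using B.N_triangle[of S T] S T by simp
  show "alg_norm ?B (S \<otimes>\<^bsub>?B\<^esub> T) \<le> alg_norm ?B S * alg_norm ?B T"
    using S T by (auto intro!: opnorm_le simp: opnorm_nonneg comp_bound)
  fix U assume "U \<in> carrier ?B"
  then have U: "U \<in> \<B>" by simp
  show "(S \<otimes>\<^bsub>?B\<^esub> T) \<otimes>\<^bsub>?B\<^esub> U = S \<otimes>\<^bsub>?B\<^esub> (T \<otimes>\<^bsub>?B\<^esub> U)" using S T U by (auto simp: fun_eq_iff)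
  show "(S \<oplus>\<^bsub>?B\<^esub> T) \<otimes>\<^bsub>?B\<^esub> U = (S \<otimes>\<^bsub>?B\<^esub> U) \<oplus>\<^bsub>?B\<^esub> (T \<otimes>\<^bsub>?B\<^esub> U)" using S T U by (auto simp: fun_eq_iff)
  show "S \<otimes>\<^bsub>?B\<^esub> (T \<oplus>\<^bsub>?B\<^esub> U) = (S \<otimes>\<^bsub>?B\<^esub> T) \<oplus>\<^bsub>?B\<^esub> (S \<otimes>\<^bsub>?B\<^esub> U)" using S T U by (auto simp: fun_eq_iff bop_add)
next
  show "Metric_space.mcomplete (carrier (bounded_operator_algebra H))
     (norm_dist (bounded_operator_algebra H) (alg_norm (bounded_operator_algebra H)))"
    using bop_complete by simp
qed

text \<open>For \<open>\<parallel>a\<parallel> < 1\<close> put \<open>y = 1 - sqrt (1 - a\<^sup>* a)\<close>; then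
  \<open>\<parallel>\<pi>(a) \<xi>\<parallel>\<^sup>2 = \<parallel>\<xi>\<parallel>\<^sup>2 - \<parallel>\<xi> - \<pi>(y) \<xi>\<parallel>\<^sup>2\<close>.\<close>

theorem star_hom_contractive:
  assumes A: "cstar_algebra A" and \<pi>: "star_hom A (bounded_operator_algebra H) \<pi>" and a: "a \<in> carrier A"
  shows "opnorm (\<pi> a) \<le> alg_norm A a"
proof -
  interpret A: cstar_algebra A by (rule A)
  have \<pi>B: "\<And>x. x \<in> carrier A \<Longrightarrow> \<pi> x \<in> \<B>"
    and \<pi>_add: "\<And>x y. \<lbrakk>x \<in> carrier A; y \<in> carrier A\<rbrakk> \<Longrightarrow> \<pi> (x \<oplus>\<^bsub>A\<^esub> y) = (\<lambda>\<xi>\<in>carrier H. \<pi> x \<xi> \<oplus> \<pi> y \<xi>)"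
    and \<pi>_mult: "\<And>x y. \<lbrakk>x \<in> carrier A; y \<in> carrier A\<rbrakk> \<Longrightarrow> \<pi> (x \<otimes>\<^bsub>A\<^esub> y) = (\<lambda>\<xi>\<in>carrier H. \<pi> x (\<pi> y \<xi>))"
    and \<pi>_star: "\<And>x. x \<in> carrier A \<Longrightarrow> \<pi> (star A x) = adj (\<pi> x)"
    and \<pi>_smult: "\<And>c x. x \<in> carrier A \<Longrightarrow> \<pi> (c \<odot>\<^bsub>A\<^esub> x) = (\<lambda>\<xi>\<in>carrier H. c \<odot> \<pi> x \<xi>)"
    using \<pi> unfolding star_hom_def by auto
  have unit: "hnorm H (\<pi> x \<xi>) \<le> hnorm H \<xi>"
    if x: "x \<in> carrier A" and x1: "alg_norm A x < 1" and \<xi>: "\<xi> \<in> carrier H" for x \<xi>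
  proof -
    let ?a = "star A x \<otimes>\<^bsub>A\<^esub> x"
    have "alg_norm A ?a < 1"
      using x x1 A.norm_nonneg[OF x] by (simp add: A.cstar_identity abs_square_less_1)
    then obtain y where y: "y \<in> carrier A" "star A y = y" "y \<oplus>\<^bsub>A\<^esub> y = ?a \<oplus>\<^bsub>A\<^esub> y \<otimes>\<^bsub>A\<^esub> y"
      using A.one_minus_sqrt[of ?a] x by (auto simp: A.star_mult)
    \<comment> \<open>The equation for \<open>y\<close> mentions no unit, so it can be transported
      by \<open>\<pi>\<close>; pairing it with \<open>\<xi>\<close> yields the identity for
      norms.\<close>
    have "\<pi> (y \<oplus>\<^bsub>A\<^esub> y) \<xi> = \<pi> (?a \<oplus>\<^bsub>A\<^esub> y \<otimes>\<^bsub>A\<^esub> y) \<xi>" using y(3) by simp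
    then have "\<pi> y \<xi> \<oplus> \<pi> y \<xi> = adj (\<pi> x) (\<pi> x \<xi>) \<oplus> adj (\<pi> y) (\<pi> y \<xi>)"
      using x y(1) \<xi> \<pi>_star[OF y(1)] y(2) by (simp add: \<pi>_add \<pi>_mult \<pi>_star)
    then have "ip H \<xi> (\<pi> y \<xi> \<oplus> \<pi> y \<xi>) = ip H \<xi> (adj (\<pi> x) (\<pi> x \<xi>) \<oplus> adj (\<pi> y) (\<pi> y \<xi>))" by simp
    then have "2 * ip H \<xi> (\<pi> y \<xi>) = ip H (\<pi> x \<xi>) (\<pi> x \<xi>) + ip H (\<pi> y \<xi>) (\<pi> y \<xi>)"
      using x y(1) \<xi> \<pi>B by (simp add: ip_add_right ip_adj)
    then have "2 * Re (ip H \<xi> (\<pi> y \<xi>)) = Re (ip H (\<pi> x \<xi>) (\<pi> x \<xi>)) + Re (ip H (\<pi> y \<xi>) (\<pi> y \<xi>))"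
      by (simp add: complex_eq_iff)
    then have "2 * Re (ip H \<xi> (\<pi> y \<xi>)) = (hnorm H (\<pi> x \<xi>))\<^sup>2 + (hnorm H (\<pi> y \<xi>))\<^sup>2"
      using x y(1) \<xi> \<pi>B by (simp add: hnorm_square)
    then have "(hnorm H (\<pi> x \<xi>))\<^sup>2 \<le> (hnorm H \<xi>)\<^sup>2"
      using hnorm_square_minus[of \<xi> "\<pi> y \<xi>"] \<xi> \<pi>B[OF y(1)] zero_le_power2[of "hnorm H (\<xi> \<ominus> \<pi> y \<xi>)"] by simp
    then show ?thesis by (rule power2_le_imp_le) (simp add: \<xi> hnorm_nonneg)
  qed
  have "hnorm H (\<pi> a \<xi>) \<le> alg_norm A a * hnorm H \<xi>" if \<xi>: "\<xi> \<in> carrier H" for \<xi>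
  proof (rule field_le_epsilon)
    fix e :: real assume e: "e > 0"
    \<comment> \<open>Slightly above the norm of \<open>a\<close>, so that \<open>a\<close> divided
      by \<open>t\<close> has norm below 1; the summand is scaled so that
      \<open>t * hnorm H \<xi>\<close> overshoots by at most \<open>e\<close>.\<close>
    define t where "t = alg_norm A a + e / (hnorm H \<xi> + 1)"
    have h: "0 \<le> hnorm H \<xi>" using \<xi> by (rule hnorm_nonneg)
    then have t: "t > 0" "alg_norm A a < t" using A.norm_nonneg[OF a] e by (auto simp: t_def add_nonneg_pos)
    have "alg_norm A (complex_of_real (1/t) \<odot>\<^bsub>A\<^esub> a) < 1"
      using a t by (simp add: A.norm_smult norm_divide)
    from unit[OF _ this \<xi>] have "hnorm H (complex_of_real (1/t) \<odot> \<pi> a \<xi>) \<le> hnorm H \<xi>"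
      using a \<xi> by (simp add: \<pi>_smult)
    then have "hnorm H (\<pi> a \<xi>) \<le> t * hnorm H \<xi>"
      using a \<xi> \<pi>B t by (simp add: hnorm_smult norm_divide field_simps)
    also have "\<dots> \<le> alg_norm A a * hnorm H \<xi> + e"
      using h e by (simp add: t_def distrib_right field_simps)
    finally show "hnorm H (\<pi> a \<xi>) \<le> alg_norm A a * hnorm H \<xi> + e" .
  qed
  then show ?thesis using a by (intro opnorm_le) (auto simp: A.norm_nonneg)
qed

end


section \<open>Square-summable functions\<close>

text \<open>Functions live on the whole type and vanish off \<open>X\<close>. Hence the spaces for
  all \<open>X\<close> share one type, which is needed to compare representations on the classes of
  different boundary paths.\<close>

definition ell2 :: "'x set \<Rightarrow> ('x \<Rightarrow> complex) hilbert" where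
  "ell2 X =
     \<lparr>carrier = {f. (\<forall>x. x \<notin> X \<longrightarrow> f x = 0) \<and> (\<lambda>x. (cmod (f x))\<^sup>2) summable_on UNIV},
      mult = (\<lambda>f g x. 0), one = (\<lambda>x. 0), zero = (\<lambda>x. 0), add = (\<lambda>f g x. f x + g x),
      smult = (\<lambda>c f x. c * f x), ip = (\<lambda>f g. \<Sum>\<^sub>\<infinity>x. f x * cnj (g x))\<rparr>"

lemma ell2_simps [simp]:
  "\<zero>\<^bsub>ell2 X\<^esub> = (\<lambda>x. 0)" "f \<oplus>\<^bsub>ell2 X\<^esub> g = (\<lambda>x. f x + g x)" "c \<odot>\<^bsub>ell2 X\<^esub> f = (\<lambda>x. c * f x)"
  by (simp_all add: ell2_def)

lemma ell2_carrier:
  "f \<in> carrier (ell2 X) \<longleftrightarrow> (\<forall>x. x \<notin> X \<longrightarrow> f x = 0) \<and> (\<lambda>x. (cmod (f x))\<^sup>2) summable_on UNIV"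
  by (simp add: ell2_def)

lemma ell2_ip: "ip (ell2 X) f g = (\<Sum>\<^sub>\<infinity>x. f x * cnj (g x))"
  by (simp add: ell2_def)

lemma ell2_outside: "\<lbrakk>f \<in> carrier (ell2 X); x \<notin> X\<rbrakk> \<Longrightarrow> f x = 0"
  by (simp add: ell2_carrier)

lemma ell2_product_summable:
  assumes "f \<in> carrier (ell2 X)" "g \<in> carrier (ell2 X)"
  shows "(\<lambda>x. f x * cnj (g x)) summable_on UNIV"
proof -
  have "(\<lambda>x. norm (f x * cnj (g x))) summable_on UNIV"
  proof (rule abs_summable_product)
    have "norm (f x * f x) = (cmod (f x))\<^sup>2" "norm (cnj (g x) * cnj (g x)) = (cmod (g x))\<^sup>2" for x
      by (simp_all only: norm_mult complex_mod_cnj power2_eq_square)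
    then show "(\<lambda>x. norm (f x * f x)) summable_on UNIV"
      "(\<lambda>x. norm (cnj (g x) * cnj (g x))) summable_on UNIV"
      using assms by (simp_all only: ell2_carrier)
  qed
  then show ?thesis by (rule abs_summable_summable)
qed

lemma ell2_ip_self:
  assumes "f \<in> carrier (ell2 X)"
  shows "Re (ip (ell2 X) f f) = (\<Sum>\<^sub>\<infinity>x. (cmod (f x))\<^sup>2)"
proof -
  have "Re (ip (ell2 X) f f) = (\<Sum>\<^sub>\<infinity>x. Re (f x * cnj (f x)))"
    unfolding ell2_ip using ell2_product_summable[OF assms assms] by (simp only: infsum_Re)
  then show ?thesis by (simp add: complex_norm_square[symmetric] del: complex_mult_cnj)
qed

lemma ell2_hnorm: "f \<in> carrier (ell2 X) \<Longrightarrow> hnorm (ell2 X) f = sqrt (\<Sum>\<^sub>\<infinity>x. (cmod (f x))\<^sup>2)"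
  by (simp add: hnorm_def ell2_ip_self)

lemma ell2_hnorm_square: "f \<in> carrier (ell2 X) \<Longrightarrow> (hnorm (ell2 X) f)\<^sup>2 = (\<Sum>\<^sub>\<infinity>x. (cmod (f x))\<^sup>2)"
  by (simp add: ell2_hnorm infsum_nonneg)

lemma ell2_finite_sum_le:
  assumes "f \<in> carrier (ell2 X)" "finite F"
  shows "(\<Sum>x\<in>F. (cmod (f x))\<^sup>2) \<le> (hnorm (ell2 X) f)\<^sup>2"
  unfolding ell2_hnorm_square[OF assms(1)] using assms by (intro finite_sum_le_infsum) (auto simp: ell2_carrier)

lemma ell2_coordinate_le:
  assumes "f \<in> carrier (ell2 X)"
  shows "cmod (f x) \<le> hnorm (ell2 X) f"
  by (rule power2_le_imp_le) (use ell2_finite_sum_le[OF assms, of "{x}"] assms in \<open>auto simp: ell2_hnorm infsum_nonneg\<close>)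

text \<open>A series of nonnegative terms with bounded partial sums converges to at most the bound;
  so membership and norm can be read off finite sums.\<close>

lemma ell2_bounded_sums:
  assumes "0 \<le> B" "\<And>x. x \<notin> X \<Longrightarrow> f x = 0" "\<And>F. finite F \<Longrightarrow> (\<Sum>x\<in>F. (cmod (f x))\<^sup>2) \<le> B\<^sup>2"
  shows "f \<in> carrier (ell2 X)" "hnorm (ell2 X) f \<le> B"
proof -
  have s: "(\<lambda>x. (cmod (f x))\<^sup>2) summable_on UNIV"
    using assms(3) by (intro nonneg_bdd_above_summable_on bdd_aboveI2[of _ _ "B\<^sup>2"]) auto
  then show f: "f \<in> carrier (ell2 X)" using assms(2) by (simp add: ell2_carrier)
  have "(\<Sum>\<^sub>\<infinity>x. (cmod (f x))\<^sup>2) \<le> B\<^sup>2" using s assms(3) by (intro infsum_le_finite_sums)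
  then show "hnorm (ell2 X) f \<le> B" using assms(1) f by (simp add: ell2_hnorm real_le_lsqrt infsum_nonneg)
qed

lemma ell2_add_closed:
  assumes "f \<in> carrier (ell2 X)" "g \<in> carrier (ell2 X)"
  shows "(\<lambda>x. f x + g x) \<in> carrier (ell2 X)"
proof -
  have le: "(cmod (f x + g x))\<^sup>2 \<le> 2 * (cmod (f x))\<^sup>2 + 2 * (cmod (g x))\<^sup>2" for x
  proof -
    have "(cmod (f x + g x))\<^sup>2 \<le> (cmod (f x) + cmod (g x))\<^sup>2" by (intro power_mono norm_triangle_ineq) auto
    also have "\<dots> \<le> 2 * (cmod (f x))\<^sup>2 + 2 * (cmod (g x))\<^sup>2"
      using sum_squares_bound[of "cmod (f x)" "cmod (g x)"] by (simp add: power2_sum)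
    finally show ?thesis .
  qed
  have "(\<lambda>x. 2 * (cmod (f x))\<^sup>2 + 2 * (cmod (g x))\<^sup>2) summable_on UNIV"
    using assms by (intro summable_on_add summable_on_cmult_right) (auto simp: ell2_carrier)
  then have "(\<lambda>x. (cmod (f x + g x))\<^sup>2) summable_on UNIV"
    by (rule summable_on_comparison_test) (use le in auto)
  then show ?thesis using assms by (simp add: ell2_carrier)
qed

lemma ell2_smult_closed: "f \<in> carrier (ell2 X) \<Longrightarrow> (\<lambda>x. c * f x) \<in> carrier (ell2 X)"
  by (auto simp: ell2_carrier norm_mult power_mult_distrib intro: summable_on_cmult_right)

lemma ell2_zero_closed: "(\<lambda>x. 0) \<in> carrier (ell2 X)"
  by (simp add: ell2_carrier)

lemma module_ell2: "module complex_ring (ell2 X)"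
proof (rule moduleI[OF cring_complex_ring])
  show "abelian_group (ell2 X)"
  proof (rule abelian_groupI)
    fix f assume "f \<in> carrier (ell2 X)"
    then show "\<exists>g\<in>carrier (ell2 X). g \<oplus>\<^bsub>ell2 X\<^esub> f = \<zero>\<^bsub>ell2 X\<^esub>"
      using ell2_smult_closed[of f X "- 1"] by (intro bexI[of _ "\<lambda>x. (- 1) * f x"]) auto
  qed (auto simp: ell2_add_closed ell2_zero_closed add_ac)
qed (auto simp: ell2_smult_closed algebra_simps)

text \<open>Coordinates are dominated by the norm, so a coordinatewise limit exists; the Cauchy
  bound passes to it in each finite partial sum and thus to the norm.\<close>

lemma ell2_limit:
  fixes \<sigma> :: "nat \<Rightarrow> 'x \<Rightarrow> complex"
  assumes \<sigma>: "\<And>n. \<sigma> n \<in> carrier (ell2 X)"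
    and Cauchy: "\<And>\<epsilon>. \<epsilon> > 0 \<Longrightarrow> \<exists>k. \<forall>m\<ge>k. \<forall>n\<ge>k. hnorm (ell2 X) (\<lambda>x. \<sigma> m x - \<sigma> n x) < \<epsilon>"
  obtains l where "l \<in> carrier (ell2 X)"
    "\<And>\<epsilon>. \<epsilon> > 0 \<Longrightarrow> \<exists>k. \<forall>n\<ge>k. hnorm (ell2 X) (\<lambda>x. \<sigma> n x - l x) < \<epsilon>"
proof -
  have diff: "(\<lambda>x. f x - g x) \<in> carrier (ell2 X)" if "f \<in> carrier (ell2 X)" "g \<in> carrier (ell2 X)" for f g
    using ell2_add_closed[OF that(1) ell2_smult_closed[OF that(2), of "- 1"]] by simp
  have "convergent (\<lambda>n. \<sigma> n x)" for x
    unfolding Cauchy_convergent_iff[symmetric]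
  proof (rule metric_CauchyI)
    fix e :: real assume "e > 0"
    then obtain k where k: "\<forall>m\<ge>k. \<forall>n\<ge>k. hnorm (ell2 X) (\<lambda>x. \<sigma> m x - \<sigma> n x) < e" using Cauchy by blast
    have "dist (\<sigma> m x) (\<sigma> n x) < e" if "m \<ge> k" "n \<ge> k" for m n
      using ell2_coordinate_le[OF diff[OF \<sigma>[of m] \<sigma>[of n]], of x] k that by (auto simp: dist_norm intro: order_le_less_trans)
    then show "\<exists>M. \<forall>m\<ge>M. \<forall>n\<ge>M. dist (\<sigma> m x) (\<sigma> n x) < e" by blast
  qed
  then obtain l where l: "\<And>x. (\<lambda>n. \<sigma> n x) \<longlonglongrightarrow> l x" unfolding convergent_def by metis
  have l0: "l x = 0" if "x \<notin> X" for x
    using l[of x] ell2_outside[OF \<sigma> that] by (simp add: LIMSEQ_const_iff)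
  have close: "(\<lambda>x. \<sigma> n x - l x) \<in> carrier (ell2 X) \<and> hnorm (ell2 X) (\<lambda>x. \<sigma> n x - l x) \<le> \<epsilon>"
    if k: "\<forall>m\<ge>k. \<forall>n\<ge>k. hnorm (ell2 X) (\<lambda>x. \<sigma> m x - \<sigma> n x) < \<epsilon>" and n: "n \<ge> k" and e: "\<epsilon> > 0" for k n \<epsilon>
  proof -
    have "(\<Sum>x\<in>F. (cmod (\<sigma> n x - l x))\<^sup>2) \<le> \<epsilon>\<^sup>2" if F: "finite F" for F
    proof (rule LIMSEQ_le_const2)
      show "(\<lambda>m. \<Sum>x\<in>F. (cmod (\<sigma> n x - \<sigma> m x))\<^sup>2) \<longlonglongrightarrow> (\<Sum>x\<in>F. (cmod (\<sigma> n x - l x))\<^sup>2)"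
        by (intro tendsto_intros l)
      have "(\<Sum>x\<in>F. (cmod (\<sigma> n x - \<sigma> m x))\<^sup>2) \<le> \<epsilon>\<^sup>2" if "m \<ge> k" for m
        using ell2_finite_sum_le[OF diff[OF \<sigma>[of n] \<sigma>[of m]] F] k n that
          power_mono[of "hnorm (ell2 X) (\<lambda>x. \<sigma> n x - \<sigma> m x)" \<epsilon> 2] diff[OF \<sigma>[of n] \<sigma>[of m]]
        by (fastforce simp: ell2_hnorm infsum_nonneg)
      then show "\<exists>k. \<forall>m\<ge>k. (\<Sum>x\<in>F. (cmod (\<sigma> n x - \<sigma> m x))\<^sup>2) \<le> \<epsilon>\<^sup>2" by blast
    qed
    then show ?thesis
      using ell2_bounded_sums[of \<epsilon> X "\<lambda>x. \<sigma> n x - l x"] e l0 ell2_outside[OF \<sigma>] by auto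
  qed
  show thesis
  proof (rule that)
    obtain k where k: "\<forall>m\<ge>k. \<forall>n\<ge>k. hnorm (ell2 X) (\<lambda>x. \<sigma> m x - \<sigma> n x) < 1" using Cauchy[of 1] by auto
    from diff[OF \<sigma>[of k] conjunct1[OF close[OF k order_refl zero_less_one]]] show "l \<in> carrier (ell2 X)" by simp
    fix \<epsilon> :: real assume e: "\<epsilon> > 0"
    then obtain k where k: "\<forall>m\<ge>k. \<forall>n\<ge>k. hnorm (ell2 X) (\<lambda>x. \<sigma> m x - \<sigma> n x) < \<epsilon>/2"
      using Cauchy[of "\<epsilon>/2"] by auto
    show "\<exists>k. \<forall>n\<ge>k. hnorm (ell2 X) (\<lambda>x. \<sigma> n x - l x) < \<epsilon>"
      using close[OF k] e by (intro exI[of _ k]) fastforce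
  qed
qed

lemma inner_product_module_ell2: "inner_product_module (ell2 X)"
proof -
  interpret module complex_ring "ell2 X" by (rule module_ell2)
  show ?thesis
  proof
    fix f g c assume f: "f \<in> carrier (ell2 X)"
    show "0 < Re (ip (ell2 X) f f)" if "f \<noteq> \<zero>\<^bsub>ell2 X\<^esub>"
    proof -
      obtain x where "f x \<noteq> 0" using \<open>f \<noteq> \<zero>\<^bsub>ell2 X\<^esub>\<close> by auto
      then have "0 < (cmod (f x))\<^sup>2" by simp
      also have "\<dots> \<le> (hnorm (ell2 X) f)\<^sup>2" using ell2_finite_sum_le[OF f, of "{x}"] by simp
      finally show ?thesis using f by (simp add: ell2_ip_self ell2_hnorm_square)
    qed
    assume g: "g \<in> carrier (ell2 X)"
    show "ip (ell2 X) (c \<odot>\<^bsub>ell2 X\<^esub> f) g = c * ip (ell2 X) f g"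
      using f g by (simp add: ell2_ip mult.assoc infsum_cmult_right ell2_product_summable)
    show "ip (ell2 X) g f = cnj (ip (ell2 X) f g)"
      by (simp add: ell2_ip infsum_cnj[symmetric] mult.commute del: infsum_cnj)
    fix h assume "h \<in> carrier (ell2 X)"
    then show "ip (ell2 X) (f \<oplus>\<^bsub>ell2 X\<^esub> g) h = ip (ell2 X) f h + ip (ell2 X) g h"
      using f g by (simp add: ell2_ip distrib_right infsum_add ell2_product_summable)
  qed
qed

lemma ell2_minus:
  assumes "f \<in> carrier (ell2 X)" "g \<in> carrier (ell2 X)"
  shows "f \<ominus>\<^bsub>ell2 X\<^esub> g = (\<lambda>x. f x - g x)"
proof -
  interpret inner_product_module "ell2 X" by (rule inner_product_module_ell2)
  show ?thesis using assms by (simp add: minus_eq_smult)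
qed

lemma hilbert_space_ell2: "hilbert_space (ell2 X)"
proof -
  interpret inner_product_module "ell2 X" by (rule inner_product_module_ell2)
  have "mcomplete"
    unfolding mcomplete_iff
  proof (intro allI impI, elim conjE)
    fix \<sigma> :: "nat \<Rightarrow> 'a \<Rightarrow> complex"
    assume \<sigma>: "\<forall>n. \<sigma> n \<in> carrier (ell2 X)"
      and C: "\<forall>\<epsilon>>0. \<exists>k. \<forall>m\<ge>k. \<forall>n\<ge>k. hnorm (ell2 X) (\<sigma> m \<ominus>\<^bsub>ell2 X\<^esub> \<sigma> n) < \<epsilon>"
    obtain l where "l \<in> carrier (ell2 X)" "\<And>\<epsilon>. \<epsilon> > 0 \<Longrightarrow> \<exists>k. \<forall>n\<ge>k. hnorm (ell2 X) (\<lambda>x. \<sigma> n x - l x) < \<epsilon>"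
      by (rule ell2_limit[of \<sigma> X]) (use \<sigma> C in \<open>auto simp: ell2_minus\<close>)
    then show "\<exists>l\<in>carrier (ell2 X). \<forall>\<epsilon>>0. \<exists>k. \<forall>n\<ge>k. hnorm (ell2 X) (\<sigma> n \<ominus>\<^bsub>ell2 X\<^esub> l) < \<epsilon>"
      using \<sigma> by (auto simp: ell2_minus)
  qed
  then show ?thesis
    by unfold_locales (assumption | rule ip_add_l ip_smult_l ip_commute ip_pos_def)+
qed

global_interpretation ell2: hilbert_space "ell2 X" for X :: "'x set"
  by (rule hilbert_space_ell2)

definition delta :: "'x \<Rightarrow> 'x \<Rightarrow> complex" where
  "delta x = (\<lambda>y. if y = x then 1 else 0)"

lemma delta_simps [simp]: "delta x x = 1" "y \<noteq> x \<Longrightarrow> delta x y = 0"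
  by (auto simp: delta_def)

lemma delta_apply: "delta x y = (if y = x then 1 else 0)"
  by (simp add: delta_def)

lemma ell2_finite_support:
  assumes "finite F" "F \<subseteq> X" "\<And>x. x \<notin> F \<Longrightarrow> f x = 0"
  shows "f \<in> carrier (ell2 X)"
proof -
  have "(\<lambda>x. (cmod (f x))\<^sup>2) summable_on UNIV \<longleftrightarrow> (\<lambda>x. (cmod (f x))\<^sup>2) summable_on F"
    using assms(3) by (intro summable_on_cong_neutral) auto
  then show ?thesis using assms by (auto simp: ell2_carrier)
qed

lemma delta_in [simp]: "x \<in> X \<Longrightarrow> delta x \<in> carrier (ell2 X)"
  by (rule ell2_finite_support[of "{x}"]) auto

lemma ip_delta [simp]: "ip (ell2 X) f (delta x) = f x"
proof -
  have "(\<Sum>\<^sub>\<infinity>y. f y * cnj (delta x y)) = (\<Sum>\<^sub>\<infinity>y\<in>{x}. f y * cnj (delta x y))"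
    by (rule infsum_cong_neutral) auto
  then show ?thesis by (simp add: ell2_ip)
qed

lemma hnorm_delta [simp]: "x \<in> X \<Longrightarrow> hnorm (ell2 X) (delta x) = 1"
  using ell2.hnorm_square[of "delta x" X] ell2.hnorm_nonneg[of "delta x" X] by (simp add: power2_eq_1_iff)

lemma ell2_restrict:
  assumes "f \<in> carrier (ell2 X)"
  shows "(\<lambda>x. if x \<in> S then f x else 0) \<in> carrier (ell2 X)"
    "hnorm (ell2 X) (\<lambda>x. if x \<in> S then f x else 0) \<le> hnorm (ell2 X) f"
proof -
  have "(\<Sum>x\<in>F. (cmod (if x \<in> S then f x else 0))\<^sup>2) \<le> (hnorm (ell2 X) f)\<^sup>2" if "finite F" for F
    using ell2_finite_sum_le[OF assms that] by (rule order_trans[rotated]) (auto intro: sum_mono)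
  then show "(\<lambda>x. if x \<in> S then f x else 0) \<in> carrier (ell2 X)"
    "hnorm (ell2 X) (\<lambda>x. if x \<in> S then f x else 0) \<le> hnorm (ell2 X) f"
    using ell2_bounded_sums[of "hnorm (ell2 X) f" X "\<lambda>x. if x \<in> S then f x else 0"]
      ell2.hnorm_nonneg[OF assms] ell2_outside[OF assms] by auto
qed

text \<open>Finitely many coordinates carry all but a small part of the norm. The quantifier over
  \<open>G\<close> lets one finite set serve several vectors at once.\<close>

lemma ell2_tail_small:
  assumes f: "f \<in> carrier (ell2 X)" and e: "\<epsilon> > 0"
  shows "\<exists>F. finite F \<and> F \<subseteq> X \<and>
    (\<forall>G. F \<subseteq> G \<longrightarrow> hnorm (ell2 X) (\<lambda>x. if x \<in> G then 0 else f x) < \<epsilon>)"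
proof -
  define q where "q x = (cmod (f x))\<^sup>2" for x
  have q: "q summable_on UNIV" "\<And>x. q x \<ge> 0" using f by (auto simp: q_def[abs_def] ell2_carrier)
  obtain F where F: "finite F" "dist (sum q F) (infsum q UNIV) \<le> (\<epsilon>/2)\<^sup>2"
    using infsum_finite_approximation[OF q(1), of "(\<epsilon>/2)\<^sup>2"] e by auto
  have "hnorm (ell2 X) (\<lambda>x. if x \<in> G then 0 else f x) < \<epsilon>" if G: "F \<inter> X \<subseteq> G" for G
  proof -
    have "(\<Sum>x\<in>E. (cmod (if x \<in> G then 0 else f x))\<^sup>2) \<le> (\<epsilon>/2)\<^sup>2" if E: "finite E" for E
    proof -
      have "(\<Sum>x\<in>E. (cmod (if x \<in> G then 0 else f x))\<^sup>2) \<le> sum q (E - F)"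
      proof -
        have "(\<Sum>x\<in>E. (cmod (if x \<in> G then 0 else f x))\<^sup>2) \<le> (\<Sum>x\<in>E. if x \<in> F then 0 else q x)"
          using G ell2_outside[OF f] by (intro sum_mono) (auto simp: q_def)
        also have "\<dots> = sum q (E - F)"
          using E by (intro sum.mono_neutral_cong_right) auto
        finally show ?thesis .
      qed
      also have "sum q (E - F) = sum q (E \<union> F) - sum q F" using E F(1) by (simp add: sum_diff[symmetric] Un_Diff)
      also have "sum q (E \<union> F) \<le> infsum q UNIV" using q E F(1) by (intro finite_sum_le_infsum) auto
      finally show ?thesis using F(2) by (simp add: dist_real_def)
    qed
    then have "hnorm (ell2 X) (\<lambda>x. if x \<in> G then 0 else f x) \<le> \<epsilon>/2"
      using ell2_bounded_sums(2)[of "\<epsilon>/2" X "\<lambda>x. if x \<in> G then 0 else f x"] e ell2_outside[OF f] by auto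
    then show ?thesis using e by simp
  qed
  then show ?thesis using F(1) by (intro exI[of _ "F \<inter> X"]) auto
qed


subsection \<open>Operators of weighted partial bijections\<close>

text \<open>Weighted composition with \<open>g\<close> on \<open>Y\<close>. This single shape covers
  the images of the edges and their adjoints, the diagonal projections and the matrix units.\<close>

definition wpb :: "'x set \<Rightarrow> 'x set \<Rightarrow> ('x \<Rightarrow> 'x) \<Rightarrow> complex \<Rightarrow> ('x \<Rightarrow> complex) \<Rightarrow> 'x \<Rightarrow> complex" where
  "wpb X Y g c = (\<lambda>f\<in>carrier (ell2 X). \<lambda>x. if x \<in> Y then c * f (g x) else 0)"

lemma wpb_apply [simp]: "f \<in> carrier (ell2 X) \<Longrightarrow> wpb X Y g c f = (\<lambda>x. if x \<in> Y then c * f (g x) else 0)"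
  by (simp add: wpb_def)

lemma wpb_bounded:
  assumes "inj_on g Y" "Y \<subseteq> X"
  shows "wpb X Y g c \<in> bounded_operators (ell2 X) (ell2 X)"
proof -
  have *: "(\<lambda>x. if x \<in> Y then c * f (g x) else 0) \<in> carrier (ell2 X)"
    "hnorm (ell2 X) (\<lambda>x. if x \<in> Y then c * f (g x) else 0) \<le> cmod c * hnorm (ell2 X) f"
    if f: "f \<in> carrier (ell2 X)" for f
  proof -
    have S: "(\<Sum>x\<in>F. (cmod (if x \<in> Y then c * f (g x) else 0))\<^sup>2) \<le> (cmod c * hnorm (ell2 X) f)\<^sup>2"
      if F: "finite F" for F
    proof -
      have "(\<Sum>x\<in>F. (cmod (if x \<in> Y then c * f (g x) else 0))\<^sup>2) = (\<Sum>x\<in>F \<inter> Y. (cmod c)\<^sup>2 * (cmod (f (g x)))\<^sup>2)"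
        using F by (intro sum.mono_neutral_cong_right) (auto simp: norm_mult power_mult_distrib)
      also have "\<dots> = (cmod c)\<^sup>2 * (\<Sum>y\<in>g ` (F \<inter> Y). (cmod (f y))\<^sup>2)"
        using inj_on_subset[OF assms(1)] by (simp add: sum.reindex sum_distrib_left)
      also have "\<dots> \<le> (cmod c)\<^sup>2 * (hnorm (ell2 X) f)\<^sup>2"
        using F f by (intro mult_left_mono ell2_finite_sum_le) auto
      finally show ?thesis by (simp add: power_mult_distrib)
    qed
    have z: "(if x \<in> Y then c * f (g x) else 0) = 0" if "x \<notin> X" for x
      using assms(2) that by auto
    have B: "0 \<le> cmod c * hnorm (ell2 X) f" by (simp add: ell2.hnorm_nonneg[OF f])
    show "(\<lambda>x. if x \<in> Y then c * f (g x) else 0) \<in> carrier (ell2 X)"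
      by (rule ell2_bounded_sums(1)[OF B z S])
    show "hnorm (ell2 X) (\<lambda>x. if x \<in> Y then c * f (g x) else 0) \<le> cmod c * hnorm (ell2 X) f"
      by (rule ell2_bounded_sums(2)[OF B z S])
  qed
  show ?thesis
    by (rule ell2.bounded_operatorsI[where B="cmod c"])
      (use * in \<open>auto simp: wpb_def ell2_add_closed ell2_smult_closed fun_eq_iff algebra_simps\<close>)
qed

text \<open>Reindexing the series for the inner product along \<open>g\<close> moves
  \<open>g\<close> to the other argument as its inverse.\<close>

lemma adjoint_wpb:
  assumes "bij_betw g Y Z" "Y \<subseteq> X" "Z \<subseteq> X" and k: "\<And>y. y \<in> Y \<Longrightarrow> k (g y) = y"
  shows "adjoint_operator (ell2 X) (ell2 X) (wpb X Y g c) = wpb X Z k (cnj c)"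
proof (rule ell2.adj_eqI)
  have kZ: "bij_betw k Z Y"
    by (rule bij_betw_byWitness[of _ g]) (use assms in \<open>auto simp: bij_betw_def\<close>)
  show "wpb X Y g c \<in> bounded_operators (ell2 X) (ell2 X)"
    using assms by (intro wpb_bounded) (auto simp: bij_betw_def)
  show "wpb X Z k (cnj c) \<in> bounded_operators (ell2 X) (ell2 X)"
    using assms kZ by (intro wpb_bounded) (auto simp: bij_betw_def)
  fix f h assume f: "f \<in> carrier (ell2 X)" and h: "h \<in> carrier (ell2 X)"
  have "ip (ell2 X) (wpb X Y g c f) h = (\<Sum>\<^sub>\<infinity>y\<in>Y. c * f (g y) * cnj (h (k (g y))))"
    using f k by (auto simp: ell2_ip intro!: infsum_cong_neutral)
  also have "\<dots> = (\<Sum>\<^sub>\<infinity>z\<in>Z. c * f z * cnj (h (k z)))"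
    by (rule infsum_reindex_bij_betw[OF assms(1)])
  also have "\<dots> = ip (ell2 X) f (wpb X Z k (cnj c) h)"
    using h by (auto simp: ell2_ip intro!: infsum_cong_neutral)
  finally show "ip (ell2 X) (wpb X Y g c f) h = ip (ell2 X) f (wpb X Z k (cnj c) h)" .
qed


section \<open>Compact operators\<close>

context hilbert_space
begin

text \<open>In a complete space a set has compact closure iff it is totally bounded. The net may
  consist of arbitrary vectors, which is easier to supply than a net inside the image.\<close>

lemma compact_operators_iff:
  "T \<in> compact_operators H \<longleftrightarrow> T \<in> \<B> \<and>
    (\<forall>\<epsilon>>0. \<exists>K. finite K \<and> K \<subseteq> carrier H \<and>
       (\<forall>x\<in>carrier H. hnorm H x \<le> 1 \<longrightarrow> (\<exists>k\<in>K. hnorm H (T x \<ominus> k) < \<epsilon>)))"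
proof (cases "T \<in> \<B>")
  case T: True
  define S where "S = T ` {x \<in> carrier H. hnorm H x \<le> 1}"
  have S: "S \<subseteq> carrier H" using T by (auto simp: S_def)
  have "T \<in> compact_operators H \<longleftrightarrow> mtotally_bounded S"
    using T S mtotally_bounded_eq_compact_closure_of[OF complete, of S]
    by (simp add: compact_operators_def norm_topology_def S_def)
  also have "\<dots> \<longleftrightarrow> (\<forall>\<epsilon>>0. \<exists>K. finite K \<and> K \<subseteq> carrier H \<and> (\<forall>s\<in>S. \<exists>k\<in>K. hnorm H (s \<ominus> k) < \<epsilon>))"
  proof
    assume tb: "mtotally_bounded S"
    show "\<forall>\<epsilon>>0. \<exists>K. finite K \<and> K \<subseteq> carrier H \<and> (\<forall>s\<in>S. \<exists>k\<in>K. hnorm H (s \<ominus> k) < \<epsilon>)"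
    proof (intro allI impI)
      fix \<epsilon> :: real assume "\<epsilon> > 0"
      then obtain K where K: "finite K" "K \<subseteq> S" "S \<subseteq> (\<Union>x\<in>K. mball x \<epsilon>)"
        using tb by (auto simp: mtotally_bounded_def)
      have "\<exists>k\<in>K. hnorm H (s \<ominus> k) < \<epsilon>" if s: "s \<in> S" for s
      proof -
        obtain k where "k \<in> K" "s \<in> mball k \<epsilon>" using K(3) s by blast
        then show ?thesis by (intro bexI[of _ k]) (auto simp: norm_dist_eq N_minus_commute)
      qed
      then show "\<exists>K. finite K \<and> K \<subseteq> carrier H \<and> (\<forall>s\<in>S. \<exists>k\<in>K. hnorm H (s \<ominus> k) < \<epsilon>)"
        using K S by blast
    qed
  next
    assume net: "\<forall>\<epsilon>>0. \<exists>K. finite K \<and> K \<subseteq> carrier H \<and> (\<forall>s\<in>S. \<exists>k\<in>K. hnorm H (s \<ominus> k) < \<epsilon>)"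
    show "mtotally_bounded S"
      unfolding mtotally_bounded_def
    proof (intro allI impI)
      fix \<epsilon> :: real assume "\<epsilon> > 0"
      then obtain K where K: "finite K" "K \<subseteq> carrier H" "\<forall>s\<in>S. \<exists>k\<in>K. hnorm H (s \<ominus> k) < \<epsilon>/2"
        using net[rule_format, OF half_gt_zero[OF \<open>\<epsilon> > 0\<close>]] by blast
      \<comment> \<open>Net points that are close to \<open>S\<close> are replaced by points of
        \<open>S\<close>, which doubles the radius; the others cover nothing and are
        dropped.\<close>
      define K' where "K' = {k \<in> K. \<exists>s\<in>S. hnorm H (s \<ominus> k) < \<epsilon>/2}"
      define c where "c k = (SOME s. s \<in> S \<and> hnorm H (s \<ominus> k) < \<epsilon>/2)" for k
      have c: "c k \<in> S" "hnorm H (c k \<ominus> k) < \<epsilon>/2" if "k \<in> K'" for k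
        using someI_ex[of "\<lambda>s. s \<in> S \<and> hnorm H (s \<ominus> k) < \<epsilon>/2"] that by (auto simp: c_def K'_def)
      have "s \<in> (\<Union>x\<in>c ` K'. mball x \<epsilon>)" if s: "s \<in> S" for s
      proof -
        obtain k where k: "k \<in> K" "hnorm H (s \<ominus> k) < \<epsilon>/2" using K(3) s by blast
        then have k': "k \<in> K'" using s by (auto simp: K'_def)
        have cc: "c k \<in> carrier H" "s \<in> carrier H" "k \<in> carrier H" using c[OF k'] S s k K by auto
        have "hnorm H (c k \<ominus> s) < \<epsilon>"
          using N_minus_triangle[of "c k" k s] c(2)[OF k'] k(2) cc N_minus_commute[of k s] by simp
        then show ?thesis using k' cc by (auto simp: norm_dist_eq)
      qed
      then show "\<exists>K. finite K \<and> K \<subseteq> S \<and> S \<subseteq> (\<Union>x\<in>K. mball x \<epsilon>)"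
        using c(1) K(1) by (intro exI[of _ "c ` K'"]) (auto simp: K'_def)
    qed
  qed
  finally have "T \<in> compact_operators H \<longleftrightarrow>
      (\<forall>\<epsilon>>0. \<exists>K. finite K \<and> K \<subseteq> carrier H \<and> (\<forall>s\<in>S. \<exists>k\<in>K. hnorm H (s \<ominus> k) < \<epsilon>))" .
  moreover have "(\<forall>s\<in>S. Q s) \<longleftrightarrow> (\<forall>x\<in>carrier H. hnorm H x \<le> 1 \<longrightarrow> Q (T x))" for Q
    by (auto simp: S_def)
  ultimately show ?thesis using T by (simp only: simp_thms)
qed (simp add: compact_operators_def)

lemma compact_bop: "T \<in> compact_operators H \<Longrightarrow> T \<in> \<B>"
  by (simp add: compact_operators_def)

lemma compact_net:
  assumes "T \<in> compact_operators H" "\<epsilon> > 0"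
  shows "\<exists>K. finite K \<and> K \<subseteq> carrier H \<and>
    (\<forall>x\<in>carrier H. hnorm H x \<le> 1 \<longrightarrow> (\<exists>k\<in>K. hnorm H (T x \<ominus> k) < \<epsilon>))"
  using assms unfolding compact_operators_iff by blast

lemma compactI:
  assumes "T \<in> \<B>"
    and "\<And>\<epsilon>. \<epsilon> > 0 \<Longrightarrow> \<exists>K. finite K \<and> K \<subseteq> carrier H \<and>
       (\<forall>x\<in>carrier H. hnorm H x \<le> 1 \<longrightarrow> (\<exists>k\<in>K. hnorm H (T x \<ominus> k) < \<epsilon>))"
  shows "T \<in> compact_operators H"
  using assms unfolding compact_operators_iff by blast

lemma compact_zero: "(\<lambda>x\<in>carrier H. \<zero>) \<in> compact_operators H"
  by (rule compactI[OF zero_bop]) (auto intro!: exI[of _ "{\<zero>}"])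

lemma compact_add:
  assumes S: "S \<in> compact_operators H" and T: "T \<in> compact_operators H"
  shows "(\<lambda>x\<in>carrier H. S x \<oplus> T x) \<in> compact_operators H"
proof (rule compactI)
  show "(\<lambda>x\<in>carrier H. S x \<oplus> T x) \<in> \<B>" using S T by (intro add_bop compact_bop)
  fix \<epsilon> :: real assume e: "\<epsilon> > 0"
  obtain K where K: "finite K" "K \<subseteq> carrier H"
    "\<And>x. \<lbrakk>x \<in> carrier H; hnorm H x \<le> 1\<rbrakk> \<Longrightarrow> \<exists>k\<in>K. hnorm H (S x \<ominus> k) < \<epsilon>/2"
    using compact_net[OF S half_gt_zero[OF e]] by blast
  obtain L where L: "finite L" "L \<subseteq> carrier H"
    "\<And>x. \<lbrakk>x \<in> carrier H; hnorm H x \<le> 1\<rbrakk> \<Longrightarrow> \<exists>k\<in>L. hnorm H (T x \<ominus> k) < \<epsilon>/2"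
    using compact_net[OF T half_gt_zero[OF e]] by blast
  define M where "M = (\<lambda>(k, l). k \<oplus> l) ` (K \<times> L)"
  have "\<exists>m\<in>M. hnorm H ((\<lambda>x\<in>carrier H. S x \<oplus> T x) x \<ominus> m) < \<epsilon>"
    if x: "x \<in> carrier H" "hnorm H x \<le> 1" for x
  proof -
    obtain k l where kl: "k \<in> K" "hnorm H (S x \<ominus> k) < \<epsilon>/2" "l \<in> L" "hnorm H (T x \<ominus> l) < \<epsilon>/2"
      using K(3)[OF x] L(3)[OF x] by blast
    then have "k \<in> carrier H" "l \<in> carrier H" using K L by auto
    then have "hnorm H ((S x \<oplus> T x) \<ominus> (k \<oplus> l)) < \<epsilon>"
      using N_add_minus_add_le[of "S x" "T x" k l] kl x compact_bop[OF S] compact_bop[OF T] by simp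
    moreover have "k \<oplus> l \<in> M" using kl by (auto simp: M_def)
    ultimately show ?thesis using x by auto
  qed
  moreover have "finite M" "M \<subseteq> carrier H" using K L by (auto simp: M_def)
  ultimately show "\<exists>K. finite K \<and> K \<subseteq> carrier H \<and>
       (\<forall>x\<in>carrier H. hnorm H x \<le> 1 \<longrightarrow> (\<exists>k\<in>K. hnorm H ((\<lambda>x\<in>carrier H. S x \<oplus> T x) x \<ominus> k) < \<epsilon>))"
    by blast
qed

lemma compact_smult:
  assumes T: "T \<in> compact_operators H"
  shows "(\<lambda>x\<in>carrier H. c \<odot> T x) \<in> compact_operators H"
proof (rule compactI)
  show "(\<lambda>x\<in>carrier H. c \<odot> T x) \<in> \<B>" using T by (intro smult_bop compact_bop)
  fix \<epsilon> :: real assume e: "\<epsilon> > 0"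
  define d where "d = \<epsilon> / (cmod c + 1)"
  have c1: "cmod c + 1 > 0" using norm_ge_zero[of c] by linarith
  have d: "d > 0" using e c1 by (simp add: d_def)
  obtain K where K: "finite K" "K \<subseteq> carrier H"
    "\<And>x. \<lbrakk>x \<in> carrier H; hnorm H x \<le> 1\<rbrakk> \<Longrightarrow> \<exists>k\<in>K. hnorm H (T x \<ominus> k) < d"
    using compact_net[OF T d] by blast
  have "\<exists>m\<in>(\<lambda>k. c \<odot> k) ` K. hnorm H ((\<lambda>x\<in>carrier H. c \<odot> T x) x \<ominus> m) < \<epsilon>"
    if x: "x \<in> carrier H" "hnorm H x \<le> 1" for x
  proof -
    obtain k where k: "k \<in> K" "hnorm H (T x \<ominus> k) < d" using K(3)[OF x] by blast
    then have kc: "k \<in> carrier H" "T x \<in> carrier H" using K compact_bop[OF T] x by auto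
    have "hnorm H (c \<odot> T x \<ominus> c \<odot> k) = cmod c * hnorm H (T x \<ominus> k)"
      using kc by (simp add: smult_minus[symmetric] hnorm_smult)
    also have "\<dots> \<le> cmod c * d" using k by (intro mult_left_mono) auto
    also have "\<dots> < \<epsilon>" using c1 e by (simp add: d_def field_simps)
    finally show ?thesis using k x by auto
  qed
  moreover have "finite ((\<lambda>k. c \<odot> k) ` K)" "(\<lambda>k. c \<odot> k) ` K \<subseteq> carrier H" using K by auto
  ultimately show "\<exists>K. finite K \<and> K \<subseteq> carrier H \<and>
       (\<forall>x\<in>carrier H. hnorm H x \<le> 1 \<longrightarrow> (\<exists>k\<in>K. hnorm H ((\<lambda>x\<in>carrier H. c \<odot> T x) x \<ominus> k) < \<epsilon>))"
    by blast
qed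

lemma submodule_compact: "submodule (compact_operators H) complex_ring (bounded_operator_algebra H)"
proof (rule B.submoduleI)
  show "\<ominus>\<^bsub>bounded_operator_algebra H\<^esub> T \<in> compact_operators H" if "T \<in> compact_operators H" for T
    using compact_smult[OF that, of "- 1"] B.inv_eq_smult[of T] compact_bop[OF that] by simp
qed (auto simp: compact_zero compact_add compact_smult dest: compact_bop)

lemma closedin_compact:
  "closedin (norm_topology (bounded_operator_algebra H) opnorm) (compact_operators H)"
  unfolding B.closedin_iff
proof (intro conjI ballI impI)
  show "compact_operators H \<subseteq> carrier (bounded_operator_algebra H)" by (auto dest: compact_bop)
  fix T assume "T \<in> carrier (bounded_operator_algebra H)"
    and ap: "\<forall>\<epsilon>>0. \<exists>S\<in>compact_operators H. opnorm (T \<ominus>\<^bsub>bounded_operator_algebra H\<^esub> S) < \<epsilon>"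
  then have T: "T \<in> \<B>" by simp
  show "T \<in> compact_operators H"
  proof (rule compactI[OF T])
    fix \<epsilon> :: real assume e: "\<epsilon> > 0"
    obtain S where S: "S \<in> compact_operators H" "opnorm (T \<ominus>\<^bsub>bounded_operator_algebra H\<^esub> S) < \<epsilon>/2"
      using ap half_gt_zero[OF e] by blast
    obtain K where K: "finite K" "K \<subseteq> carrier H"
      "\<And>x. \<lbrakk>x \<in> carrier H; hnorm H x \<le> 1\<rbrakk> \<Longrightarrow> \<exists>k\<in>K. hnorm H (S x \<ominus> k) < \<epsilon>/2"
      using compact_net[OF S(1) half_gt_zero[OF e]] by blast
    have "\<exists>k\<in>K. hnorm H (T x \<ominus> k) < \<epsilon>" if x: "x \<in> carrier H" "hnorm H x \<le> 1" for x
    proof -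
      obtain k where k: "k \<in> K" "hnorm H (S x \<ominus> k) < \<epsilon>/2" using K(3)[OF x] by blast
      have SB: "S \<in> \<B>" using S(1) by (rule compact_bop)
      have D: "T \<ominus>\<^bsub>bounded_operator_algebra H\<^esub> S \<in> \<B>" using B.minus_in[of T S] T SB by simp
      have "hnorm H (T x \<ominus> S x) \<le> opnorm (T \<ominus>\<^bsub>bounded_operator_algebra H\<^esub> S) * hnorm H x"
        using opnorm_bound[OF D x(1)] bop_minus_apply[OF T SB x(1)] by simp
      also have "\<dots> \<le> opnorm (T \<ominus>\<^bsub>bounded_operator_algebra H\<^esub> S) * 1"
        using x opnorm_nonneg[OF D] by (intro mult_left_mono) auto
      finally have "hnorm H (T x \<ominus> S x) < \<epsilon>/2" using S(2) by simp
      moreover have "k \<in> carrier H" using k K by auto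
      ultimately have "hnorm H (T x \<ominus> k) < \<epsilon>"
        using N_minus_triangle[of "T x" "S x" k] k(2) T SB x by simp
      then show ?thesis using k by blast
    qed
    then show "\<exists>K. finite K \<and> K \<subseteq> carrier H \<and>
       (\<forall>x\<in>carrier H. hnorm H x \<le> 1 \<longrightarrow> (\<exists>k\<in>K. hnorm H (T x \<ominus> k) < \<epsilon>))"
      using K by blast
  qed
qed

end

text \<open>The matrix with a single entry 1, in row \<open>x\<close> and column \<open>y\<close>:
  it sends \<open>f\<close> to \<open>f y\<close> times \<open>delta x\<close>.\<close>

abbreviation munit :: "'x set \<Rightarrow> 'x \<Rightarrow> 'x \<Rightarrow> ('x \<Rightarrow> complex) \<Rightarrow> 'x \<Rightarrow> complex" where
  "munit X x y \<equiv> wpb X {x} (\<lambda>_. y) 1"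

definition munits :: "'x set \<Rightarrow> (('x \<Rightarrow> complex) \<Rightarrow> 'x \<Rightarrow> complex) set" where
  "munits X = {munit X x y | x y. x \<in> X \<and> y \<in> X}"

lemma munit_bounded: "x \<in> X \<Longrightarrow> munit X x y \<in> bounded_operators (ell2 X) (ell2 X)"
  by (rule wpb_bounded) auto

lemma munits_carrier: "munits X \<subseteq> carrier (bounded_operator_algebra (ell2 X))"
  by (auto simp: munits_def munit_bounded)

text \<open>The unit ball is mapped into the multiples of \<open>delta x\<close> by scalars from the
  closed unit disc, and the disc is totally bounded.\<close>

lemma munit_compact:
  assumes x: "x \<in> X"
  shows "munit X x y \<in> compact_operators (ell2 X)"
proof (rule ell2.compactI[OF munit_bounded[OF x]])
  fix \<epsilon> :: real assume "\<epsilon> > 0"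
  then obtain C where C: "finite C" "cball 0 1 \<subseteq> (\<Union>c\<in>C. ball (c :: complex) \<epsilon>)"
    using compact_cball[of "0 :: complex" 1] unfolding compact_eq_totally_bounded by blast
  define K where "K = (\<lambda>c z. c * delta x z) ` C"
  have "\<exists>k\<in>K. hnorm (ell2 X) (munit X x y f \<ominus>\<^bsub>ell2 X\<^esub> k) < \<epsilon>"
    if f: "f \<in> carrier (ell2 X)" "hnorm (ell2 X) f \<le> 1" for f
  proof -
    have "f y \<in> cball 0 1" using ell2_coordinate_le[OF f(1), of y] f(2) by simp
    then obtain c where c: "c \<in> C" "dist c (f y) < \<epsilon>" using C(2) by auto
    have cd: "(\<lambda>z. c * delta x z) \<in> carrier (ell2 X)" for c
      using ell2_smult_closed[OF delta_in[OF x]] .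
    have "munit X x y f = (\<lambda>z. f y * delta x z)" using f by (auto simp: fun_eq_iff delta_def)
    then have "munit X x y f \<ominus>\<^bsub>ell2 X\<^esub> (\<lambda>z. c * delta x z) = (f y - c) \<odot>\<^bsub>ell2 X\<^esub> delta x"
      using cd by (simp only: ell2_minus ell2_simps left_diff_distrib)
    then have "hnorm (ell2 X) (munit X x y f \<ominus>\<^bsub>ell2 X\<^esub> (\<lambda>z. c * delta x z)) = dist c (f y)"
      using ell2.hnorm_smult[OF delta_in[OF x], of "f y - c"] x by (simp only: hnorm_delta dist_norm norm_minus_commute)
    then show ?thesis using c unfolding K_def by (intro bexI[OF _ imageI[of c]]) auto
  qed
  moreover have "finite K" "K \<subseteq> carrier (ell2 X)"
    using C(1) ell2_smult_closed[OF delta_in[OF x]] by (auto simp: K_def)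
  ultimately show "\<exists>K. finite K \<and> K \<subseteq> carrier (ell2 X) \<and>
       (\<forall>f\<in>carrier (ell2 X). hnorm (ell2 X) f \<le> 1 \<longrightarrow> (\<exists>k\<in>K. hnorm (ell2 X) (munit X x y f \<ominus>\<^bsub>ell2 X\<^esub> k) < \<epsilon>))"
    by blast
qed

definition munit_closure :: "'x set \<Rightarrow> (('x \<Rightarrow> complex) \<Rightarrow> 'x \<Rightarrow> complex) set" where
  "munit_closure X = ell2.B.closure_set X (ell2.B.lin_span X (munits X))"

lemma munit_span_carrier: "ell2.B.lin_span X (munits X) \<subseteq> carrier (bounded_operator_algebra (ell2 X))"
  using ell2.B.lin_span_carrier[OF munits_carrier] by blast

lemma munit_closure_submodule: "submodule (munit_closure X) complex_ring (bounded_operator_algebra (ell2 X))"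
  unfolding munit_closure_def by (rule ell2.B.submodule_closure_span[OF munits_carrier])

lemma munit_closure_compact: "munit_closure X \<subseteq> compact_operators (ell2 X)"
  unfolding munit_closure_def
  by (intro ell2.B.closure_set_subset_closed ell2.closedin_compact
      ell2.B.closed_submodule_contains_span ell2.submodule_compact) (auto simp: munits_def munit_compact)

text \<open>The general bounded operator with values in the line of \<open>delta x\<close>. Row
  \<open>x\<close> of an operator \<open>T\<close> has this form, with \<open>g\<close> the image of
  \<open>delta x\<close> under the adjoint of \<open>T\<close>.\<close>

definition rank_one :: "'x set \<Rightarrow> 'x \<Rightarrow> ('x \<Rightarrow> complex) \<Rightarrow> ('x \<Rightarrow> complex) \<Rightarrow> 'x \<Rightarrow> complex" where
  "rank_one X x g = (\<lambda>f\<in>carrier (ell2 X). \<lambda>z. ip (ell2 X) f g * delta x z)"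

lemma rank_one_bounded:
  assumes x: "x \<in> X" and g: "g \<in> carrier (ell2 X)"
  shows "rank_one X x g \<in> bounded_operators (ell2 X) (ell2 X)"
    and "f \<in> carrier (ell2 X) \<Longrightarrow> hnorm (ell2 X) (rank_one X x g f) \<le> hnorm (ell2 X) g * hnorm (ell2 X) f"
proof -
  show *: "hnorm (ell2 X) (rank_one X x g f) \<le> hnorm (ell2 X) g * hnorm (ell2 X) f"
    if f: "f \<in> carrier (ell2 X)" for f
    using ell2.hnorm_smult[OF delta_in[OF x], of "ip (ell2 X) f g"] x f
      ell2.Cauchy_Schwarz[OF f g] by (simp add: rank_one_def mult.commute)
  show "rank_one X x g \<in> bounded_operators (ell2 X) (ell2 X)"
  proof (rule ell2.bounded_operatorsI[OF _ _ _ _ *])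
    show "rank_one X x g \<in> extensional (carrier (ell2 X))" by (simp add: rank_one_def)
    fix f h c assume f: "f \<in> carrier (ell2 X)"
    show "rank_one X x g f \<in> carrier (ell2 X)"
      using ell2_smult_closed[OF delta_in[OF x]] f by (simp add: rank_one_def)
    show "rank_one X x g (c \<odot>\<^bsub>ell2 X\<^esub> f) = c \<odot>\<^bsub>ell2 X\<^esub> rank_one X x g f"
      using ell2.ip_smult_left[OF f g, of c] ell2_smult_closed[OF f] f by (simp add: rank_one_def mult.assoc)
    assume h: "h \<in> carrier (ell2 X)"
    show "rank_one X x g (f \<oplus>\<^bsub>ell2 X\<^esub> h) = rank_one X x g f \<oplus>\<^bsub>ell2 X\<^esub> rank_one X x g h"
      using ell2.ip_add_left[OF f h g] ell2_add_closed[OF f h] f h by (simp add: rank_one_def distrib_right)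
  qed
qed

lemma rank_one_finite:
  assumes x: "x \<in> X" and "finite F" "F \<subseteq> X"
  shows "(\<lambda>f\<in>carrier (ell2 X). \<lambda>z. (\<Sum>y\<in>F. f y * cnj (g y)) * delta x z) \<in> ell2.B.lin_span X (munits X)"
  using assms(2,3)
proof (induction F)
  case empty
  show ?case using ell2.B.lin_span.zero[of X "munits X"] by (simp add: restrict_def)
next
  case (insert y F)
  have "cnj (g y) \<odot>\<^bsub>bounded_operator_algebra (ell2 X)\<^esub> munit X x y \<in> ell2.B.lin_span X (munits X)"
    using x insert by (intro ell2.B.lin_span.smult ell2.B.lin_span.base) (auto simp: munits_def)
  from ell2.B.lin_span.add[OF this insert.IH]
  have "(\<lambda>f\<in>carrier (ell2 X). \<lambda>z. cnj (g y) * (if z \<in> {x} then 1 * f y else 0) + (\<Sum>y\<in>F. f y * cnj (g y)) * delta x z)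
      \<in> ell2.B.lin_span X (munits X)"
    using insert.prems by (simp cong: restrict_cong)
  moreover have "(\<lambda>f\<in>carrier (ell2 X). \<lambda>z. (\<Sum>y\<in>insert y F. f y * cnj (g y)) * delta x z)
    = (\<lambda>f\<in>carrier (ell2 X). \<lambda>z. cnj (g y) * (if z \<in> {x} then 1 * f y else 0) + (\<Sum>y\<in>F. f y * cnj (g y)) * delta x z)"
    using insert.hyps by (intro restrict_ext ext) (auto simp: delta_def algebra_simps)
  ultimately show ?case by (simp only:)
qed

text \<open>Cutting \<open>g\<close> down to a finite set gives a combination of matrix units, and
  the error is at most the norm of the part of \<open>g\<close> that is cut off.\<close>

lemma rank_one_in_closure:
  assumes x: "x \<in> X" and g: "g \<in> carrier (ell2 X)"
  shows "rank_one X x g \<in> munit_closure X"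
  unfolding munit_closure_def
proof (rule ell2.B.closure_setI)
  show R: "rank_one X x g \<in> carrier (bounded_operator_algebra (ell2 X))" using rank_one_bounded[OF x g] by simp
  fix \<epsilon> :: real assume "\<epsilon> > 0"
  then obtain F where F: "finite F" "F \<subseteq> X" "hnorm (ell2 X) (\<lambda>x. if x \<in> F then 0 else g x) < \<epsilon>"
    using ell2_tail_small[OF g] by blast
  define h where "h = (\<lambda>x. if x \<in> F then 0 else g x)"
  have hg: "h \<in> carrier (ell2 X)"
    using ell2_restrict(1)[OF g, of "- F"] unfolding h_def by (rule back_subst[of "\<lambda>f. f \<in> _"]) auto
  define R' where "R' = (\<lambda>f\<in>carrier (ell2 X). \<lambda>z. (\<Sum>y\<in>F. f y * cnj (g y)) * delta x z)"
  have R': "R' \<in> ell2.B.lin_span X (munits X)" unfolding R'_def by (rule rank_one_finite[OF x F(1,2)])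
  have R'B: "R' \<in> bounded_operators (ell2 X) (ell2 X)" using munit_span_carrier R' by auto
  have RB: "rank_one X x g \<in> bounded_operators (ell2 X) (ell2 X)" using R by simp
  have "operator_norm (ell2 X) (ell2 X) (rank_one X x g \<ominus>\<^bsub>bounded_operator_algebra (ell2 X)\<^esub> R') \<le> hnorm (ell2 X) h"
  proof (rule ell2.opnorm_le[OF ell2.hnorm_nonneg[OF hg]])
    fix f assume f: "f \<in> carrier (ell2 X)"
    have hF: "(\<lambda>z. if z \<in> F then g z else 0) \<in> carrier (ell2 X)" using ell2_restrict(1)[OF g] .
    have "(\<lambda>z. if z \<in> F then g z else 0) \<oplus>\<^bsub>ell2 X\<^esub> h = g" by (auto simp: h_def)
    then have "ip (ell2 X) f g = ip (ell2 X) f (\<lambda>z. if z \<in> F then g z else 0) + ip (ell2 X) f h"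
      using ell2.ip_add_right[OF f hF hg] by simp
    moreover have "ip (ell2 X) f (\<lambda>z. if z \<in> F then g z else 0) = (\<Sum>\<^sub>\<infinity>y\<in>F. f y * cnj (g y))"
      unfolding ell2_ip by (rule infsum_cong_neutral) auto
    ultimately have "(rank_one X x g \<ominus>\<^bsub>bounded_operator_algebra (ell2 X)\<^esub> R') f = rank_one X x h f"
      unfolding ell2.bop_minus_apply[OF RB R'B f]
      using ell2_minus[OF ell2.bop_in[OF RB f] ell2.bop_in[OF R'B f]] F(1) f
      by (simp add: rank_one_def R'_def algebra_simps)
    then show "hnorm (ell2 X) ((rank_one X x g \<ominus>\<^bsub>bounded_operator_algebra (ell2 X)\<^esub> R') f)
        \<le> hnorm (ell2 X) h * hnorm (ell2 X) f"
      using rank_one_bounded(2)[OF x hg f] by simp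
  qed
  also have "\<dots> < \<epsilon>" using F(3) by (simp add: h_def)
  finally show "\<exists>S\<in>ell2.B.lin_span X (munits X).
      operator_norm (ell2 X) (ell2 X) (rank_one X x g \<ominus>\<^bsub>bounded_operator_algebra (ell2 X)\<^esub> S) < \<epsilon>"
    using R' by blast
qed

lemma finite_rows_in_closure:
  assumes T: "T \<in> bounded_operators (ell2 X) (ell2 X)" and "finite F" "F \<subseteq> X"
  shows "(\<lambda>f\<in>carrier (ell2 X). \<lambda>z. if z \<in> F then T f z else 0) \<in> munit_closure X"
  using assms(2,3)
proof (induction F)
  case empty
  show ?case
    using ell2.B.closed_submodule_contains_span[OF munit_closure_submodule, of "{}" X]
      ell2.B.lin_span.zero[of X "{}"] by (auto simp: restrict_def)
next
  case (insert x F)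
  then have x: "x \<in> X" and d: "adjoint_operator (ell2 X) (ell2 X) T (delta x) \<in> carrier (ell2 X)"
    using T by auto
  let ?R = "rank_one X x (adjoint_operator (ell2 X) (ell2 X) T (delta x))"
  have "?R \<oplus>\<^bsub>bounded_operator_algebra (ell2 X)\<^esub> (\<lambda>f\<in>carrier (ell2 X). \<lambda>z. if z \<in> F then T f z else 0) \<in> munit_closure X"
    using insert rank_one_in_closure[OF x d] ell2.B.submoduleE(5)[OF munit_closure_submodule] by auto
  moreover have "?R \<oplus>\<^bsub>bounded_operator_algebra (ell2 X)\<^esub> (\<lambda>f\<in>carrier (ell2 X). \<lambda>z. if z \<in> F then T f z else 0)
      = (\<lambda>f\<in>carrier (ell2 X). \<lambda>z. if z \<in> insert x F then T f z else 0)"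
    unfolding bounded_operator_algebra_simps
  proof (intro restrict_ext)
    fix f assume f: "f \<in> carrier (ell2 X)"
    show "?R f \<oplus>\<^bsub>ell2 X\<^esub> (\<lambda>f\<in>carrier (ell2 X). \<lambda>z. if z \<in> F then T f z else 0) f
        = (\<lambda>z. if z \<in> insert x F then T f z else 0)"
      using ell2.ip_adj[OF T f delta_in[OF x]] f insert.hyps by (auto simp: rank_one_def delta_apply)
  qed
  ultimately show ?case by (simp only:)
qed

text \<open>The image of the unit ball has a finite net, and one finite set \<open>F\<close> carries
  almost all of each point of the net. Discarding the rows of \<open>T\<close> outside
  \<open>F\<close> therefore changes \<open>T\<close> little, and finitely many rows are
  approximated by matrix units.\<close>

theorem compact_operators_ell2: "compact_operators (ell2 X) = munit_closure X"
proof
  show "compact_operators (ell2 X) \<subseteq> munit_closure X"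
  proof
    fix T assume Tc: "T \<in> compact_operators (ell2 X)"
    then have T: "T \<in> bounded_operators (ell2 X) (ell2 X)" by (rule ell2.compact_bop)
    have "T \<in> ell2.B.closure_set X (munit_closure X)"
    proof (rule ell2.B.closure_setI)
      show "T \<in> carrier (bounded_operator_algebra (ell2 X))" using T by simp
      fix \<epsilon> :: real assume e: "\<epsilon> > 0"
      then have e4: "\<epsilon>/4 > 0" by simp
      have "\<exists>K. finite K \<and> K \<subseteq> carrier (ell2 X) \<and> (\<forall>f\<in>carrier (ell2 X). hnorm (ell2 X) f \<le> 1 \<longrightarrow>
          (\<exists>k\<in>K. hnorm (ell2 X) (T f \<ominus>\<^bsub>ell2 X\<^esub> k) < \<epsilon>/4))"
        by (rule ell2.compact_net[OF Tc e4])
      then obtain K where K: "finite K" "K \<subseteq> carrier (ell2 X)"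
        "\<forall>f\<in>carrier (ell2 X). hnorm (ell2 X) f \<le> 1 \<longrightarrow> (\<exists>k\<in>K. hnorm (ell2 X) (T f \<ominus>\<^bsub>ell2 X\<^esub> k) < \<epsilon>/4)"
        by (elim exE conjE)
      have "\<forall>k\<in>K. \<exists>F. finite F \<and> F \<subseteq> X \<and> (\<forall>G. F \<subseteq> G \<longrightarrow> hnorm (ell2 X) (\<lambda>x. if x \<in> G then 0 else k x) < \<epsilon>/4)"
        using K(2) by (intro ballI ell2_tail_small e4) auto
      from bchoice[OF this] obtain \<Phi> where \<Phi>: "\<forall>k\<in>K. finite (\<Phi> k) \<and> \<Phi> k \<subseteq> X \<and>
          (\<forall>G. \<Phi> k \<subseteq> G \<longrightarrow> hnorm (ell2 X) (\<lambda>x. if x \<in> G then 0 else k x) < \<epsilon>/4)"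
        by (elim exE)
      define F where "F = (\<Union>k\<in>K. \<Phi> k)"
      have F: "finite F" "F \<subseteq> X" using \<Phi> K(1) by (auto simp: F_def)
      define S where "S = (\<lambda>f\<in>carrier (ell2 X). \<lambda>z. if z \<in> F then T f z else 0)"
      have S: "S \<in> munit_closure X" unfolding S_def by (rule finite_rows_in_closure[OF T F])
      then have SB: "S \<in> bounded_operators (ell2 X) (ell2 X)"
        using munit_closure_compact ell2.compact_bop by blast
      have D: "T \<ominus>\<^bsub>bounded_operator_algebra (ell2 X)\<^esub> S \<in> bounded_operators (ell2 X) (ell2 X)"
        using ell2.B.minus_in[of T X S] T SB by simp
      have "operator_norm (ell2 X) (ell2 X) (T \<ominus>\<^bsub>bounded_operator_algebra (ell2 X)\<^esub> S) \<le> \<epsilon>/2"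
        \<comment> \<open>The net concerns the unit ball and gives no bound proportional to the norm
          of \<open>f\<close>, so the supremum is estimated directly.\<close>
        unfolding operator_norm_def
      proof (rule cSUP_least)
        show "{f \<in> carrier (ell2 X). hnorm (ell2 X) f \<le> 1} \<noteq> {}"
          using ell2_zero_closed[of X] ell2.N_zero[of X] by (auto intro!: exI[of _ "\<lambda>x. 0"])
        fix f assume "f \<in> {f \<in> carrier (ell2 X). hnorm (ell2 X) f \<le> 1}"
        then have f: "f \<in> carrier (ell2 X)" "hnorm (ell2 X) f \<le> 1" by auto
        obtain k where k: "k \<in> K" "hnorm (ell2 X) (T f \<ominus>\<^bsub>ell2 X\<^esub> k) < \<epsilon>/4" using K(3)[rule_format, OF f] by blast
        have kc: "k \<in> carrier (ell2 X)" and Tf: "T f \<in> carrier (ell2 X)" using k K T f by auto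
        define d where "d = T f \<ominus>\<^bsub>ell2 X\<^esub> k"
        have dc: "d \<in> carrier (ell2 X)" and d: "d = (\<lambda>z. T f z - k z)"
          unfolding d_def by (rule ell2.minus_in[OF Tf kc], rule ell2_minus[OF Tf kc])
        let ?d = "\<lambda>z. if z \<in> - F then d z else 0" and ?k = "\<lambda>z. if z \<in> - F then k z else 0"
        have "(T \<ominus>\<^bsub>bounded_operator_algebra (ell2 X)\<^esub> S) f = (\<lambda>z. T f z - S f z)"
          unfolding ell2.bop_minus_apply[OF T SB f(1)] using ell2_minus[OF Tf ell2.bop_in[OF SB f(1)]] .
        \<comment> \<open>Off \<open>F\<close>, split \<open>T f\<close> into its difference from
          the net point \<open>k\<close> and \<open>k\<close> itself; each contributes at most a
          quarter of \<open>\<epsilon>\<close>.\<close>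
        also have "\<dots> = ?d \<oplus>\<^bsub>ell2 X\<^esub> ?k" using f by (auto simp: S_def d)
        finally have "hnorm (ell2 X) ((T \<ominus>\<^bsub>bounded_operator_algebra (ell2 X)\<^esub> S) f)
            \<le> hnorm (ell2 X) ?d + hnorm (ell2 X) ?k"
          using ell2.N_triangle[OF ell2_restrict(1)[OF dc] ell2_restrict(1)[OF kc], of "- F" "- F"] by simp
        also have "hnorm (ell2 X) ?d \<le> hnorm (ell2 X) d" by (rule ell2_restrict(2)[OF dc])
        also have "?k = (\<lambda>z. if z \<in> F then 0 else k z)" by auto
        also have "hnorm (ell2 X) (\<lambda>z. if z \<in> F then 0 else k z) \<le> \<epsilon>/4"
        proof (rule less_imp_le)
          have "\<Phi> k \<subseteq> F" using k(1) by (auto simp: F_def)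
          then show "hnorm (ell2 X) (\<lambda>z. if z \<in> F then 0 else k z) < \<epsilon>/4"
            using bspec[OF \<Phi> k(1)] by (elim conjE allE) (rule mp)
        qed
        finally show "hnorm (ell2 X) ((T \<ominus>\<^bsub>bounded_operator_algebra (ell2 X)\<^esub> S) f) \<le> \<epsilon>/2"
          using k(2) by (simp add: d_def)
      qed
      then show "\<exists>S\<in>munit_closure X. operator_norm (ell2 X) (ell2 X) (T \<ominus>\<^bsub>bounded_operator_algebra (ell2 X)\<^esub> S) < \<epsilon>"
        using S e by (intro bexI[of _ S]) auto
    qed
    then show "T \<in> munit_closure X"
      using ell2.B.closure_set_idem[OF munit_span_carrier[of X]] by (simp add: munit_closure_def)
  qed
qed (rule munit_closure_compact)


section \<open>Coefficients of elements of a span\<close>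

context normed_module
begin

lemma lin_span_finsum:
  assumes "finite I" "f \<in> I \<rightarrow> carrier V" "x \<in> lin_span (f ` I)"
  shows "\<exists>c. x = (\<Oplus>i\<in>I. c i \<odot> f i)"
  using assms(3)
proof induction
  case zero
  have "(\<Oplus>i\<in>I. 0 \<odot> f i) = (\<Oplus>i\<in>I. \<zero>)"
    using assms(2) by (intro M.finsum_cong') (auto simp: Pi_iff)
  then show ?case by (intro exI[of _ "\<lambda>_. 0"]) (simp add: M.finsum_zero)
next
  case (base g)
  then obtain j where j: "j \<in> I" "g = f j" by blast
  have "(\<Oplus>i\<in>I. (if j = i then 1 else 0) \<odot> f i) = (\<Oplus>i\<in>I. if j = i then f i else \<zero>)"
    using assms(2) by (intro M.finsum_cong') (auto simp: Pi_iff)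
  also have "\<dots> = f j" by (rule M.finsum_singleton) (use j assms in auto)
  finally show ?case using j by (intro exI[of _ "\<lambda>i. if j = i then 1 else 0"]) simp
next
  case (add x y)
  then obtain c d where "x = (\<Oplus>i\<in>I. c i \<odot> f i)" "y = (\<Oplus>i\<in>I. d i \<odot> f i)" by blast
  then have "x \<oplus> y = (\<Oplus>i\<in>I. c i \<odot> f i \<oplus> d i \<odot> f i)"
    using assms(2) by (subst M.finsum_addf) auto
  also have "\<dots> = (\<Oplus>i\<in>I. (c i + d i) \<odot> f i)"
    using assms(2) by (intro M.finsum_cong') (auto simp: add_smult Pi_iff)
  finally show ?case by (intro exI[of _ "\<lambda>i. c i + d i"])
next
  case (smult x a)
  then obtain c where "x = (\<Oplus>i\<in>I. c i \<odot> f i)" by blast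
  then have "a \<odot> x = (\<Oplus>i\<in>I. a \<odot> (c i \<odot> f i))"
    using assms(1,2) finsum_smult_ldistr[of I a "\<lambda>i. c i \<odot> f i"] by (simp add: Pi_iff)
  also have "\<dots> = (\<Oplus>i\<in>I. (a * c i) \<odot> f i)"
    using assms(2) by (intro M.finsum_cong') (auto simp: mult_smult Pi_iff)
  finally show ?case by (intro exI[of _ "\<lambda>i. a * c i"])
qed

end

text \<open>If \<open>t < s\<close>, the powers of \<open>s / t\<close> outgrow every constant. The
  exponents are powers of 2 because the C*-identity controls norms under repeated squaring.\<close>

lemma le_if_powers_le:
  fixes s t K :: real
  assumes "0 \<le> s" "0 \<le> t" and le: "\<And>n. s ^ (2 ^ n) \<le> K * t ^ (2 ^ n)"
  shows "s \<le> t"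
proof (rule ccontr)
  assume "\<not> s \<le> t"
  then have st: "t < s" by simp
  show False
  proof (cases "t = 0")
    case True
    then show False using le[of 0] st by simp
  next
    case False
    then have t: "t > 0" using assms by simp
    then have "1 < s / t" using st by simp
    then obtain n where n: "K < (s / t) ^ n" using real_arch_pow by blast
    also have "(s / t) ^ n \<le> (s / t) ^ (2 ^ n)"
      using \<open>1 < s / t\<close> by (intro power_increasing) (auto simp: less_imp_le[OF less_exp])
    finally have "K * t ^ (2 ^ n) < s ^ (2 ^ n)"
      using t by (simp add: power_divide field_simps)
    then show False using le[of n] by simp
  qed
qed

section \<open>Algebras spanned by matrix units\<close>

text \<open>The representation \<open>\<pi>\<close> is part of the data: for a graph algebra it
  comes from the universal property, and it remains to see that it is isometric with the compact
  operators as its range.\<close>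

locale matrix_unit_algebra = cstar_algebra A for A :: "'a cstar" (structure) +
  fixes X :: "'x set" and \<pi> :: "'a \<Rightarrow> ('x \<Rightarrow> complex) \<Rightarrow> 'x \<Rightarrow> complex" and a :: "'x \<Rightarrow> 'x \<Rightarrow> 'a"
  assumes hom: "star_hom A (bounded_operator_algebra (ell2 X)) \<pi>"
    and a_in: "\<lbrakk>x \<in> X; y \<in> X\<rbrakk> \<Longrightarrow> a x y \<in> carrier A"
    and a_mult: "\<lbrakk>x \<in> X; y \<in> X; z \<in> X; w \<in> X\<rbrakk> \<Longrightarrow> a x y \<otimes> a z w = (if y = z then a x w else \<zero>)"
    and a_star: "\<lbrakk>x \<in> X; y \<in> X\<rbrakk> \<Longrightarrow> star A (a x y) = a y x"
    and \<pi>_a: "\<lbrakk>x \<in> X; y \<in> X\<rbrakk> \<Longrightarrow> \<pi> (a x y) = munit X x y"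
    and dense: "carrier A \<subseteq> closure_set (lin_span {a x y | x y. x \<in> X \<and> y \<in> X})"
begin

abbreviation opn where "opn \<equiv> operator_norm (ell2 X) (ell2 X)"
abbreviation BB where "BB \<equiv> bounded_operator_algebra (ell2 X)"

text \<open>For a finite subset of \<open>X\<close> this is a copy of a full matrix algebra.\<close>

definition Sp :: "'x set \<Rightarrow> 'a set" where
  "Sp F = lin_span {a x y | x y. x \<in> F \<and> y \<in> F}"

lemma \<pi>_in: "b \<in> carrier A \<Longrightarrow> \<pi> b \<in> bounded_operators (ell2 X) (ell2 X)"
  and \<pi>_add: "\<lbrakk>b \<in> carrier A; c \<in> carrier A\<rbrakk> \<Longrightarrow> \<pi> (b \<oplus> c) = \<pi> b \<oplus>\<^bsub>BB\<^esub> \<pi> c"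
  and \<pi>_smult: "b \<in> carrier A \<Longrightarrow> \<pi> (k \<odot> b) = k \<odot>\<^bsub>BB\<^esub> \<pi> b"
  and \<pi>_mult: "\<lbrakk>b \<in> carrier A; c \<in> carrier A\<rbrakk> \<Longrightarrow> \<pi> (b \<otimes> c) = \<pi> b \<otimes>\<^bsub>BB\<^esub> \<pi> c"
  and \<pi>_star: "b \<in> carrier A \<Longrightarrow> \<pi> (star A b) = star BB (\<pi> b)"
  using hom unfolding star_hom_def by auto

lemma \<pi>_zero: "\<pi> \<zero> = \<zero>\<^bsub>BB\<^esub>"
  using \<pi>_smult[of \<zero> 0] ell2.B.zero_smult[of "\<pi> \<zero>" X] \<pi>_in[of \<zero>] by simp

lemma \<pi>_minus: "\<lbrakk>b \<in> carrier A; c \<in> carrier A\<rbrakk> \<Longrightarrow> \<pi> (b \<ominus> c) = \<pi> b \<ominus>\<^bsub>BB\<^esub> \<pi> c"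
  using ell2.B.minus_eq_smult[of "\<pi> b" X "\<pi> c"] \<pi>_in
  by (simp add: minus_eq_smult \<pi>_add \<pi>_smult del: bounded_operator_algebra_simps(4,5))

lemma Sp_in: assumes "F \<subseteq> X" "b \<in> Sp F" shows "b \<in> carrier A"
  using assms(2) lin_span_carrier[of "{a x y | x y. x \<in> F \<and> y \<in> F}" b] assms(1) a_in by (auto simp: Sp_def)

lemma Sp_mult_unit:
  assumes F: "F \<subseteq> X" and b: "b \<in> Sp F" and xy: "x \<in> F" "y \<in> F"
  shows "b \<otimes> a x y \<in> Sp F"
  using b unfolding Sp_def
proof induction
  case zero
  then show ?case using F xy a_in[of x y] by (simp add: subset_iff lin_span.zero)
next
  case (base g)
  then obtain u v where "u \<in> F" "v \<in> F" "g = a u v" by blast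
  then have "g \<otimes> a x y = (if v = x then a u y else \<zero>)" "u \<in> F"
    using xy a_mult[of u v x y] subsetD[OF F] by simp_all
  then show ?case using xy by (auto intro: lin_span.zero lin_span.base)
next
  case (add b c)
  then show ?case
    using mult_distrib_right[of b c "a x y"] xy a_in[OF subsetD[OF F] subsetD[OF F]] Sp_in[OF F] by (auto simp: Sp_def intro!: lin_span.add)
next
  case (smult b k)
  then show ?case
    using smult_mult_left[of b "a x y" k] xy a_in[OF subsetD[OF F] subsetD[OF F]] Sp_in[OF F] by (auto simp: Sp_def intro!: lin_span.smult)
qed

lemma Sp_mult:
  assumes F: "F \<subseteq> X" and b: "b \<in> Sp F" and c: "c \<in> Sp F"
  shows "b \<otimes> c \<in> Sp F"
  using c unfolding Sp_def
proof induction
  case zero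
  then show ?case using Sp_in[OF F b] by (auto intro: lin_span.zero)
next
  case (base g)
  then show ?case using Sp_mult_unit[OF F b] by (auto simp: Sp_def)
next
  case (add c d)
  then show ?case
    using mult_distrib_left[of b c d] Sp_in[OF F] b by (auto simp: Sp_def intro!: lin_span.add)
next
  case (smult c k)
  then show ?case
    using smult_mult_right[of b c k] Sp_in[OF F] b by (auto simp: Sp_def intro!: lin_span.smult)
qed

lemma Sp_star:
  assumes F: "F \<subseteq> X" and b: "b \<in> Sp F"
  shows "star A b \<in> Sp F"
  using b unfolding Sp_def
proof induction
  case zero
  then show ?case by (auto intro: lin_span.zero)
next
  case (base g)
  then obtain x y where "x \<in> F" "y \<in> F" "g = a x y" by blast
  then show ?case using F a_star[of x y] by (intro lin_span.base) auto
next
  case (add b c)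
  then show ?case
    using star_add[of b c] Sp_in[OF F] by (auto simp: Sp_def intro!: lin_span.add)
next
  case (smult b k)
  then show ?case
    using star_smult[of b k] Sp_in[OF F] by (auto simp: Sp_def intro!: lin_span.smult)
qed

lemma \<pi>_finsum:
  assumes "finite I" "I \<subseteq> X \<times> X" "f \<in> carrier (ell2 X)"
  shows "\<pi> (\<Oplus>i\<in>I. c i \<odot> a (fst i) (snd i)) f z = (\<Sum>i\<in>I. if z = fst i then c i * f (snd i) else 0)"
  using assms(1,2)
proof (induction I)
  case empty
  then show ?case using assms(3) \<pi>_zero by simp
next
  case (insert i I)
  then have in_A: "(\<lambda>i. c i \<odot> a (fst i) (snd i)) \<in> I \<rightarrow> carrier A" "c i \<odot> a (fst i) (snd i) \<in> carrier A"
    "a (fst i) (snd i) \<in> carrier A"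
    using a_in by auto
  have "(\<Oplus>i\<in>insert i I. c i \<odot> a (fst i) (snd i))
      = c i \<odot> a (fst i) (snd i) \<oplus> (\<Oplus>i\<in>I. c i \<odot> a (fst i) (snd i))"
    using insert in_A by (intro finsum_insert)
  then have "\<pi> (\<Oplus>i\<in>insert i I. c i \<odot> a (fst i) (snd i)) f z
      = c i * munit X (fst i) (snd i) f z + \<pi> (\<Oplus>i\<in>I. c i \<odot> a (fst i) (snd i)) f z"
    using in_A assms(3) insert.prems by (simp add: \<pi>_add \<pi>_smult finsum_closed \<pi>_a mem_Times_iff del: wpb_apply)
  then show ?case using insert assms(3) by simp
qed

text \<open>The coefficients of \<open>b\<close> are matrix entries of \<open>\<pi> b\<close>, so
  they are bounded by its norm; the constant is the sum of the norms of the finitely many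
  units.\<close>

lemma norm_le_opn_finite:
  assumes F: "finite F" "F \<subseteq> X"
  obtains K where "0 \<le> K" "\<And>b. b \<in> Sp F \<Longrightarrow> alg_norm A b \<le> K * opn (\<pi> b)"
proof
  let ?K = "\<Sum>i\<in>F \<times> F. alg_norm A (a (fst i) (snd i))"
  show "0 \<le> ?K" using F by (intro sum_nonneg norm_nonneg a_in) auto
  fix b assume b: "b \<in> Sp F"
  have bA: "b \<in> carrier A" using Sp_in[OF F(2) b] .
  have "{a x y | x y. x \<in> F \<and> y \<in> F} = (\<lambda>i. a (fst i) (snd i)) ` (F \<times> F)"
    by force
  moreover have "(\<lambda>i. a (fst i) (snd i)) \<in> F \<times> F \<rightarrow> carrier A" using a_in subsetD[OF F(2)] by auto
  ultimately obtain c where c: "b = (\<Oplus>i\<in>F \<times> F. c i \<odot> a (fst i) (snd i))"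
    using lin_span_finsum[of "F \<times> F" "\<lambda>i. a (fst i) (snd i)" b] F b by (auto simp: Sp_def)
  have coeff: "cmod (c (x, y)) \<le> opn (\<pi> b)" if "x \<in> F" "y \<in> F" for x y
  proof -
    have dy: "delta y \<in> carrier (ell2 X)" using that F by auto
    have "\<pi> b (delta y) x = (\<Sum>i\<in>F \<times> F. if x = fst i then c i * delta y (snd i) else 0)"
      unfolding c using F by (intro \<pi>_finsum dy) auto
    also have "\<dots> = (\<Sum>i\<in>{(x, y)}. if x = fst i then c i * delta y (snd i) else 0)"
      using F that by (intro sum.mono_neutral_right) (auto simp: delta_apply)
    finally have "cmod (c (x, y)) = cmod (\<pi> b (delta y) x)" by simp
    also have "\<dots> \<le> hnorm (ell2 X) (\<pi> b (delta y))"
      using \<pi>_in[OF bA] dy by (intro ell2_coordinate_le) auto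
    also have "\<dots> \<le> opn (\<pi> b) * hnorm (ell2 X) (delta y)"
      using \<pi>_in[OF bA] dy by (intro ell2.opnorm_bound)
    finally show ?thesis using that F by auto
  qed
  have "alg_norm A b \<le> (\<Sum>i\<in>F \<times> F. alg_norm A (c i \<odot> a (fst i) (snd i)))"
    unfolding c using F(1) a_in[OF subsetD[OF F(2)] subsetD[OF F(2)]] by (intro N_finsum_le) auto
  also have "\<dots> \<le> (\<Sum>i\<in>F \<times> F. opn (\<pi> b) * alg_norm A (a (fst i) (snd i)))"
  proof (intro sum_mono)
    fix i assume "i \<in> F \<times> F"
    then have "a (fst i) (snd i) \<in> carrier A" "cmod (c i) \<le> opn (\<pi> b)"
      using a_in[OF subsetD[OF F(2)] subsetD[OF F(2)]] coeff[of "fst i" "snd i"] by auto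
    then show "alg_norm A (c i \<odot> a (fst i) (snd i)) \<le> opn (\<pi> b) * alg_norm A (a (fst i) (snd i))"
      by (simp add: norm_smult mult_right_mono norm_nonneg)
  qed
  also have "\<dots> = ?K * opn (\<pi> b)" by (rule sym, subst mult.commute, rule sum_distrib_left)
  finally show "alg_norm A b \<le> ?K * opn (\<pi> b)" .
qed

text \<open>On the finite-dimensional algebra \<open>Sp F\<close> the two norms are equivalent; for self-adjoint \<open>d\<close>
  both sides of the estimate may be replaced by their \<open>2\<^sup>n\<close>-th powers, which removes the constant.\<close>

lemma norm_le_opn_Sp:
  assumes F: "finite F" "F \<subseteq> X" and b: "b \<in> Sp F"
  shows "alg_norm A b \<le> opn (\<pi> b)"
proof -
  obtain K where K: "0 \<le> K" "\<And>b. b \<in> Sp F \<Longrightarrow> alg_norm A b \<le> K * opn (\<pi> b)"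
    using norm_le_opn_finite[OF F] by blast
  define d where "d = star A b \<otimes> b"
  \<comment> \<open>Repeated squaring: \<open>e n\<close> is the power of \<open>d\<close> with
    exponent \<open>2 ^ n\<close>.\<close>
  define e where "e n = ((\<lambda>x. x \<otimes> x) ^^ n) d" for n
  have bA: "b \<in> carrier A" using Sp_in[OF F(2) b] .
  have BBc: "cstar_algebra BB" by (rule ell2.cstar_bounded_operator_algebra)
  have norm_sq: "opn (\<pi> (star A x \<otimes> x)) = (opn (\<pi> x))\<^sup>2" if x: "x \<in> carrier A" for x
    using cstar_algebra.cstar_identity[OF BBc, of "\<pi> x"] \<pi>_in[OF x] x by (simp add: \<pi>_mult \<pi>_star)
  have e: "e n \<in> Sp F \<and> star A (e n) = e n \<and> alg_norm A (e n) = alg_norm A d ^ (2 ^ n) \<and>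
      opn (\<pi> (e n)) = opn (\<pi> d) ^ (2 ^ n)" for n
  proof (induction n)
    case 0
    then show ?case using Sp_mult[OF F(2) Sp_star[OF F(2) b] b] bA by (simp add: e_def d_def star_mult)
  next
    case (Suc n)
    have eA: "e n \<in> carrier A" using Suc Sp_in[OF F(2)] by blast
    \<comment> \<open>As \<open>e n\<close> is self-adjoint, its square is its adjoint times itself,
      so the C*-identity squares both norms exactly.\<close>
    have eS: "e (Suc n) = star A (e n) \<otimes> e n" using Suc by (simp add: e_def)
    have "alg_norm A (e (Suc n)) = (alg_norm A (e n))\<^sup>2" unfolding eS using eA by (rule cstar_identity)
    moreover have "opn (\<pi> (e (Suc n))) = (opn (\<pi> (e n)))\<^sup>2" unfolding eS using eA by (rule norm_sq)
    moreover have "star A (e (Suc n)) = e (Suc n)" unfolding eS using eA by (simp add: star_mult)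
    moreover have "e (Suc n) \<in> Sp F" unfolding eS using Suc Sp_mult[OF F(2)] by simp
    ultimately show ?case using Suc by (simp add: power_mult[symmetric] mult.commute)
  qed
  have dA: "d \<in> carrier A" using bA by (simp add: d_def)
  have "alg_norm A d \<le> opn (\<pi> d)"
  proof (rule le_if_powers_le)
    show "alg_norm A d ^ 2 ^ n \<le> K * opn (\<pi> d) ^ 2 ^ n" for n using e[of n] K(2)[of "e n"] by simp
  qed (use dA \<pi>_in ell2.opnorm_nonneg norm_nonneg in auto)
  then have "(alg_norm A b)\<^sup>2 \<le> (opn (\<pi> b))\<^sup>2"
    using cstar_identity[OF bA] norm_sq[OF bA] by (simp add: d_def)
  then show ?thesis by (rule power2_le_imp_le) (use bA \<pi>_in ell2.opnorm_nonneg in auto)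
qed

abbreviation "units \<equiv> {a x y | x y. x \<in> X \<and> y \<in> X}"

lemma units_carrier: "units \<subseteq> carrier A"
  using a_in by auto

lemma norm_le_opn_span:
  assumes "b \<in> lin_span units"
  shows "alg_norm A b \<le> opn (\<pi> b)"
proof -
  obtain G where G: "finite G" "G \<subseteq> units" "b \<in> lin_span G"
    using lin_span_finite_subset[OF assms] by blast
  have "\<forall>g\<in>G. \<exists>x y. x \<in> X \<and> y \<in> X \<and> g = a x y" using G(2) by blast
  then obtain x y where xy: "\<And>g. g \<in> G \<Longrightarrow> x g \<in> X \<and> y g \<in> X \<and> g = a (x g) (y g)" by metis
  define F where "F = x ` G \<union> y ` G"
  have F: "finite F" "F \<subseteq> X" using G xy by (auto simp: F_def)
  have "G \<subseteq> {a x y | x y. x \<in> F \<and> y \<in> F}"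
  proof
    fix g assume "g \<in> G"
    then show "g \<in> {a x y | x y. x \<in> F \<and> y \<in> F}" using xy[of g] by (auto simp: F_def)
  qed
  then have "b \<in> Sp F" using lin_span_mono G(3) by (auto simp: Sp_def)
  then show ?thesis by (rule norm_le_opn_Sp[OF F])
qed

lemma contractive: "b \<in> carrier A \<Longrightarrow> opn (\<pi> b) \<le> alg_norm A b"
  by (rule ell2.star_hom_contractive[OF cstar_algebra_axioms hom])

text \<open>Contractivity is one inequality. The other holds on the dense span of the units and
  passes to all of \<open>A\<close>, because contractivity also makes the operator norm of the image
  continuous.\<close>

lemma isometric:
  assumes b: "b \<in> carrier A"
  shows "opn (\<pi> b) = alg_norm A b"
proof (rule antisym[OF contractive[OF b]], rule field_le_epsilon)
  fix e :: real assume e: "e > 0"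
  obtain c where c: "c \<in> lin_span units" "alg_norm A (b \<ominus> c) < e/2"
    using closure_setD[OF subsetD[OF dense b], of "e/2"] e by auto
  have cA: "c \<in> carrier A" using lin_span_carrier[OF units_carrier c(1)] .
  have "alg_norm A b \<le> alg_norm A (b \<ominus> c) + alg_norm A c" using b cA by (rule N_le_minus)
  also have "alg_norm A c \<le> opn (\<pi> c)" by (rule norm_le_opn_span[OF c(1)])
  also have "opn (\<pi> c) \<le> opn (\<pi> c \<ominus>\<^bsub>BB\<^esub> \<pi> b) + opn (\<pi> b)"
    using ell2.B.N_le_minus[of "\<pi> c" X "\<pi> b"] \<pi>_in b cA by simp
  also have "opn (\<pi> c \<ominus>\<^bsub>BB\<^esub> \<pi> b) \<le> alg_norm A (b \<ominus> c)"
    using contractive[of "c \<ominus> b"] b cA by (simp add: \<pi>_minus N_minus_commute[of b c])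
  finally show "alg_norm A b \<le> opn (\<pi> b) + e" using c(2) by simp
qed

lemma \<pi>_span: "b \<in> lin_span units \<Longrightarrow> \<pi> b \<in> ell2.B.lin_span X (munits X)"
proof (induction rule: lin_span.induct)
  case zero
  then show ?case unfolding \<pi>_zero by (rule ell2.B.lin_span.zero)
next
  case (base g)
  then obtain x y where "x \<in> X" "y \<in> X" "g = a x y" by blast
  then show ?case using \<pi>_a[of x y] by (intro ell2.B.lin_span.base) (auto simp: munits_def)
next
  case (add b c)
  then show ?case
    unfolding \<pi>_add[OF lin_span_carrier[OF units_carrier add.hyps(1)] lin_span_carrier[OF units_carrier add.hyps(2)]]
    by (intro ell2.B.lin_span.add)
next
  case (smult b k)
  then show ?case
    unfolding \<pi>_smult[OF lin_span_carrier[OF units_carrier smult.hyps]] by (intro ell2.B.lin_span.smult)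
qed

lemma span_in_range: "T \<in> ell2.B.lin_span X (munits X) \<Longrightarrow> \<exists>b\<in>carrier A. \<pi> b = T"
proof (induction rule: ell2.B.lin_span.induct)
  case zero
  then show ?case using \<pi>_zero by (intro bexI[of _ \<zero>]) auto
next
  case (base g)
  then obtain x y where "x \<in> X" "y \<in> X" "g = munit X x y" by (auto simp: munits_def)
  then show ?case using a_in \<pi>_a by (intro bexI[of _ "a x y"]) auto
next
  case (add S T)
  then obtain b c where "b \<in> carrier A" "\<pi> b = S" "c \<in> carrier A" "\<pi> c = T" by blast
  then show ?case using \<pi>_add[of b c] by (intro bexI[of _ "b \<oplus> c"]) auto
next
  case (smult S k)
  then obtain b where "b \<in> carrier A" "\<pi> b = S" by blast
  then show ?case using \<pi>_smult[of b k] by (intro bexI[of _ "k \<odot> b"]) auto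
qed

lemma \<pi>_compact:
  assumes b: "b \<in> carrier A"
  shows "\<pi> b \<in> compact_operators (ell2 X)"
  unfolding compact_operators_ell2 munit_closure_def
proof (rule ell2.B.closure_setI)
  show "\<pi> b \<in> carrier BB" using \<pi>_in[OF b] by simp
  fix e :: real assume "e > 0"
  then obtain c where c: "c \<in> lin_span units" "alg_norm A (b \<ominus> c) < e"
    using closure_setD[OF subsetD[OF dense b], of e] by auto
  have cA: "c \<in> carrier A" using lin_span_carrier[OF units_carrier c(1)] .
  have "opn (\<pi> b \<ominus>\<^bsub>BB\<^esub> \<pi> c) < e" using isometric[of "b \<ominus> c"] b cA c(2) by (simp add: \<pi>_minus)
  then show "\<exists>S\<in>ell2.B.lin_span X (munits X). opn (\<pi> b \<ominus>\<^bsub>BB\<^esub> S) < e" using \<pi>_span[OF c(1)] by blast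
qed

text \<open>An isometry between complete spaces has closed range: preimages of operators that
  converge to \<open>T\<close> form a Cauchy sequence, and its limit is mapped to
  \<open>T\<close>.\<close>

lemma compact_in_range:
  assumes T: "T \<in> compact_operators (ell2 X)"
  shows "\<exists>b\<in>carrier A. \<pi> b = T"
proof -
  have TB: "T \<in> carrier BB" using ell2.compact_bop[OF T] by simp
  have Tc: "T \<in> ell2.B.closure_set X (ell2.B.lin_span X (munits X))"
    using T unfolding compact_operators_ell2 munit_closure_def .
  have "\<exists>b. b \<in> carrier A \<and> opn (T \<ominus>\<^bsub>BB\<^esub> \<pi> b) < 1 / Suc n" for n
  proof -
    obtain S where S: "S \<in> ell2.B.lin_span X (munits X)" "opn (T \<ominus>\<^bsub>BB\<^esub> S) < 1 / Suc n"
      using ell2.B.closure_setD[OF Tc, of "1 / Suc n"] by auto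
    then show ?thesis using span_in_range[OF S(1)] by auto
  qed
  then obtain b where b: "\<And>n. b n \<in> carrier A" "\<And>n. opn (T \<ominus>\<^bsub>BB\<^esub> \<pi> (b n)) < 1 / Suc n"
    using choice[of "\<lambda>n b. b \<in> carrier A \<and> opn (T \<ominus>\<^bsub>BB\<^esub> \<pi> b) < 1 / Suc n"] by blast
  have \<pi>b: "\<pi> (b n) \<in> carrier BB" for n using \<pi>_in[OF b(1)] by simp
  have lim: "(\<lambda>n. opn (\<pi> (b n) \<ominus>\<^bsub>BB\<^esub> T)) \<longlonglongrightarrow> 0"
  proof (rule tendsto_sandwich[of "\<lambda>_. 0" _ _ "\<lambda>n. 1 / Suc n"])
    show "\<forall>\<^sub>F n in sequentially. opn (\<pi> (b n) \<ominus>\<^bsub>BB\<^esub> T) \<le> 1 / Suc n"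
      using b(2) ell2.B.N_minus_commute[OF TB \<pi>b] by (auto intro!: always_eventually less_imp_le)
    show "(\<lambda>n. 1 / real (Suc n)) \<longlonglongrightarrow> 0" by (rule LIMSEQ_Suc[OF lim_1_over_n])
  qed (use ell2.B.N_nonneg[OF ell2.B.minus_in[OF \<pi>b TB]] in auto)
  have "\<exists>k. \<forall>m\<ge>k. \<forall>n\<ge>k. alg_norm A (b m \<ominus> b n) < \<epsilon>" if "\<epsilon> > 0" for \<epsilon>
  proof -
    have "\<forall>\<^sub>F n in sequentially. opn (\<pi> (b n) \<ominus>\<^bsub>BB\<^esub> T) < \<epsilon>/2"
      using lim by (rule order_tendstoD) (use \<open>\<epsilon> > 0\<close> in simp)
    then obtain k where k: "\<And>n. n \<ge> k \<Longrightarrow> opn (\<pi> (b n) \<ominus>\<^bsub>BB\<^esub> T) < \<epsilon>/2" by (auto simp: eventually_sequentially)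
    have "alg_norm A (b m \<ominus> b n) < \<epsilon>" if "m \<ge> k" "n \<ge> k" for m n
    proof -
      have "alg_norm A (b m \<ominus> b n) = opn (\<pi> (b m) \<ominus>\<^bsub>BB\<^esub> \<pi> (b n))"
        using isometric[of "b m \<ominus> b n"] b(1) by (simp add: \<pi>_minus)
      also have "\<dots> \<le> opn (\<pi> (b m) \<ominus>\<^bsub>BB\<^esub> T) + opn (T \<ominus>\<^bsub>BB\<^esub> \<pi> (b n))"
        by (rule ell2.B.N_minus_triangle[OF \<pi>b TB \<pi>b])
      finally show ?thesis using k[OF that(1)] k[OF that(2)] ell2.B.N_minus_commute[OF TB \<pi>b, of n] by simp
    qed
    then show ?thesis by blast
  qed
  then obtain l where l: "l \<in> carrier A" "(\<lambda>n. alg_norm A (b n \<ominus> l)) \<longlonglongrightarrow> 0"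
    using complete_tendsto[OF complete, of b] b(1) by blast
  have "(\<lambda>n. opn (\<pi> (b n) \<ominus>\<^bsub>BB\<^esub> \<pi> l)) \<longlonglongrightarrow> 0"
    using l b(1) isometric[of "b _ \<ominus> l"] by (simp add: \<pi>_minus[symmetric])
  then have "\<pi> l = T"
    using ell2.B.tendsto_unique_limit[of "\<lambda>n. \<pi> (b n)" X "\<pi> l" T] \<pi>b \<pi>_in[OF l(1)] TB lim by simp
  then show ?thesis using l(1) by blast
qed

theorem isomorphic_compact: "star_isomorphic A (compact_operator_algebra (ell2 X))"
  unfolding star_isomorphic_def
proof (intro exI conjI)
  show "star_hom A (compact_operator_algebra (ell2 X)) \<pi>"
    using hom \<pi>_compact by (auto simp: star_hom_def compact_operator_algebra_def)
  have "inj_on \<pi> (carrier A)"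
  proof (rule inj_onI)
    fix b c assume bc: "b \<in> carrier A" "c \<in> carrier A" "\<pi> b = \<pi> c"
    then have "alg_norm A (b \<ominus> c) = 0"
      using isometric[of "b \<ominus> c"] \<pi>_minus[of b c] ell2.B.minus_self[of "\<pi> c" X] ell2.B.N_zero[of X] \<pi>_in by simp
    then show "b = c" using bc N_eq_0_iff[of "b \<ominus> c"] by simp
  qed
  then show "bij_betw \<pi> (carrier A) (carrier (compact_operator_algebra (ell2 X)))"
    using \<pi>_compact compact_in_range by (force simp: bij_betw_def compact_operator_algebra_def)
qed

end


section \<open>Orthogonal projections and invariant subspaces\<close>

context hilbert_space
begin

lemma projection_unique:
  assumes M: "submodule M complex_ring H" and x: "x \<in> carrier H"
    and m: "m \<in> M" "\<And>z. z \<in> M \<Longrightarrow> ip H (x \<ominus> m) z = 0"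
    and n: "n \<in> M" "\<And>z. z \<in> M \<Longrightarrow> ip H (x \<ominus> n) z = 0"
  shows "m = n"
proof -
  note Mm = submoduleE[OF M]
  have c: "m \<in> carrier H" "n \<in> carrier H" using Mm(1) m n by auto
  have d: "m \<ominus> n \<in> M" using m n Mm by (auto simp: M.minus_eq)
  have "ip H (m \<ominus> n) (m \<ominus> n) = ip H (x \<ominus> n) (m \<ominus> n) - ip H (x \<ominus> m) (m \<ominus> n)"
    using c x by (simp add: ip_minus_left)
  then have "ip H (m \<ominus> n) (m \<ominus> n) = 0" using m(2)[OF d] n(2)[OF d] by simp
  then have "m \<ominus> n = \<zero>" using ip_pos[of "m \<ominus> n"] c by (cases "m \<ominus> n = \<zero>") auto
  then show ?thesis using c by simp
qed

definition proj :: "'h set \<Rightarrow> 'h \<Rightarrow> 'h" where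
  "proj M x = (SOME m. m \<in> M \<and> (\<forall>z\<in>M. ip H (x \<ominus> m) z = 0))"

context
  fixes M assumes M: "submodule M complex_ring H" and cl: "closedin (norm_topology H (hnorm H)) M"
begin

lemma proj:
  assumes "x \<in> carrier H"
  shows "proj M x \<in> M" "z \<in> M \<Longrightarrow> ip H (x \<ominus> proj M x) z = 0"
proof -
  have "\<exists>m. m \<in> M \<and> (\<forall>z\<in>M. ip H (x \<ominus> m) z = 0)"
    using orthogonal_projection[OF M cl assms] by metis
  from someI_ex[OF this] show "proj M x \<in> M" "z \<in> M \<Longrightarrow> ip H (x \<ominus> proj M x) z = 0"
    by (auto simp: proj_def)
qed

lemma proj_carrier: "x \<in> carrier H \<Longrightarrow> proj M x \<in> carrier H"
  using proj(1) submoduleE(1)[OF M] by auto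

lemma proj_eqI:
  assumes "x \<in> carrier H" "m \<in> M" "\<And>z. z \<in> M \<Longrightarrow> ip H (x \<ominus> m) z = 0"
  shows "proj M x = m"
  using projection_unique[OF M assms(1) proj(1)[OF assms(1)] proj(2)[OF assms(1)] assms(2,3)] .

lemma proj_smult: "x \<in> carrier H \<Longrightarrow> proj M (c \<odot> x) = c \<odot> proj M x"
  using proj[of x] proj_carrier[of x] submoduleE(1,4)[OF M]
  by (intro proj_eqI) (auto simp: smult_minus[symmetric] ip_smult_left subset_iff)

text \<open>As \<open>M\<close> is invariant under the adjoint of \<open>R\<close>, its orthogonal
  complement is invariant under \<open>R\<close>. This makes the projection an intertwiner in
  \<open>irreducible\<close>.\<close>

lemma proj_commute:
  assumes x: "x \<in> carrier H" and R: "R \<in> \<B>" and RM: "\<And>z. z \<in> M \<Longrightarrow> R z \<in> M"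
    and RM': "\<And>z. z \<in> M \<Longrightarrow> adj R z \<in> M"
  shows "proj M (R x) = R (proj M x)"
proof (rule proj_eqI)
  show "R x \<in> carrier H" using R x by simp
  show "R (proj M x) \<in> M" using RM proj(1)[OF x] .
  fix z assume z: "z \<in> M"
  then have zc: "z \<in> carrier H" using submoduleE(1)[OF M] by auto
  have "ip H (R x \<ominus> R (proj M x)) z = ip H (x \<ominus> proj M x) (adj R z)"
    using R x zc proj_carrier[OF x] by (simp add: bop_minus[symmetric] ip_adj)
  then show "ip H (R x \<ominus> R (proj M x)) z = 0" using proj(2)[OF x RM'[OF z]] by simp
qed

end

end

lemma closed_submodule_ell2_eq_carrier:
  assumes M: "submodule M complex_ring (ell2 X)" and cl: "closedin (norm_topology (ell2 X) (hnorm (ell2 X))) M"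
    and d: "\<And>x. x \<in> X \<Longrightarrow> delta x \<in> M"
  shows "M = carrier (ell2 X)"
proof
  note Mm = ell2.submoduleE[OF M]
  show "M \<subseteq> carrier (ell2 X)" by (rule Mm(1))
  show "carrier (ell2 X) \<subseteq> M"
  proof
    fix f assume f: "f \<in> carrier (ell2 X)"
    have fin: "(\<lambda>z. if z \<in> F then f z else 0) \<in> M" if "finite F" "F \<subseteq> X" for F
      using that
    proof (induction F)
      case empty
      obtain g where "g \<in> M" using Mm(2) by blast
      from Mm(4)[OF _ this, of 0] show ?case by simp
    next
      case (insert x F)
      have "(\<lambda>z. if z \<in> insert x F then f z else 0) = f x \<odot>\<^bsub>ell2 X\<^esub> delta x \<oplus>\<^bsub>ell2 X\<^esub> (\<lambda>z. if z \<in> F then f z else 0)"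
        using insert by (auto simp: delta_apply)
      then show ?case using insert d by (simp only: insert_subset) (intro Mm(5) Mm(4), auto)
    qed
    have "\<exists>g\<in>M. hnorm (ell2 X) (f \<ominus>\<^bsub>ell2 X\<^esub> g) < \<epsilon>" if e: "\<epsilon> > 0" for \<epsilon>
    proof -
      obtain F where F: "finite F" "F \<subseteq> X" "hnorm (ell2 X) (\<lambda>z. if z \<in> F then 0 else f z) < \<epsilon>"
        using ell2_tail_small[OF f e] by blast
      have "f \<ominus>\<^bsub>ell2 X\<^esub> (\<lambda>z. if z \<in> F then f z else 0) = (\<lambda>z. if z \<in> F then 0 else f z)"
        unfolding ell2_minus[OF f ell2_restrict(1)[OF f]] by auto
      then show ?thesis using F(3) fin[OF F(1,2)] by (intro bexI[of _ "\<lambda>z. if z \<in> F then f z else 0"]) simp_all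
    qed
    then show "f \<in> M" using cl f unfolding ell2.closedin_iff by blast
  qed
qed

section \<open>Representations on boundary path orbits\<close>

fun src :: "('v, 'e) pre_digraph \<Rightarrow> ('v + 'e) list \<Rightarrow> 'v" where
  "src E (Inl v # x) = v"
| "src E (Inr e # x) = tail E e"
| "src E [] = undefined"

text \<open>A partial function \<open>nx\<close> that picks an edge at each vertex, and may be undefined only at singular
  vertices, traces out a boundary path from \<open>v0\<close>; its vertices form the set \<open>W\<close>. The boundary paths that
  eventually follow it are encoded as lists: \<open>[Inr e\<^sub>1, \<dots>, Inr e\<^sub>n, Inl v]\<close> is the path that runs through
  \<open>e\<^sub>1, \<dots>, e\<^sub>n\<close> and then follows \<open>nx\<close> from \<open>v\<close> on, where \<open>e\<^sub>n\<close> is not already an edge chosen by \<open>nx\<close>.\<close>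

locale spine = wf_digraph E for E :: "('v, 'e) pre_digraph" +
  fixes nx :: "'v \<Rightarrow> 'e option" and v0 :: 'v and \<theta> :: "'e \<Rightarrow> complex"
  assumes v0: "v0 \<in> verts E"
    and nx_Some: "nx v = Some e \<Longrightarrow> e \<in> arcs E \<and> tail E e = v"
    and nx_None: "\<lbrakk>v \<in> verts E; nx v = None\<rbrakk> \<Longrightarrow> \<not> regular_vertex E v"
    and \<theta>: "cmod (\<theta> e) = 1"
begin

inductive_set W where
  start: "v0 \<in> W"
| follow: "\<lbrakk>v \<in> W; nx v = Some e\<rbrakk> \<Longrightarrow> head E e \<in> W"

lemma W_verts: "v \<in> W \<Longrightarrow> v \<in> verts E"
  by (induction rule: W.induct) (auto simp: v0 dest: nx_Some)

text \<open>Prepending an edge in normal form: if \<open>e\<close> is the edge chosen at a vertex of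
  \<open>W\<close> and \<open>x\<close> is the spine from its head, the longer path is the spine
  from an earlier vertex and is coded as such, so that no path gets two codes.\<close>

definition ext :: "'e \<Rightarrow> ('v + 'e) list \<Rightarrow> ('v + 'e) list" where
  "ext e x = (if x = [Inl (head E e)] \<and> tail E e \<in> W \<and> nx (tail E e) = Some e then [Inl (tail E e)] else Inr e # x)"

text \<open>The condition on \<open>ext\<close> admits an edge in the list only if the spine does
  not absorb it.\<close>

inductive_set X where
  base: "v \<in> W \<Longrightarrow> [Inl v] \<in> X"
| step: "\<lbrakk>x \<in> X; e \<in> arcs E; src E x = head E e; ext e x = Inr e # x\<rbrakk> \<Longrightarrow> Inr e # x \<in> X"

fun edge :: "('v + 'e) list \<Rightarrow> 'e option" where
  "edge (Inl v # x) = nx v"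
| "edge (Inr e # x) = Some e"
| "edge [] = None"

text \<open>The shift on coded paths. It is meant for paths with a first edge; on a path that stops,
  \<open>the (nx v)\<close> is arbitrary.\<close>

fun next_state :: "('v + 'e) list \<Rightarrow> ('v + 'e) list" where
  "next_state (Inl v # x) = [Inl (head E (the (nx v)))]"
| "next_state (Inr e # x) = x"
| "next_state [] = []"

lemma Inl_in_X [simp]: "[Inl v] \<in> X \<longleftrightarrow> v \<in> W"
  by (auto intro: X.base elim: X.cases)

lemma Inr_in_X: "Inr e # x \<in> X \<Longrightarrow> x \<in> X \<and> e \<in> arcs E \<and> src E x = head E e \<and> ext e x = Inr e # x"
  by (erule X.cases) auto

lemma src_verts: "x \<in> X \<Longrightarrow> src E x \<in> verts E"
  by (induction rule: X.induct) (auto simp: W_verts)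

text \<open>With \<open>ext_X\<close>: splitting off the first edge and prepending it are mutually
  inverse, which makes \<open>T e\<close> and \<open>Ts e\<close> adjoint partial
  isometries.\<close>

lemma edge_Some:
  assumes "y \<in> X" "edge y = Some e"
  shows "e \<in> arcs E" "tail E e = src E y" "next_state y \<in> X" "src E (next_state y) = head E e"
    "ext e (next_state y) = y"
proof -
  have "e \<in> arcs E \<and> tail E e = src E y \<and> next_state y \<in> X \<and> src E (next_state y) = head E e \<and>
    ext e (next_state y) = y"
    using assms
  proof (cases rule: X.cases)
    case (base v)
    then show ?thesis using assms nx_Some[of v e] W.follow[of v e] by (auto simp: ext_def)
  next
    case (step x f)
    then show ?thesis using assms by auto
  qed
  then show "e \<in> arcs E" "tail E e = src E y" "next_state y \<in> X" "src E (next_state y) = head E e"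
    "ext e (next_state y) = y" by auto
qed

lemma ext_X:
  assumes "x \<in> X" "e \<in> arcs E" "src E x = head E e"
  shows "ext e x \<in> X" "edge (ext e x) = Some e" "next_state (ext e x) = x" "src E (ext e x) = tail E e"
proof -
  have "ext e x = [Inl (tail E e)] \<and> x = [Inl (head E e)] \<and> tail E e \<in> W \<and> nx (tail E e) = Some e \<or> ext e x = Inr e # x"
    by (auto simp: ext_def)
  then show "ext e x \<in> X" "edge (ext e x) = Some e" "next_state (ext e x) = x" "src E (ext e x) = tail E e"
    using assms X.step[of x e] by auto
qed

lemma edge_None:
  assumes "x \<in> X" "edge x = None"
  shows "\<exists>v\<in>W. x = [Inl v] \<and> nx v = None"
  using assms by (cases rule: X.cases) auto

text \<open>\<open>Y e\<close> holds the paths that begin with \<open>e\<close>, and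
  \<open>Z e\<close> those that \<open>e\<close> can prolong. Operators act on functions by pulling
  back, so \<open>T e\<close>, built from the shift, sends the basis vector of a path
  \<open>x\<close> in \<open>Z e\<close> to that of \<open>ext e x\<close>, times the phase.\<close>

definition Y where "Y e = {y \<in> X. edge y = Some e}"
definition Z where "Z e = {x \<in> X. src E x = head E e}"
definition T where "T e = wpb X (Y e) next_state (\<theta> e)"
definition Ts where "Ts e = wpb X (Z e) (ext e) (cnj (\<theta> e))"
definition D where "D S = wpb X (X \<inter> S) (\<lambda>x. x) 1"
definition P where "P v = D {x. src E x = v}"

lemma \<theta>_cnj [simp]: "\<theta> e * cnj (\<theta> e) = 1" "cnj (\<theta> e) * \<theta> e = 1"
  using \<theta>[of e] by (simp_all add: complex_norm_square[symmetric] mult.commute del: complex_mult_cnj)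

lemma \<theta>_cnj' [simp]: "\<theta> e * (cnj (\<theta> e) * c) = c" "cnj (\<theta> e) * (\<theta> e * c) = c"
  by (simp_all add: mult.assoc[symmetric])

lemma \<theta>_nonzero [simp]: "\<theta> e \<noteq> 0"
  using \<theta>[of e] by auto

lemma bij_next: "e \<in> arcs E \<Longrightarrow> bij_betw next_state (Y e) (Z e)"
  by (rule bij_betw_byWitness[of _ "ext e"]) (auto simp: Y_def Z_def edge_Some ext_X)

lemma D_bop [simp]: "D S \<in> bounded_operators (ell2 X) (ell2 X)"
  unfolding D_def by (rule wpb_bounded) auto

lemma adj_D [simp]: "adjoint_operator (ell2 X) (ell2 X) (D S) = D S"
  using adjoint_wpb[of "\<lambda>x. x" "X \<inter> S" "X \<inter> S" X "\<lambda>x. x" 1] by (simp add: D_def bij_betw_def)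

lemma T_bop: "e \<in> arcs E \<Longrightarrow> T e \<in> bounded_operators (ell2 X) (ell2 X)"
  unfolding T_def using bij_next[of e] by (intro wpb_bounded) (auto simp: bij_betw_def Y_def)

lemma adj_T: "e \<in> arcs E \<Longrightarrow> adjoint_operator (ell2 X) (ell2 X) (T e) = Ts e"
  unfolding T_def Ts_def by (rule adjoint_wpb[OF bij_next]) (auto simp: Y_def Z_def edge_Some)

lemma Ts_bop: "e \<in> arcs E \<Longrightarrow> Ts e \<in> bounded_operators (ell2 X) (ell2 X)"
  using ell2.adj_bop[OF T_bop] by (simp add: adj_T)

lemma T_apply [simp]: "f \<in> carrier (ell2 X) \<Longrightarrow> T e f = (\<lambda>x. if x \<in> Y e then \<theta> e * f (next_state x) else 0)"
  and Ts_apply [simp]: "f \<in> carrier (ell2 X) \<Longrightarrow> Ts e f = (\<lambda>x. if x \<in> Z e then cnj (\<theta> e) * f (ext e x) else 0)"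
  and D_apply [simp]: "f \<in> carrier (ell2 X) \<Longrightarrow> D S f = (\<lambda>x. if x \<in> X \<inter> S then f x else 0)"
  by (simp_all add: T_def Ts_def D_def cong: if_cong)

lemma T_in: "\<lbrakk>e \<in> arcs E; f \<in> carrier (ell2 X)\<rbrakk> \<Longrightarrow> T e f \<in> carrier (ell2 X)"
  using T_bop by (rule ell2.bop_in)

lemma Ts_in: "\<lbrakk>e \<in> arcs E; f \<in> carrier (ell2 X)\<rbrakk> \<Longrightarrow> Ts e f \<in> carrier (ell2 X)"
  using Ts_bop by (rule ell2.bop_in)

lemma D_in: "f \<in> carrier (ell2 X) \<Longrightarrow> D S f \<in> carrier (ell2 X)"
  using D_bop by (rule ell2.bop_in)

abbreviation BX where "BX \<equiv> bounded_operator_algebra (ell2 X)"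

lemma BX_eqI:
  assumes "R \<in> bounded_operators (ell2 X) (ell2 X)" "S \<in> bounded_operators (ell2 X) (ell2 X)"
    and "\<And>f x. f \<in> carrier (ell2 X) \<Longrightarrow> R f x = S f x"
  shows "R = S"
  using assms by (intro ell2.bop_ext[of R X S]) auto

lemma D_mult: "D S \<otimes>\<^bsub>BX\<^esub> D S' = D (S \<inter> S')"
proof (rule BX_eqI)
  show "D S \<otimes>\<^bsub>BX\<^esub> D S' \<in> bounded_operators (ell2 X) (ell2 X)"
    using ell2.comp_bop[OF D_bop D_bop] by simp
  fix f x assume f: "f \<in> carrier (ell2 X)"
  have "D S (D S' f) x = D (S \<inter> S') f x"
    unfolding D_apply[OF D_in[OF f]] using f by simp
  then show "(D S \<otimes>\<^bsub>BX\<^esub> D S') f x = D (S \<inter> S') f x" using f by (simp del: D_apply)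
qed simp

lemma D_add: "S \<inter> S' = {} \<Longrightarrow> D S \<oplus>\<^bsub>BX\<^esub> D S' = D (S \<union> S')"
  by (rule BX_eqI) (use ell2.add_bop[OF D_bop D_bop] in auto)

lemma D_minus: "S' \<subseteq> S \<Longrightarrow> D S \<ominus>\<^bsub>BX\<^esub> D S' = D (S - S')"
proof (rule BX_eqI)
  show "D S \<ominus>\<^bsub>BX\<^esub> D S' \<in> bounded_operators (ell2 X) (ell2 X)"
    using ell2.B.minus_in[of "D S" X "D S'"] by simp
  fix f x assume S: "S' \<subseteq> S" and f: "f \<in> carrier (ell2 X)"
  show "(D S \<ominus>\<^bsub>BX\<^esub> D S') f x = D (S - S') f x"
    unfolding ell2.bop_minus_apply[OF D_bop D_bop f] ell2_minus[OF D_in[OF f] D_in[OF f]]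
    using S f by auto
qed simp

lemma D_empty: "D {} = \<zero>\<^bsub>BX\<^esub>"
  by (rule BX_eqI) (use ell2.zero_bop in auto)

lemma T_Ts: "e \<in> arcs E \<Longrightarrow> T e \<otimes>\<^bsub>BX\<^esub> Ts e = D (Y e)"
proof (rule BX_eqI)
  assume e: "e \<in> arcs E"
  show "T e \<otimes>\<^bsub>BX\<^esub> Ts e \<in> bounded_operators (ell2 X) (ell2 X)"
    using ell2.comp_bop[OF T_bop[OF e] Ts_bop[OF e]] by simp
  fix f x assume f: "f \<in> carrier (ell2 X)"
  have "T e (Ts e f) x = D (Y e) f x"
    unfolding T_apply[OF Ts_in[OF e f]] using f by (auto simp: Y_def Z_def edge_Some)
  then show "(T e \<otimes>\<^bsub>BX\<^esub> Ts e) f x = D (Y e) f x" using f by (simp del: T_apply Ts_apply D_apply)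
qed simp

lemma Ts_T: "e \<in> arcs E \<Longrightarrow> Ts e \<otimes>\<^bsub>BX\<^esub> T e = P (head E e)"
proof (rule BX_eqI)
  assume e: "e \<in> arcs E"
  show "Ts e \<otimes>\<^bsub>BX\<^esub> T e \<in> bounded_operators (ell2 X) (ell2 X)"
    using ell2.comp_bop[OF Ts_bop[OF e] T_bop[OF e]] by simp
  fix f x assume f: "f \<in> carrier (ell2 X)"
  have "Ts e (T e f) x = P (head E e) f x"
    unfolding Ts_apply[OF T_in[OF e f]] P_def using f e by (auto simp: Y_def Z_def ext_X)
  then show "(Ts e \<otimes>\<^bsub>BX\<^esub> T e) f x = P (head E e) f x" using f by (simp del: T_apply Ts_apply)
qed (simp add: P_def)

lemma finsum_D:
  assumes "finite F" "\<And>e f. \<lbrakk>e \<in> F; f \<in> F; e \<noteq> f\<rbrakk> \<Longrightarrow> S e \<inter> S f = {}"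
  shows "(\<Oplus>\<^bsub>BX\<^esub>e\<in>F. D (S e)) = D (\<Union>e\<in>F. S e)"
  using assms
proof (induction F)
  case empty
  show ?case using D_empty by (simp add: ell2.B.M.finsum_empty del: bounded_operator_algebra_simps)
next
  case (insert e F)
  have "(\<Oplus>\<^bsub>BX\<^esub>e\<in>insert e F. D (S e)) = D (S e) \<oplus>\<^bsub>BX\<^esub> (\<Oplus>\<^bsub>BX\<^esub>e\<in>F. D (S e))"
    by (rule ell2.B.M.finsum_insert) (use insert in auto)
  also have "(\<Oplus>\<^bsub>BX\<^esub>e\<in>F. D (S e)) = D (\<Union>e\<in>F. S e)" using insert by blast
  also have "D (S e) \<oplus>\<^bsub>BX\<^esub> D (\<Union>e\<in>F. S e) = D (S e \<union> (\<Union>e\<in>F. S e))"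
    by (rule D_add) (use insert in blast)
  finally show ?case by simp
qed

text \<open>This is behind (CK3): \<open>nx\<close> is undefined only at singular vertices, so a
  path from a regular vertex cannot stop there and begins with one of its edges.\<close>

lemma X_Int_src: "regular_vertex E v \<Longrightarrow> X \<inter> {x. src E x = v} = X \<inter> (\<Union>e\<in>out_arcs E v. Y e)"
proof (intro equalityI subsetI)
  fix x assume r: "regular_vertex E v" and x: "x \<in> X \<inter> {x. src E x = v}"
  then obtain e where "edge x = Some e"
    using edge_None[of x] nx_None W_verts by (cases "edge x") auto
  then show "x \<in> X \<inter> (\<Union>e\<in>out_arcs E v. Y e)" using x edge_Some[of x e] by (auto simp: Y_def)
qed (auto simp: Y_def edge_Some)

text \<open>All relations reduce to identities between sets of paths: \<open>T e\<close> times
  \<open>Ts e\<close> is the diagonal projection on \<open>Y e\<close>, and the reverse product is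
  the one on \<open>Z e\<close>.\<close>

theorem cuntz_krieger: "cuntz_krieger_family E BX T P"
  unfolding cuntz_krieger_family_def
proof (intro conjI ballI allI impI)
  fix v assume "v \<in> verts E"
  show "projection BX (P v)"
    unfolding projection_def P_def using D_mult[of "{x. src E x = v}" "{x. src E x = v}"] by simp
next
  fix v w :: 'v assume "v \<noteq> w"
  then have "{x. src E x = v} \<inter> {x. src E x = w} = {}" by auto
  then show "P v \<otimes>\<^bsub>BX\<^esub> P w = \<zero>\<^bsub>BX\<^esub>" unfolding P_def D_mult D_empty[symmetric] by simp
next
  fix e assume e: "e \<in> arcs E"
  have Y: "Y e \<subseteq> {x. src E x = tail E e}" by (auto simp: Y_def edge_Some)
  have star_T: "star BX (T e) = Ts e" by (simp add: adj_T e)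
  show "star BX (T e) \<otimes>\<^bsub>BX\<^esub> T e = P (head E e)" unfolding star_T by (rule Ts_T[OF e])
  show "partial_isometry BX (T e)"
    unfolding partial_isometry_def star_T T_Ts[OF e]
  proof
    show "T e \<in> carrier BX" using T_bop[OF e] by simp
    show "D (Y e) \<otimes>\<^bsub>BX\<^esub> T e = T e"
    proof (rule BX_eqI)
      show "D (Y e) \<otimes>\<^bsub>BX\<^esub> T e \<in> bounded_operators (ell2 X) (ell2 X)"
        using ell2.comp_bop[OF D_bop T_bop[OF e]] by simp
      fix f x assume f: "f \<in> carrier (ell2 X)"
      have "D (Y e) (T e f) x = T e f x"
        unfolding D_apply[OF T_in[OF e f]] using f by (auto simp: Y_def)
      then show "(D (Y e) \<otimes>\<^bsub>BX\<^esub> T e) f x = T e f x" using f by (simp del: T_apply D_apply)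
    qed (rule T_bop[OF e])
  qed
  show "cstar_le BX (T e \<otimes>\<^bsub>BX\<^esub> star BX (T e)) (P (tail E e))"
    unfolding cstar_le_def star_T T_Ts[OF e] P_def
  \<comment> \<open>A difference of nested diagonal projections is a projection, hence its adjoint
    times itself.\<close>
  proof (intro conjI bexI[of _ "D ({x. src E x = tail E e} - Y e)"])
    show "D {x. src E x = tail E e} \<ominus>\<^bsub>BX\<^esub> D (Y e)
        = star BX (D ({x. src E x = tail E e} - Y e)) \<otimes>\<^bsub>BX\<^esub> D ({x. src E x = tail E e} - Y e)"
      using D_minus[OF Y] D_mult[of "{x. src E x = tail E e} - Y e" "{x. src E x = tail E e} - Y e"]
      by (simp del: bounded_operator_algebra_simps add: bounded_operator_algebra_simps(6))
  qed simp_all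
next
  fix e f assume ef: "e \<in> arcs E" "f \<in> arcs E" "e \<noteq> f"
  have "star BX (T e) = Ts e" "star BX (T f) = Ts f" by (simp_all add: adj_T ef)
  moreover have "Y e \<inter> Y f = {}" using ef by (auto simp: Y_def)
  ultimately show "(T e \<otimes>\<^bsub>BX\<^esub> star BX (T e)) \<otimes>\<^bsub>BX\<^esub> (T f \<otimes>\<^bsub>BX\<^esub> star BX (T f)) = \<zero>\<^bsub>BX\<^esub>"
    unfolding T_Ts[OF ef(1)] T_Ts[OF ef(2)] D_empty[symmetric]
    by (simp only: T_Ts[OF ef(1)] T_Ts[OF ef(2)] D_mult)
next
  fix v assume r: "regular_vertex E v"
  then have fin: "finite (out_arcs E v)" by (simp add: regular_vertex_def)
  have "(\<Oplus>\<^bsub>BX\<^esub>e\<in>out_arcs E v. T e \<otimes>\<^bsub>BX\<^esub> star BX (T e)) = (\<Oplus>\<^bsub>BX\<^esub>e\<in>out_arcs E v. D (Y e))"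
  proof (rule ell2.B.M.finsum_cong')
    fix e assume "e \<in> out_arcs E v"
    then have "e \<in> arcs E" by auto
    then show "T e \<otimes>\<^bsub>BX\<^esub> star BX (T e) = D (Y e)"
      using T_Ts[of e] adj_T[of e] by (simp only: bounded_operator_algebra_simps(6))
  qed auto
  also have "\<dots> = D (\<Union>e\<in>out_arcs E v. Y e)"
    by (rule finsum_D[OF fin]) (auto simp: Y_def)
  also have "\<dots> = P v"
    unfolding P_def D_def X_Int_src[OF r] ..
  finally show "P v = (\<Oplus>\<^bsub>BX\<^esub>e\<in>out_arcs E v. T e \<otimes>\<^bsub>BX\<^esub> star BX (T e))" ..
qed

end


section \<open>Basis vectors and intertwining maps\<close>

context spine
begin

lemma P_delta: "x \<in> X \<Longrightarrow> P v (delta x) = (if src E x = v then delta x else (\<lambda>y. 0))"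
  unfolding P_def D_apply[OF delta_in] by (auto simp: delta_apply)

lemma Ts_delta:
  assumes "x \<in> X" "e \<in> arcs E"
  shows "Ts e (delta x) = (if edge x = Some e then (\<lambda>y. cnj (\<theta> e) * delta (next_state x) y) else (\<lambda>y. 0))"
proof -
  have "y \<in> Z e \<and> ext e y = x \<longleftrightarrow> edge x = Some e \<and> y = next_state x" for y
    using edge_Some[OF assms(1)] ext_X[of y e] assms(2) by (auto simp: Z_def)
  then have "(if y \<in> Z e then cnj (\<theta> e) * delta x (ext e y) else 0) =
      (if edge x = Some e then cnj (\<theta> e) * delta (next_state x) y else 0)" for y
    by (auto simp: delta_apply)
  then show ?thesis
    unfolding Ts_apply[OF delta_in[OF assms(1)]] by simp
qed

lemma T_delta:
  assumes "x \<in> X" "e \<in> arcs E" "src E x = head E e"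
  shows "T e (delta x) = (\<lambda>y. \<theta> e * delta (ext e x) y)"
proof -
  have "y \<in> Y e \<and> next_state y = x \<longleftrightarrow> y = ext e x" for y
    using edge_Some[of y e] ext_X[OF assms] by (auto simp: Y_def)
  then have "(if y \<in> Y e then \<theta> e * delta x (next_state y) else 0) = \<theta> e * delta (ext e x) y" for y
    by (auto simp: delta_apply)
  then show ?thesis
    unfolding T_apply[OF delta_in[OF assms(1)]] by simp
qed

lemma T_Ts_apply: "\<lbrakk>e \<in> arcs E; f \<in> carrier (ell2 X)\<rbrakk> \<Longrightarrow> T e (Ts e f) = (\<lambda>x. if x \<in> Y e then f x else 0)"
  unfolding T_apply[OF Ts_in] by (auto simp: Y_def Z_def edge_Some fun_eq_iff)

text \<open>The codes are lists over \<open>'v + 'e\<close>, so \<open>BX\<close> has the type for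
  which the universal property of \<open>A\<close> is stated.\<close>

lemma representation_exists:
  assumes "graph_cstar_algebra E (A :: 'a cstar) s p"
  shows "\<exists>\<pi>. star_hom A BX \<pi> \<and> (\<forall>e\<in>arcs E. \<pi> (s e) = T e) \<and> (\<forall>v\<in>verts E. \<pi> (p v) = P v)"
  using assms cuntz_krieger ell2.cstar_bounded_operator_algebra[of X] unfolding graph_cstar_algebra_def by blast

end

text \<open>Used twice: for a unitary equivalence between the representations of two spines, and for
  the projection onto an invariant subspace of one of them.\<close>

locale spine_intertwiner = S1: spine E nx v0 \<theta> + S2: spine E nx' v0' \<theta>'
  for E :: "('v, 'e) pre_digraph" and nx v0 \<theta> nx' v0' \<theta>' +
  fixes U :: "(('v + 'e) list \<Rightarrow> complex) \<Rightarrow> ('v + 'e) list \<Rightarrow> complex"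
  assumes U_in: "f \<in> carrier (ell2 S1.X) \<Longrightarrow> U f \<in> carrier (ell2 S2.X)"
    and U_smult: "f \<in> carrier (ell2 S1.X) \<Longrightarrow> U (\<lambda>x. c * f x) = (\<lambda>x. c * U f x)"
    and U_T: "\<lbrakk>e \<in> arcs E; f \<in> carrier (ell2 S1.X)\<rbrakk> \<Longrightarrow> U (S1.T e f) = S2.T e (U f)"
    and U_Ts: "\<lbrakk>e \<in> arcs E; f \<in> carrier (ell2 S1.X)\<rbrakk> \<Longrightarrow> U (S1.Ts e f) = S2.Ts e (U f)"
    and U_P: "\<lbrakk>v \<in> verts E; f \<in> carrier (ell2 S1.X)\<rbrakk> \<Longrightarrow> U (S1.P v f) = S2.P v (U f)"
begin

lemma U_zero: "U (\<lambda>x. 0) = (\<lambda>x. 0)"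
  using U_smult[OF ell2_zero_closed, of 0] by simp

context
  fixes u assumes u: "u \<in> S1.W"
begin

lemma du [simp]: "delta [Inl u] \<in> carrier (ell2 S1.X)"
  using u by simp

lemma support_src:
  assumes "U (delta [Inl u]) x \<noteq> 0"
  shows "x \<in> S2.X" "src E x = u"
proof -
  show "x \<in> S2.X" using ell2_outside[OF U_in[OF du]] assms by blast
  have "U (delta [Inl u]) = S2.P u (U (delta [Inl u]))"
    using U_P[OF S1.W_verts[OF u] du] S1.P_delta[of "[Inl u]" u] u by simp
  then have "U (delta [Inl u]) x = S2.P u (U (delta [Inl u])) x" by (rule fun_cong)
  then show "src E x = u" using assms unfolding S2.P_def S2.D_apply[OF U_in[OF du]] by (auto split: if_splits)
qed

lemma shift:
  assumes "nx u = Some e"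
  shows "cnj (\<theta> e) * U (delta [Inl (head E e)]) y = S2.Ts e (U (delta [Inl u])) y"
proof -
  have e: "e \<in> arcs E" using S1.nx_Some[OF assms] by simp
  have "[Inl (head E e)] \<in> S1.X" using S1.W.follow[OF u assms] by simp
  then have "(\<lambda>y. cnj (\<theta> e) * U (delta [Inl (head E e)]) y) = U (S1.Ts e (delta [Inl u]))"
    using S1.Ts_delta[of "[Inl u]" e] u e assms U_smult[OF delta_in[of "[Inl (head E e)]"]] by simp
  also have "\<dots> = S2.Ts e (U (delta [Inl u]))" by (rule U_Ts[OF e du])
  finally show ?thesis by (rule fun_cong)
qed

text \<open>The basis vector of the spine at \<open>u\<close> is fixed by \<open>Ts e\<close>
  followed by \<open>T e\<close> if \<open>nx\<close> picks \<open>e\<close> at \<open>u\<close>,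
  and killed by every \<open>Ts e\<close> if the spine stops there. Its image under \<open>U\<close>
  behaves in the same way.\<close>

lemma support_edge:
  assumes x: "U (delta [Inl u]) x \<noteq> 0"
  shows "S2.edge x = nx u"
proof (cases "nx u")
  case None
  show ?thesis
  proof (cases "S2.edge x")
    case (Some e)
    note ee = S2.edge_Some[OF support_src(1)[OF x] Some]
    have "S1.Ts e (delta [Inl u]) = (\<lambda>y. 0)"
      using S1.Ts_delta[of "[Inl u]" e] u ee(1) None by simp
    then have "S2.Ts e (U (delta [Inl u])) = (\<lambda>y. 0)"
      using U_Ts[OF ee(1) du] U_zero by simp
    then have "S2.Ts e (U (delta [Inl u])) (S2.next_state x) = 0" by simp
    then show ?thesis
      using x ee unfolding S2.Ts_apply[OF U_in[OF du]] by (simp add: S2.Z_def)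
  qed (use None in simp)
next
  case (Some e)
  have e: "e \<in> arcs E" using S1.nx_Some[OF Some] by simp
  have "delta [Inl u] = S1.T e (S1.Ts e (delta [Inl u]))"
    unfolding S1.T_Ts_apply[OF e du] using u Some by (auto simp: S1.Y_def delta_apply)
  then have "U (delta [Inl u]) = S2.T e (S2.Ts e (U (delta [Inl u])))"
    using U_T[OF e S1.Ts_in[OF e du]] U_Ts[OF e du] by simp
  also have "\<dots> = (\<lambda>x. if x \<in> S2.Y e then U (delta [Inl u]) x else 0)"
    by (rule S2.T_Ts_apply[OF e U_in[OF du]])
  finally have "U (delta [Inl u]) x = (if x \<in> S2.Y e then U (delta [Inl u]) x else 0)" by (rule fun_cong)
  then show ?thesis using x Some by (auto simp: S2.Y_def split: if_splits)
qed

lemma support_next: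
  assumes x: "U (delta [Inl u]) x \<noteq> 0" and e: "nx u = Some e"
  shows "U (delta [Inl (head E e)]) (S2.next_state x) \<noteq> 0"
    "cnj (\<theta> e) * U (delta [Inl (head E e)]) (S2.next_state x) = cnj (\<theta>' e) * U (delta [Inl u]) x"
proof -
  have edge: "S2.edge x = Some e" using support_edge[OF x] e by simp
  note ee = S2.edge_Some[OF support_src(1)[OF x] edge]
  show *: "cnj (\<theta> e) * U (delta [Inl (head E e)]) (S2.next_state x) = cnj (\<theta>' e) * U (delta [Inl u]) x"
    unfolding shift[OF e] S2.Ts_apply[OF U_in[OF du]] using ee by (simp add: S2.Z_def)
  then show "U (delta [Inl (head E e)]) (S2.next_state x) \<noteq> 0" using x by auto
qed

end

text \<open>Shifting moves \<open>u\<close> along the first spine and removes an entry from the list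
  \<open>x\<close>. When \<open>[Inl v]\<close> remains, \<open>support_src\<close> identifies
  \<open>v\<close> with the current vertex, which thus lies on both spines.\<close>

lemma merge:
  assumes "u \<in> S1.W" "U (delta [Inl u]) x \<noteq> 0"
  shows "\<exists>w. w \<in> S1.W \<and> w \<in> S2.W \<and> U (delta [Inl w]) [Inl w] \<noteq> 0"
  using assms
proof (induction x arbitrary: u rule: list.induct)
  case Nil
  then have "[] \<in> S2.X" by (rule support_src)
  then show ?case by (auto elim: S2.X.cases)
next
  case (Cons a x)
  note xX = support_src[OF Cons.prems]
  show ?case
  proof (cases a)
    case (Inl v)
    then have "x = []" "v \<in> S2.W" using xX(1) by (auto elim: S2.X.cases)
    then show ?thesis using Cons.prems xX(2) Inl by auto
  next
    case (Inr e)
    then have e: "nx u = Some e" using support_edge[OF Cons.prems] by simp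
    then show ?thesis
      using support_next(1)[OF Cons.prems e] S1.W.follow[OF Cons.prems(1) e] Cons.IH Inr by auto
  qed
qed

text \<open>A nonzero coefficient of \<open>[Inl w]\<close> in the image of
  \<open>delta [Inl w]\<close> makes both rules pick the same edge at \<open>w\<close>, and is
  handed on to the head of that edge.\<close>

lemma agree:
  assumes "w \<in> S1.W" "w \<in> S2.W" "U (delta [Inl w]) [Inl w] \<noteq> 0"
    and "(w, w') \<in> {(v, head E e) | v e. nx v = Some e}\<^sup>*"
  shows "nx' w' = nx w'"
proof -
  from assms(4) have "w' \<in> S1.W \<and> w' \<in> S2.W \<and> U (delta [Inl w']) [Inl w'] \<noteq> 0"
  proof induction
    case (step v w')
    then obtain e where e: "nx v = Some e" "w' = head E e" by blast
    have v: "v \<in> S1.W" "v \<in> S2.W" "U (delta [Inl v]) [Inl v] \<noteq> 0" using step by auto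
    have "nx' v = Some e" using support_edge[OF v(1,3)] e by simp
    then show ?case
      using support_next(1)[OF v(1,3) e(1)] S1.W.follow[OF v(1) e(1)] S2.W.follow[OF v(2), of e] e(2) by simp
  qed (use assms in simp)
  then show ?thesis using support_edge[of w' "[Inl w']"] by simp
qed

end

text \<open>One spine with two families of phases: equal ones for irreducibility, different ones to
  exclude cycles.\<close>

locale phase_intertwiner = spine_intertwiner E nx v0 \<theta> nx v0 \<theta>' U
  for E :: "('v, 'e) pre_digraph" and nx v0 \<theta> \<theta>' U
begin

text \<open>A path in the support follows \<open>nx\<close> from \<open>u\<close> at each step, and
  in normal form its only code is \<open>[Inl u]\<close>.\<close>

lemma support_delta:
  assumes "u \<in> S1.W" "U (delta [Inl u]) x \<noteq> 0"
  shows "x = [Inl u]"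
  using assms
proof (induction x arbitrary: u rule: list.induct)
  case Nil
  then have "[] \<in> S1.X" by (rule support_src)
  then show ?case by (auto elim: S1.X.cases)
next
  case (Cons a x)
  note xX = support_src[OF Cons.prems]
  show ?case
  proof (cases a)
    case (Inl v)
    then show ?thesis using xX by (auto elim: S1.X.cases)
  next
    case (Inr e)
    then have e: "nx u = Some e" using support_edge[OF Cons.prems] by simp
    then have "U (delta [Inl (head E e)]) x \<noteq> 0"
      using support_next(1)[OF Cons.prems e] Inr by simp
    then have "x = [Inl (head E e)]" using Cons.IH S1.W.follow[OF Cons.prems(1) e] by blast
    \<comment> \<open>The list \<open>Inr e # x\<close> is a code only if it equals
      \<open>ext e x\<close>, whereas here \<open>ext\<close> absorbs \<open>e\<close> into the
      spine.\<close>
    then have "S1.ext e x = [Inl u]" using e S1.nx_Some[OF e] Cons.prems(1) by (simp add: S1.ext_def)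
    then show ?thesis using S1.Inr_in_X[of e x] xX(1) Inr by simp
  qed
qed

lemma phase:
  assumes u: "u \<in> S1.W" and e: "nx u = Some e"
  shows "cnj (\<theta> e) * U (delta [Inl (head E e)]) [Inl (head E e)] = cnj (\<theta>' e) * U (delta [Inl u]) [Inl u]"
proof (cases "U (delta [Inl u]) [Inl u] = 0")
  case False
  then show ?thesis using support_next(2)[OF u False e] e by simp
next
  case True
  \<comment> \<open>\<open>support_next\<close> starts from a nonzero coefficient; for a zero one,
    \<open>shift\<close> is evaluated at the spine from the head of \<open>e\<close>.\<close>
  then show ?thesis
    unfolding shift[OF u e] S2.Ts_apply[OF U_in[OF du[OF u]]]
    using u e S1.nx_Some[OF e] by (simp add: S2.Z_def S2.ext_def)
qed

end

section \<open>Irreducibility\<close>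

context spine
begin

lemma nonzero_on_delta: "P v0 \<noteq> \<zero>\<^bsub>BX\<^esub>"
proof
  assume "P v0 = \<zero>\<^bsub>BX\<^esub>"
  then have "P v0 (delta [Inl v0]) [Inl v0] = \<zero>\<^bsub>BX\<^esub> (delta [Inl v0]) [Inl v0]" by simp
  then show False using P_delta[of "[Inl v0]" v0] W.start by simp
qed

text \<open>Schur's argument: the projection onto an invariant \<open>M\<close> intertwines the
  representation with itself, so it multiplies all vectors of the spine by one scalar. If the scalar
  is not 0, \<open>M\<close> contains every basis vector; if it is 0, \<open>M\<close> is orthogonal
  to all of them.\<close>

theorem irreducible:
  assumes A: "cstar_algebra A" and hom: "star_hom A BX \<pi>"
    and s: "\<And>e. e \<in> arcs E \<Longrightarrow> s e \<in> carrier A \<and> \<pi> (s e) = T e"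
    and p: "\<And>v. v \<in> verts E \<Longrightarrow> p v \<in> carrier A \<and> \<pi> (p v) = P v"
  shows "irreducible_representation A (ell2 X) \<pi>"
  unfolding irreducible_representation_def representation_def
proof (intro conjI allI impI hom ell2.hilbert_space_axioms)
  show "\<exists>a\<in>carrier A. \<pi> a \<noteq> \<zero>\<^bsub>BX\<^esub>"
    using p[OF v0] nonzero_on_delta by metis
  fix M assume "submodule M complex_ring (ell2 X) \<and> closedin (norm_topology (ell2 X) (hnorm (ell2 X))) M \<and>
      (\<forall>a\<in>carrier A. \<pi> a ` M \<subseteq> M)"
  then have M: "submodule M complex_ring (ell2 X)" and cl: "closedin (norm_topology (ell2 X) (hnorm (ell2 X))) M"
    and inv: "\<And>a f. \<lbrakk>a \<in> carrier A; f \<in> M\<rbrakk> \<Longrightarrow> \<pi> a f \<in> M" by auto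
  note Mm = ell2.submoduleE[OF M]
  have Mc: "f \<in> M \<Longrightarrow> f \<in> carrier (ell2 X)" for f using Mm(1) by auto
  have TM: "T e f \<in> M" if "e \<in> arcs E" "f \<in> M" for e f
    using inv[of "s e" f] s[OF that(1)] that(2) by (simp del: T_apply)
  have TsM: "Ts e f \<in> M" if "e \<in> arcs E" "f \<in> M" for e f
  proof -
    have "\<pi> (star A (s e)) = Ts e"
      using hom s[OF that(1)] adj_T[OF that(1)] by (auto simp: star_hom_def)
    then show ?thesis using inv[of "star A (s e)" f] cstar_algebra.star_closed[OF A] s[OF that(1)] that(2)
      by (simp del: Ts_apply)
  qed
  have PM: "P v f \<in> M" if "v \<in> verts E" "f \<in> M" for v f
    using inv[of "p v" f] p[OF that(1)] that(2) by simp
  let ?U = "ell2.proj X M"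
  interpret U: phase_intertwiner E nx v0 \<theta> \<theta> ?U
  proof
    fix f c e v assume f: "f \<in> carrier (ell2 X)"
    show "?U f \<in> carrier (ell2 X)" by (rule ell2.proj_carrier[OF M cl f])
    show "?U (\<lambda>x. c * f x) = (\<lambda>x. c * ?U f x)" using ell2.proj_smult[OF M cl f, of c] by simp
    show "?U (T e f) = T e (?U f)" if e: "e \<in> arcs E"
      by (rule ell2.proj_commute[OF M cl f T_bop[OF e]]) (use TM[OF e] TsM[OF e] in \<open>simp_all add: adj_T e del: T_apply Ts_apply\<close>)
    show "?U (Ts e f) = Ts e (?U f)" if e: "e \<in> arcs E"
      by (rule ell2.proj_commute[OF M cl f Ts_bop[OF e]])
        (use TM[OF e] TsM[OF e] ell2.adj_adj[OF T_bop[OF e]] in \<open>simp_all add: adj_T e del: T_apply Ts_apply\<close>)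
    show "?U (P v f) = P v (?U f)" if v: "v \<in> verts E"
      by (rule ell2.proj_commute[OF M cl f]) (use PM[OF v] in \<open>simp_all add: P_def del: D_apply\<close>)
  qed
  define c where "c u = ?U (delta [Inl u]) [Inl u]" for u
  have Uc: "?U (delta [Inl u]) = (\<lambda>x. c u * delta [Inl u] x)" if u: "u \<in> W" for u
    using U.support_delta[OF u] by (auto simp: c_def delta_apply fun_eq_iff)
  \<comment> \<open>With equal phases on both sides, \<open>phase\<close> introduces no factor along
    an edge.\<close>
  have cc: "c u = c v0" if "u \<in> W" for u
    using that
  proof induction
    case (follow v e)
    then show ?case using U.phase[OF follow.hyps] by (simp add: c_def)
  qed simp
  show "M = {\<zero>\<^bsub>ell2 X\<^esub>} \<or> M = carrier (ell2 X)"
  proof (cases "c v0 = 0")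
    case False
    have dW: "delta [Inl u] \<in> M" if u: "u \<in> W" for u
    proof -
      have "?U (delta [Inl u]) \<in> M" using ell2.proj(1)[OF M cl, of "delta [Inl u]"] u by simp
      then have "(\<lambda>x. c v0 * delta [Inl u] x) \<in> M" using Uc[OF u] cc[OF u] by simp
      from Mm(4)[OF _ this, of "inverse (c v0)"] show ?thesis
        using False by (simp add: mult.assoc[symmetric])
    qed
    \<comment> \<open>The other paths arise from the spine by prepending edges, which
      \<open>T e\<close> performs on basis vectors.\<close>
    have "delta x \<in> M" if "x \<in> X" for x
      using that
    proof induction
      case (step x e)
      have "T e (delta x) \<in> M" using TM step by blast
      then have "(\<lambda>y. \<theta> e * delta (Inr e # x) y) \<in> M"
        using T_delta[of x e] step by simp
      from Mm(4)[OF _ this, of "cnj (\<theta> e)"] show ?case by simp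
    qed (rule dW)
    then show ?thesis using closed_submodule_ell2_eq_carrier[OF M cl] by blast
  next
    case True
    have zW: "z [Inl u] = 0" if u: "u \<in> W" and z: "z \<in> M" for u z
    proof -
      have d: "delta [Inl u] \<in> carrier (ell2 X)" using u by simp
      have U0: "?U (delta [Inl u]) = \<zero>\<^bsub>ell2 X\<^esub>" using Uc[OF u] cc[OF u] True by simp
      have "ip (ell2 X) (delta [Inl u] \<ominus>\<^bsub>ell2 X\<^esub> ?U (delta [Inl u])) z = 0"
        by (rule ell2.proj(2)[OF M cl d z])
      then have "ip (ell2 X) (delta [Inl u]) z = 0"
        unfolding U0 ell2.minus_zero[OF d] .
      then show ?thesis using ell2.ip_cnj[OF d Mc[OF z]] by simp
    qed
    \<comment> \<open>Dually, the coordinate of \<open>z\<close> at \<open>Inr e # x\<close> is, up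
      to a phase, that of \<open>Ts e z\<close> at \<open>x\<close>, and \<open>Ts e z\<close> is
      again in \<open>M\<close>.\<close>
    have "z x = 0" if "x \<in> X" "z \<in> M" for x z
      using that
    proof (induction arbitrary: z)
      case (step x e)
      have "Ts e z x = 0" using step.IH TsM step by blast
      then show ?case using step Mc[OF step.prems] by (simp add: Z_def)
    qed (rule zW)
    then have "z = \<zero>\<^bsub>ell2 X\<^esub>" if "z \<in> M" for z
      using that ell2_outside[OF Mc[OF that]] by (auto simp: fun_eq_iff)
    then show ?thesis using Mm(2) by blast
  qed
qed

end

text \<open>Representations respect the star, so \<open>U\<close> intertwines \<open>Ts e\<close> as
  well. Injectivity is recorded because \<open>merge\<close> has to begin with a nonzero
  coefficient.\<close>

lemma unitarily_equivalent_intertwiner: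
  assumes A: "cstar_algebra A" and S1: "spine E nx v0 \<theta>" and S2: "spine E nx' v0' \<theta>'"
    and \<pi>: "star_hom A (bounded_operator_algebra (ell2 (spine.X E nx v0))) \<pi>"
      "\<And>e. e \<in> arcs E \<Longrightarrow> s e \<in> carrier A \<and> \<pi> (s e) = spine.T E nx v0 \<theta> e"
      "\<And>v. v \<in> verts E \<Longrightarrow> p v \<in> carrier A \<and> \<pi> (p v) = spine.P E nx v0 v"
    and \<rho>: "star_hom A (bounded_operator_algebra (ell2 (spine.X E nx' v0'))) \<rho>"
      "\<And>e. e \<in> arcs E \<Longrightarrow> \<rho> (s e) = spine.T E nx' v0' \<theta>' e"
      "\<And>v. v \<in> verts E \<Longrightarrow> \<rho> (p v) = spine.P E nx' v0' v"
    and eq: "unitarily_equivalent A (ell2 (spine.X E nx v0)) \<pi> (ell2 (spine.X E nx' v0')) \<rho>"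
  shows "\<exists>U. spine_intertwiner E nx v0 \<theta> nx' v0' \<theta>' U \<and>
    (\<forall>f\<in>carrier (ell2 (spine.X E nx v0)). U f = (\<lambda>x. 0) \<longrightarrow> f = (\<lambda>x. 0))"
proof -
  interpret S1: spine E nx v0 \<theta> by (rule S1)
  interpret S2: spine E nx' v0' \<theta>' by (rule S2)
  let ?H = "ell2 S1.X" and ?K = "ell2 S2.X"
  obtain U where U: "unitary_operator ?H ?K U"
    and eq: "\<forall>a\<in>carrier A. \<forall>f\<in>carrier ?H. \<pi> a f = adjoint_operator ?H ?K U (\<rho> a (U f))"
    using eq unfolding unitarily_equivalent_def by blast
  have UB: "U \<in> bounded_operators ?H ?K" and U1: "\<And>f. f \<in> carrier ?H \<Longrightarrow> adjoint_operator ?H ?K U (U f) = f"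
    and U2: "\<And>f. f \<in> carrier ?K \<Longrightarrow> U (adjoint_operator ?H ?K U f) = f"
    using U unfolding unitary_operator_def by auto
  have U_in: "U f \<in> carrier ?K" if "f \<in> carrier ?H" for f using UB that by (auto simp: bounded_operators_def)
  have U_smult: "U (\<lambda>x. c * f x) = (\<lambda>x. c * U f x)" if "f \<in> carrier ?H" for c f
    using UB that unfolding bounded_operators_def by simp
  have inter: "U (\<pi> a f) = \<rho> a (U f)" if "a \<in> carrier A" "f \<in> carrier ?H" for a f
  proof -
    have "\<rho> a \<in> bounded_operators ?K ?K" using \<rho>(1) that(1) by (auto simp: star_hom_def)
    then have "\<rho> a (U f) \<in> carrier ?K" using U_in[OF that(2)] by (rule ell2.bop_in)
    then show ?thesis using U2 eq that by simp
  qed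
  have st: "star A (s e) \<in> carrier A \<and> \<pi> (star A (s e)) = S1.Ts e \<and> \<rho> (star A (s e)) = S2.Ts e" if e: "e \<in> arcs E" for e
    using \<pi>(1) \<rho>(1) \<pi>(2)[OF e] \<rho>(2)[OF e] S1.adj_T[OF e] S2.adj_T[OF e] cstar_algebra.star_closed[OF A]
    by (simp add: star_hom_def)
  have "spine_intertwiner E nx v0 \<theta> nx' v0' \<theta>' U"
  proof
    fix f e v assume f: "f \<in> carrier ?H"
    show "U (S1.T e f) = S2.T e (U f)" if "e \<in> arcs E"
      using inter[of "s e" f] \<pi>(2)[OF that] \<rho>(2)[OF that] f by (simp del: S1.T_apply S2.T_apply)
    show "U (S1.Ts e f) = S2.Ts e (U f)" if "e \<in> arcs E"
      using inter[of "star A (s e)" f] st[OF that] f by (simp del: S1.Ts_apply S2.Ts_apply)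
    show "U (S1.P v f) = S2.P v (U f)" if "v \<in> verts E"
      using inter[of "p v" f] \<pi>(3)[OF that] \<rho>(3)[OF that] f by simp
  qed (use U_in U_smult in auto)
  moreover have "f = (\<lambda>x. 0)" if "f \<in> carrier ?H" "U f = (\<lambda>x. 0)" for f
  proof -
    have "U (\<lambda>x. 0) = (\<lambda>x. 0)" using U_smult[OF that(1), of 0] by simp
    then show ?thesis using U1[OF that(1)] U1[OF ell2_zero_closed] that(2) by simp
  qed
  ultimately show ?thesis by blast
qed


section \<open>Consequences of a unique irreducible representation\<close>

context spine
begin

abbreviation follows :: "('v \<times> 'v) set" where
  "follows \<equiv> {(v, head E e) | v e. nx v = Some e}"

lemma W_iff: "v \<in> W \<longleftrightarrow> (v0, v) \<in> follows\<^sup>*"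
proof
  show "v \<in> W \<Longrightarrow> (v0, v) \<in> follows\<^sup>*"
    by (induction rule: W.induct) (auto intro: rtrancl.rtrancl_into_rtrancl)
  show "(v0, v) \<in> follows\<^sup>* \<Longrightarrow> v \<in> W"
    by (induction rule: rtrancl_induct) (auto intro: W.start W.follow)
qed

lemma follows_arcs: "follows \<subseteq> arcs_ends E"
  using nx_Some by (auto simp: arcs_ends_conv)

lemma W_reachable: "v \<in> W \<Longrightarrow> (v0, v) \<in> (arcs_ends E)\<^sup>*"
  using W_iff rtrancl_mono[OF follows_arcs] by auto

end

locale unique_rep_graph = wf_digraph E for E :: "('v, 'e) pre_digraph" +
  fixes A :: "'a cstar" and s :: "'e \<Rightarrow> 'a" and p :: "'v \<Rightarrow> 'a"
  assumes verts_nonempty: "verts E \<noteq> {}"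
    and graph: "graph_cstar_algebra E A s p"
    and unique: "unique_irreducible_representation TYPE(('v, 'e) hilbert_carrier) A"
begin

lemma A: "cstar_algebra A"
  using graph by (simp add: graph_cstar_algebra_def)

lemma s_in: "e \<in> arcs E \<Longrightarrow> s e \<in> carrier A" and p_in: "v \<in> verts E \<Longrightarrow> p v \<in> carrier A"
  using graph by (auto simp: graph_cstar_algebra_def generates_cstar_def)

lemma intertwiner_exists:
  assumes S1: "spine E nx v0 \<theta>" and S2: "spine E nx' v0' \<theta>'"
  shows "\<exists>U. spine_intertwiner E nx v0 \<theta> nx' v0' \<theta>' U \<and>
    (\<forall>f\<in>carrier (ell2 (spine.X E nx v0)). U f = (\<lambda>x. 0) \<longrightarrow> f = (\<lambda>x. 0))"
proof -
  obtain \<pi> where \<pi>: "star_hom A (bounded_operator_algebra (ell2 (spine.X E nx v0))) \<pi>"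
    "\<forall>e\<in>arcs E. \<pi> (s e) = spine.T E nx v0 \<theta> e" "\<forall>v\<in>verts E. \<pi> (p v) = spine.P E nx v0 v"
    using spine.representation_exists[OF S1 graph] by (elim exE conjE)
  obtain \<rho> where \<rho>: "star_hom A (bounded_operator_algebra (ell2 (spine.X E nx' v0'))) \<rho>"
    "\<forall>e\<in>arcs E. \<rho> (s e) = spine.T E nx' v0' \<theta>' e" "\<forall>v\<in>verts E. \<rho> (p v) = spine.P E nx' v0' v"
    using spine.representation_exists[OF S2 graph] by (elim exE conjE)
  have "irreducible_representation A (ell2 (spine.X E nx v0)) \<pi>"
    using \<pi> s_in p_in by (intro spine.irreducible[OF S1 A, where s=s and p=p]) auto
  moreover have "irreducible_representation A (ell2 (spine.X E nx' v0')) \<rho>"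
    using \<rho> s_in p_in by (intro spine.irreducible[OF S2 A, where s=s and p=p]) auto
  ultimately have "unitarily_equivalent A (ell2 (spine.X E nx v0)) \<pi> (ell2 (spine.X E nx' v0')) \<rho>"
    using unique unfolding unique_irreducible_representation_def by blast
  then show ?thesis
    using \<pi> \<rho> s_in p_in by (intro unitarily_equivalent_intertwiner[OF A S1 S2, where s=s and p=p]) auto
qed

lemma spineI:
  assumes "v0 \<in> verts E" "\<And>v e. nx v = Some e \<Longrightarrow> e \<in> out_arcs E v"
    and "\<And>v. nx v = None \<Longrightarrow> \<not> regular_vertex E v" and "\<And>e. cmod (\<theta> e) = 1"
  shows "spine E nx v0 \<theta>"
  using assms by unfold_locales auto

lemma spines_merge:
  assumes S1: "spine E nx v0 (\<lambda>_. 1)" and S2: "spine E nx' v0' (\<lambda>_. 1)"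
  shows "\<exists>w. w \<in> spine.W E nx v0 \<and> w \<in> spine.W E nx' v0' \<and>
    (\<forall>w'. (w, w') \<in> {(v, head E e) | v e. nx v = Some e}\<^sup>* \<longrightarrow> nx' w' = nx w')"
proof -
  obtain U where U: "spine_intertwiner E nx v0 (\<lambda>_. 1) nx' v0' (\<lambda>_. 1) U"
    and inj: "\<forall>f\<in>carrier (ell2 (spine.X E nx v0)). U f = (\<lambda>x. 0) \<longrightarrow> f = (\<lambda>x. 0)"
    using intertwiner_exists[OF S1 S2] by (elim exE conjE)
  interpret U: spine_intertwiner E nx v0 "\<lambda>_. 1" nx' v0' "\<lambda>_. 1" U by (rule U)
  have v0: "v0 \<in> U.S1.W" by (rule U.S1.W.start)
  have "U (delta [Inl v0]) \<noteq> (\<lambda>x. 0)"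
  proof
    assume "U (delta [Inl v0]) = (\<lambda>x. 0)"
    then have "(delta [Inl v0] :: ('v + 'e) list \<Rightarrow> complex) = (\<lambda>x. 0)"
      using bspec[OF inj, of "delta [Inl v0]"] delta_in[of "[Inl v0]" U.S1.X] v0 by simp
    then have "delta [Inl v0] ([Inl v0] :: ('v + 'e) list) = 0" by (rule fun_cong)
    then show False by simp
  qed
  then obtain x where "U (delta [Inl v0]) x \<noteq> 0" by auto
  then obtain w where w: "w \<in> U.S1.W" "w \<in> U.S2.W" "U (delta [Inl w]) [Inl w] \<noteq> 0"
    using U.merge[OF v0] by blast
  show ?thesis
    using w U.agree[OF w] by blast
qed

text \<open>On a cycle the edges can be multiplied by a phase \<open>\<zeta>\<close>; going once around the cycle, an intertwiner
  between the representations for \<open>\<zeta>\<close> and for \<open>1\<close> picks up the factor \<open>\<zeta>\<^sup>k = -1\<close>.\<close>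

theorem acyclic:
  assumes e0: "e0 \<in> arcs E"
  shows "(head E e0, tail E e0) \<notin> (arcs_ends E)\<^sup>*"
proof
  assume cyc: "(head E e0, tail E e0) \<in> (arcs_ends E)\<^sup>*"
  define v0 where "v0 = tail E e0"
  \<comment> \<open>The distance to \<open>v0\<close>. The rule takes \<open>e0\<close> at
    \<open>v0\<close> and elsewhere, if possible, an edge that lowers the distance, so that the
    spine from \<open>v0\<close> runs around a cycle. At vertices that cannot reach
    \<open>v0\<close> the value of \<open>d\<close> is arbitrary, but \<open>Q\<close> then holds
    for no edge.\<close>
  define d where "d v = (LEAST n. (v, v0) \<in> arcs_ends E ^^ n)" for v
  define Q where "Q v e \<longleftrightarrow> e \<in> out_arcs E v \<and> (\<exists>n. d v = Suc n \<and> (head E e, v0) \<in> arcs_ends E ^^ n)" for v e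
  define nx where "nx v = (if v = v0 then Some e0 else if \<exists>e. Q v e then Some (SOME e. Q v e)
      else if out_arcs E v \<noteq> {} then Some (SOME e. e \<in> out_arcs E v) else None)" for v
  let ?F = "{(v, head E e) | v e. nx v = Some e}"
  have nx_out: "e \<in> out_arcs E v" if "nx v = Some e" for v e
  proof (cases "v = v0")
    case False
    show ?thesis
    proof (cases "\<exists>e. Q v e")
      case True
      then have "e = (SOME e. Q v e)" using that False by (simp add: nx_def)
      with someI_ex[OF True] have "Q v e" by simp
      then show ?thesis by (simp add: Q_def)
    next
      case nQ: False
      then have "out_arcs E v \<noteq> {}" using that False by (auto simp: nx_def split: if_splits)
      then show ?thesis using some_in_eq[of "out_arcs E v"] that False nQ by (simp add: nx_def)
    qed
  qed (use that e0 in \<open>simp add: nx_def v0_def\<close>)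
  have nx_None: "\<not> regular_vertex E v" if "nx v = None" for v
    using that by (auto simp: nx_def regular_vertex_def split: if_splits)
  \<comment> \<open>A vertex that can reach \<open>v0\<close> in the graph also reaches it along
    \<open>nx\<close>, since each chosen edge shortens the way.\<close>
  have returns: "(v, v0) \<in> ?F\<^sup>*" if "(v, v0) \<in> arcs_ends E ^^ n" for v n
    using that
  proof (induction n arbitrary: v rule: less_induct)
    case (less n)
    show ?case
    proof (cases "v = v0")
      case False
      have dv: "(v, v0) \<in> arcs_ends E ^^ d v" "d v \<le> n"
        unfolding d_def using less.prems by (auto intro: LeastI Least_le)
      then obtain m where m: "d v = Suc m" using False by (cases "d v") auto
      then obtain y where "(v, y) \<in> arcs_ends E" "(y, v0) \<in> arcs_ends E ^^ m"
        using dv(1) relpow_Suc_D2[of v v0 m "arcs_ends E"] by auto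
      then have "\<exists>e. Q v e" using m by (auto simp: Q_def arcs_ends_conv)
      then obtain e where e: "nx v = Some e" "Q v e" using False someI_ex[of "Q v"] by (auto simp: nx_def)
      then have "(head E e, v0) \<in> arcs_ends E ^^ m" "m < n" using m dv(2) by (auto simp: Q_def)
      then have "(head E e, v0) \<in> ?F\<^sup>*" using less.IH by blast
      moreover have "(v, head E e) \<in> ?F" using e(1) by blast
      ultimately show ?thesis by (rule converse_rtrancl_into_rtrancl[rotated])
    qed simp
  qed
  have "(head E e0, v0) \<in> ?F\<^sup>*"
    using cyc returns rtrancl_power[of "(head E e0, v0)" "arcs_ends E"] by (auto simp: v0_def)
  moreover have "(v0, head E e0) \<in> ?F" by (auto simp: nx_def)
  ultimately have "(v0, v0) \<in> ?F\<^sup>+" by (rule rtrancl_into_trancl2[rotated])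
  then obtain k where k: "k > 0" "(v0, v0) \<in> ?F ^^ k" using trancl_power[of "(v0, v0)" ?F] by blast
  \<comment> \<open>\<open>k\<close> is the length of a closed walk along the spine, and the phase
    is chosen so that one turn changes the sign.\<close>
  define \<zeta> where "\<zeta> = cis (pi / real k)"
  have \<zeta>k: "\<zeta> ^ k = - 1" using k(1) Complex.DeMoivre[of "pi / real k" k] by (simp add: \<zeta>_def)
  have \<zeta>1: "\<zeta> * cnj \<zeta> = 1" by (simp add: \<zeta>_def cis_mult cis_cnj)
  have v0v: "v0 \<in> verts E" using e0 by (simp add: v0_def)
  have S1: "spine E nx v0 (\<lambda>_. \<zeta>)" by (rule spineI[OF v0v nx_out nx_None]) (auto simp: \<zeta>_def)
  have S2: "spine E nx v0 (\<lambda>_. 1)" by (rule spineI[OF v0v nx_out nx_None]) auto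
  obtain U where U: "spine_intertwiner E nx v0 (\<lambda>_. \<zeta>) nx v0 (\<lambda>_. 1) U"
    and inj: "\<forall>f\<in>carrier (ell2 (spine.X E nx v0)). U f = (\<lambda>x. 0) \<longrightarrow> f = (\<lambda>x. 0)"
    using intertwiner_exists[OF S1 S2] by (elim exE conjE)
  interpret U: phase_intertwiner E nx v0 "\<lambda>_. \<zeta>" "\<lambda>_. 1" U
    by (rule phase_intertwiner.intro[OF U])
  define c where "c u = U (delta [Inl u]) [Inl u]" for u
  have c_power: "u \<in> U.S1.W \<and> c u = \<zeta> ^ j * c v0" if "(v0, u) \<in> ?F ^^ j" for j u
    using that
  proof (induction j arbitrary: u)
    case 0
    then show ?case using U.S1.W.start by simp
  next
    case (Suc j)
    then obtain v e where ve: "(v0, v) \<in> ?F ^^ j" "nx v = Some e" "u = head E e" by auto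
    then have v: "v \<in> U.S1.W" "c v = \<zeta> ^ j * c v0" using Suc.IH by auto
    have "cnj \<zeta> * c u = c v" using U.phase[OF v(1) ve(2)] ve(3) by (simp add: c_def)
    then have "\<zeta> * (cnj \<zeta> * c u) = \<zeta> * (\<zeta> ^ j * c v0)" using v(2) by simp
    then show ?case using \<zeta>1 U.S1.W.follow[OF v(1) ve(2)] ve(3) by (simp add: mult.assoc[symmetric])
  qed
  \<comment> \<open>One turn gives \<open>c v0 = - c v0\<close>; the injective \<open>U\<close>
    would then kill the basis vector of the spine at \<open>v0\<close>.\<close>
  have "c v0 = 0" using c_power[OF k(2)] \<zeta>k by simp
  have v0W: "v0 \<in> U.S1.W" by (rule U.S1.W.start)
  have "U (delta [Inl v0]) = (\<lambda>x. 0)"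
    using U.support_delta[OF v0W] \<open>c v0 = 0\<close> by (auto simp: c_def fun_eq_iff)
  then have "(delta [Inl v0] :: ('v + 'e) list \<Rightarrow> complex) = (\<lambda>x. 0)"
    using bspec[OF inj, of "delta [Inl v0]"] delta_in[of "[Inl v0]" U.S1.X] v0W by simp
  then have "delta [Inl v0] ([Inl v0] :: ('v + 'e) list) = 0" by (rule fun_cong)
  then show False by simp
qed

text \<open>At a singular vertex a boundary path may stop. If \<open>w\<close> emitted an edge, the
  path from its head would have to merge with the one that stops at \<open>w\<close>, hence return
  to \<open>w\<close> and close a cycle.\<close>

theorem no_infinite_emitters:
  assumes "\<not> regular_vertex E w"
  shows "out_arcs E w = {}"
proof (rule ccontr)
  assume "out_arcs E w \<noteq> {}"
  then obtain e where "e \<in> out_arcs E w" by blast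
  then have e: "e \<in> arcs E" "tail E e = w" by auto
  \<comment> \<open>Stops at every singular vertex, also at one that emits edges.\<close>
  define nx where "nx v = (if regular_vertex E v then Some (SOME e. e \<in> out_arcs E v) else None)" for v
  have nx_out: "e \<in> out_arcs E v" if "nx v = Some e" for v e
    using that some_in_eq[of "out_arcs E v"] by (auto simp: nx_def regular_vertex_def split: if_splits)
  have S: "spine E nx v (\<lambda>_. 1)" if "v \<in> verts E" for v
    by (rule spineI[OF that nx_out]) (auto simp: nx_def split: if_splits)
  have wv: "w \<in> verts E" "head E e \<in> verts E" using e by auto
  obtain u where u: "u \<in> spine.W E nx w" "u \<in> spine.W E nx (head E e)"
    using spines_merge[OF S[OF wv(1)] S[OF wv(2)]] by (elim exE conjE)
  interpret Sw: spine E nx w "\<lambda>_. 1" by (rule S[OF wv(1)])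
  from u(1) have "u = w"
    by (induction rule: Sw.W.induct) (use assms in \<open>auto simp: nx_def\<close>)
  then have "(head E e, w) \<in> (arcs_ends E)\<^sup>*" using spine.W_reachable[OF S[OF wv(2)] u(2)] by simp
  then show False using acyclic[OF e(1)] e(2) by simp
qed

text \<open>Otherwise one could follow a path and, whenever there is a choice, deviate from it: the two
  boundary paths would never merge.\<close>

theorem line_vertex_exists:
  "\<exists>w\<in>verts E. \<forall>u e f. (w, u) \<in> (arcs_ends E)\<^sup>* \<longrightarrow> e \<in> out_arcs E u \<longrightarrow> f \<in> out_arcs E u \<longrightarrow> e = f"
proof (rule ccontr)
  assume "\<not> ?thesis"
  then have branch: "\<And>w. w \<in> verts E \<Longrightarrow> \<exists>u e f. (w, u) \<in> (arcs_ends E)\<^sup>* \<and> e \<in> out_arcs E u \<and> f \<in> out_arcs E u \<and> e \<noteq> f"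
    by blast
  obtain v0 where v0: "v0 \<in> verts E" using verts_nonempty by blast
  define nx where "nx v = (if out_arcs E v = {} then None else Some (SOME e. e \<in> out_arcs E v))" for v
  define nx' where "nx' v = (if \<exists>e. e \<in> out_arcs E v \<and> nx v \<noteq> Some e
      then Some (SOME e. e \<in> out_arcs E v \<and> nx v \<noteq> Some e) else nx v)" for v
  have nx_out: "e \<in> out_arcs E v" if "nx v = Some e" for v e
    using that some_in_eq[of "out_arcs E v"] by (auto simp: nx_def split: if_splits)
  have nx_None: "out_arcs E v = {}" if "nx v = None" for v
    using that by (auto simp: nx_def split: if_splits)
  have dev: "\<exists>g. nx' v = Some g \<and> g \<in> out_arcs E v \<and> nx v \<noteq> Some g" if "e \<in> out_arcs E v" "nx v \<noteq> Some e" for v e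
    using someI_ex[of "\<lambda>e. e \<in> out_arcs E v \<and> nx v \<noteq> Some e"] that by (auto simp: nx'_def)
  have nx'_out: "e \<in> out_arcs E v" if "nx' v = Some e" for v e
  proof (cases "\<exists>f. f \<in> out_arcs E v \<and> nx v \<noteq> Some f")
    case True
    then show ?thesis using dev that by force
  next
    case False
    then have "nx' v = nx v" by (simp only: nx'_def if_False)
    then show ?thesis using nx_out that by simp
  qed
  have nx'_None: "out_arcs E v = {}" if "nx' v = None" for v
    using that nx_None by (auto simp: nx'_def split: if_splits)
  have S: "spine E nx v0 (\<lambda>_. 1)" by (rule spineI[OF v0 nx_out]) (auto dest: nx_None simp: regular_vertex_def)
  have S': "spine E nx' v0 (\<lambda>_. 1)" by (rule spineI[OF v0 nx'_out]) (auto dest: nx'_None simp: regular_vertex_def)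
  obtain u where u: "u \<in> spine.W E nx v0"
    and agree: "\<forall>w. (u, w) \<in> {(v, head E e) | v e. nx v = Some e}\<^sup>* \<longrightarrow> nx' w = nx w"
    using spines_merge[OF S S'] by (elim exE conjE)
  \<comment> \<open>From \<open>u\<close> on the two rules agree, so no vertex there has an edge
    besides that of \<open>nx\<close>, and every vertex that can be reached lies on the
    spine.\<close>
  have on_spine: "(u, w) \<in> {(v, head E e) | v e. nx v = Some e}\<^sup>*" if "(u, w) \<in> (arcs_ends E)\<^sup>*" for w
    using that
  proof induction
    case (step y w)
    then obtain e where e: "e \<in> out_arcs E y" "w = head E e" by (auto simp: arcs_ends_conv)
    have "nx y = Some e" using agree step.IH dev[OF e(1)] by force
    then have "(y, w) \<in> {(v, head E e) | v e. nx v = Some e}" using e(2) by blast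
    with step.IH show ?case by (rule rtrancl.rtrancl_into_rtrancl)
  qed simp
  obtain b e f where b: "(u, b) \<in> (arcs_ends E)\<^sup>*" "e \<in> out_arcs E b" "f \<in> out_arcs E b" "e \<noteq> f"
    using branch[OF spine.W_verts[OF S u]] by blast
  \<comment> \<open>Of two distinct edges at \<open>b\<close> one is not the choice of
    \<open>nx\<close>, so \<open>nx'\<close> would deviate at \<open>b\<close>.\<close>
  have "nx' b = nx b" using agree on_spine[OF b(1)] by blast
  then show False using dev[of _ b] b(2,3,4) by (metis option.inject)
qed

end


section \<open>Linear maps on closed spans, and finite sums\<close>

context normed_module
begin

lemma closure_span_image:
  assumes G: "G \<subseteq> carrier V"
    and f: "\<And>x. x \<in> carrier V \<Longrightarrow> f x \<in> carrier V"
    and add: "\<And>x y. \<lbrakk>x \<in> carrier V; y \<in> carrier V\<rbrakk> \<Longrightarrow> f (x \<oplus> y) = f x \<oplus> f y"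
    and smult: "\<And>c x. x \<in> carrier V \<Longrightarrow> f (c \<odot> x) = c \<odot> f x"
    and L: "\<And>x. x \<in> carrier V \<Longrightarrow> N (f x) \<le> L * N x"
    and fG: "\<And>g. g \<in> G \<Longrightarrow> f g \<in> closure_set (lin_span G)"
    and x: "x \<in> closure_set (lin_span G)"
  shows "f x \<in> closure_set (lin_span G)"
proof (rule closure_set_image[OF _ _ f _ _ x])
  show sp: "lin_span G \<subseteq> carrier V" using lin_span_carrier[OF G] by auto
  then show "lin_span G \<subseteq> carrier V" .
  show "N (f y \<ominus> f z) \<le> L * N (y \<ominus> z)" if "y \<in> carrier V" "z \<in> carrier V" for y z
  proof -
    have "f y \<ominus> f z = f (y \<ominus> z)" using that f by (simp add: minus_eq_smult add smult)
    then show ?thesis using L[of "y \<ominus> z"] that by simp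
  qed
  note S = submoduleE[OF submodule_closure_span[OF G]]
  show "f y \<in> closure_set (lin_span G)" if "y \<in> lin_span G" for y
    using that
  proof induction
    case zero
    have "f \<zero> = \<zero>" using smult[of \<zero> 0] f by simp
    then show ?case using closure_set_superset[OF sp] lin_span.zero by auto
  next
    case (add x y)
    then show ?case using assms(3)[of x y] subsetD[OF sp] S(5) by simp
  next
    case (smult x c)
    then show ?case using assms(4)[of x c] subsetD[OF sp] S(4) by simp
  qed (rule fG)
qed

lemma submodule_finsum:
  assumes S: "submodule S complex_ring V" and "finite F" "\<And>i. i \<in> F \<Longrightarrow> f i \<in> S"
  shows "finsum V f F \<in> S"
  using assms(2,3)
proof (induction F)
  case empty
  have "lin_span {} \<subseteq> S" by (rule closed_submodule_contains_span[OF S]) simp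
  then show ?case using lin_span.zero[of "{}"] by (auto simp: M.finsum_empty)
next
  case (insert i F)
  then have "f \<in> F \<rightarrow> carrier V" "f i \<in> carrier V" using submoduleE(1)[OF S] by auto
  then show ?case using insert submoduleE(5)[OF S] by (simp add: M.finsum_insert)
qed

end

context cstar_algebra
begin

lemma finsum_mult_right:
  assumes "finite F" "f \<in> F \<rightarrow> carrier A" "b \<in> carrier A"
  shows "(\<Oplus>i\<in>F. f i) \<otimes> b = (\<Oplus>i\<in>F. f i \<otimes> b)"
  using assms(1,2)
proof (induction F)
  case empty
  then show ?case using assms(3) by (simp add: M.finsum_empty)
next
  case (insert i F)
  then have "f \<in> F \<rightarrow> carrier A" "f i \<in> carrier A" "(\<lambda>i. f i \<otimes> b) \<in> F \<rightarrow> carrier A" using assms(3) by auto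
  then show ?case using insert assms(3) by (simp add: M.finsum_insert mult_distrib_right M.finsum_closed)
qed

end

section \<open>Matrix units in the graph algebra\<close>

locale line_graph_algebra = unique_rep_graph E A s p + cstar_algebra A
  for E :: "('v, 'e) pre_digraph" and A :: "'a cstar" (structure) and s p +
  fixes w :: 'v
  assumes w: "w \<in> verts E"
    and line: "\<lbrakk>(w, u) \<in> (arcs_ends E)\<^sup>*; e \<in> out_arcs E u; f \<in> out_arcs E u\<rbrakk> \<Longrightarrow> e = f"
begin

text \<open>Stops only at vertices without edges, which by \<open>no_infinite_emitters\<close> are
  exactly the singular ones.\<close>

definition nx :: "'v \<Rightarrow> 'e option" where
  "nx v = (if out_arcs E v = {} then None else Some (SOME e. e \<in> out_arcs E v))"

lemma nx_out: "nx v = Some e \<Longrightarrow> e \<in> out_arcs E v"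
  using some_in_eq[of "out_arcs E v"] by (auto simp: nx_def split: if_splits)

lemma nx_None_iff: "nx v = None \<longleftrightarrow> out_arcs E v = {}"
  by (simp add: nx_def)

sublocale S: spine E nx w "\<lambda>_. 1"
  by (rule spineI[OF w nx_out]) (auto simp: nx_None_iff regular_vertex_def)

lemma W_out: "\<lbrakk>u \<in> S.W; e \<in> arcs E; tail E e = u\<rbrakk> \<Longrightarrow> nx u = Some e"
  using line[OF S.W_reachable, of u e "the (nx u)"] nx_out[of u "the (nx u)"] nx_None_iff[of u]
  by (cases "nx u") auto

text \<open>No vertex reachable from \<open>w\<close> branches, so a path that starts on the spine
  cannot leave it. In particular the range of \<open>S.P w\<close> is spanned by one basis
  vector.\<close>

lemma src_in_W:
  assumes "y \<in> S.X" "src E y \<in> S.W"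
  shows "y = [Inl (src E y)]"
  using assms
proof induction
  case (step x e)
  then have e: "tail E e \<in> S.W" "nx (tail E e) = Some e" using W_out by auto
  then have "x = [Inl (head E e)]" using step S.W.follow[OF e] by simp
  then have "S.ext e x = [Inl (tail E e)]" using e by (simp add: S.ext_def)
  then show ?case using step by simp
qed simp

subsection \<open>Relations of the Cuntz-Krieger family\<close>

lemma CK: "cuntz_krieger_family E A s p"
  using graph by (simp add: graph_cstar_algebra_def)

lemma s_A [simp]: "e \<in> arcs E \<Longrightarrow> s e \<in> carrier A" and p_A [simp]: "v \<in> verts E \<Longrightarrow> p v \<in> carrier A"
  using s_in p_in by auto

lemma p_idem: "v \<in> verts E \<Longrightarrow> p v \<otimes> p v = p v" and p_star: "v \<in> verts E \<Longrightarrow> star A (p v) = p v"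
  using CK by (auto simp: cuntz_krieger_family_def projection_def)

lemma p_orth: "\<lbrakk>u \<in> verts E; v \<in> verts E; u \<noteq> v\<rbrakk> \<Longrightarrow> p u \<otimes> p v = \<zero>"
  using CK by (auto simp: cuntz_krieger_family_def)

lemma ss: "e \<in> arcs E \<Longrightarrow> star A (s e) \<otimes> s e = p (head E e)"
  using CK by (auto simp: cuntz_krieger_family_def)

lemma sss: "e \<in> arcs E \<Longrightarrow> (s e \<otimes> star A (s e)) \<otimes> s e = s e"
  using CK by (auto simp: cuntz_krieger_family_def partial_isometry_def)

lemma s_p: "e \<in> arcs E \<Longrightarrow> s e \<otimes> p (head E e) = s e"
  using sss[of e] ss[of e] by (simp add: mult_assoc)

lemma p_sstar: "e \<in> arcs E \<Longrightarrow> p (head E e) \<otimes> star A (s e) = star A (s e)"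
  using arg_cong[OF s_p, of e "star A"] by (simp add: star_mult p_star)

text \<open>Multiply the orthogonality of the range projections by the adjoint of \<open>s e\<close>
  on the left and by \<open>s f\<close> on the right; both are partial isometries, so the
  projections disappear.\<close>

lemma s_orth:
  assumes e: "e \<in> arcs E" and f: "f \<in> arcs E" and ef: "e \<noteq> f"
  shows "star A (s e) \<otimes> s f = \<zero>"
proof -
  have "(s e \<otimes> star A (s e)) \<otimes> (s f \<otimes> star A (s f)) = \<zero>"
    using CK e f ef by (auto simp: cuntz_krieger_family_def)
  then have "star A (s e) \<otimes> ((s e \<otimes> star A (s e)) \<otimes> (s f \<otimes> star A (s f))) \<otimes> s f = \<zero>" using e f by simp
  moreover have "star A (s e) \<otimes> ((s e \<otimes> star A (s e)) \<otimes> (s f \<otimes> star A (s f))) \<otimes> s f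
      = (star A (s e) \<otimes> (s e \<otimes> star A (s e))) \<otimes> ((s f \<otimes> star A (s f)) \<otimes> s f)"
    using e f by (simp add: mult_assoc)
  moreover have "star A (s e) \<otimes> (s e \<otimes> star A (s e)) = star A (s e)"
    using arg_cong[OF sss[OF e], of "star A"] e by (simp add: star_mult)
  ultimately show ?thesis using sss[OF f] by simp
qed

lemma p_sum:
  assumes "out_arcs E v \<noteq> {}"
  shows "finite (out_arcs E v)" "p v = (\<Oplus>e\<in>out_arcs E v. s e \<otimes> star A (s e))"
proof -
  have r: "regular_vertex E v" using no_infinite_emitters[of v] assms by blast
  then show "finite (out_arcs E v)" by (simp add: regular_vertex_def)
  show "p v = (\<Oplus>e\<in>out_arcs E v. s e \<otimes> star A (s e))"
    using CK r by (auto simp: cuntz_krieger_family_def)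
qed

text \<open>A vertex that emits an edge is regular, so (CK3) writes \<open>p (tail E e)\<close> as a
  sum of range projections, of which \<open>s_orth\<close> leaves that of \<open>e\<close>.\<close>

lemma p_tail_s:
  assumes e: "e \<in> arcs E"
  shows "p (tail E e) \<otimes> s e = s e"
proof -
  have out: "e \<in> out_arcs E (tail E e)" using e by simp
  then have ne: "out_arcs E (tail E e) \<noteq> {}" by blast
  have "p (tail E e) \<otimes> s e = (\<Oplus>f\<in>out_arcs E (tail E e). (s f \<otimes> star A (s f)) \<otimes> s e)"
    unfolding p_sum(2)[OF ne] using p_sum(1)[OF ne] e by (intro finsum_mult_right) auto
  also have "\<dots> = (\<Oplus>f\<in>out_arcs E (tail E e). if e = f then s f else \<zero>)"
  proof (rule M.finsum_cong')
    fix f assume "f \<in> out_arcs E (tail E e)"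
    then have f: "f \<in> arcs E" by simp
    show "(s f \<otimes> star A (s f)) \<otimes> s e = (if e = f then s f else \<zero>)"
      using sss[OF e] s_orth[OF f e] e f by (cases "e = f") (simp_all add: mult_assoc)
  qed auto
  also have "\<dots> = s e"
    by (rule M.finsum_singleton) (use out p_sum(1)[OF ne] in auto)
  finally show ?thesis .
qed

lemma sstar_p_tail: "e \<in> arcs E \<Longrightarrow> star A (s e) \<otimes> p (tail E e) = star A (s e)"
  using arg_cong[OF p_tail_s, of e "star A"] by (simp add: star_mult p_star)

text \<open>On the spine (CK3) has a single summand, so a step along the spine can be
  undone.\<close>

lemma s_star_single:
  assumes "u \<in> S.W" "nx u = Some e"
  shows "s e \<otimes> star A (s e) = p u"
proof -
  have e: "e \<in> out_arcs E u" using nx_out assms by blast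
  have "f = e" if "f \<in> out_arcs E u" for f
    using W_out[OF assms(1), of f] assms(2) that by simp
  then have "out_arcs E u = {e}" using e by blast
  moreover have "(\<Oplus>f\<in>{e}. s f \<otimes> star A (s f)) = s e \<otimes> star A (s e)"
    using e by (subst M.finsum_insert) (auto simp: M.finsum_empty)
  ultimately show ?thesis using p_sum(2)[of u] by simp
qed

subsection \<open>The partial isometries\<close>

text \<open>\<open>line_elt v a\<close> says that \<open>a\<close> is the adjoint of \<open>s\<^sub>\<nu>\<close> for the path \<open>\<nu>\<close> from \<open>w\<close> to \<open>v\<close>.\<close>

inductive line_elt :: "'v \<Rightarrow> 'a \<Rightarrow> bool" where
  start: "line_elt w (p w)"
| follow: "\<lbrakk>line_elt v a; v \<in> S.W; nx v = Some e\<rbrakk> \<Longrightarrow> line_elt (head E e) (star A (s e) \<otimes> a)"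

lemma line_elt_exists: "v \<in> S.W \<Longrightarrow> \<exists>a. line_elt v a"
  by (induction rule: S.W.induct) (auto intro: line_elt.intros)

lemma W_total:
  assumes "v \<in> S.W" "v' \<in> S.W"
  shows "(v, v') \<in> S.follows\<^sup>* \<or> (v', v) \<in> S.follows\<^sup>*"
  using assms(1)
proof induction
  case start
  then show ?case using assms(2) S.W_iff by blast
next
  case (follow v e)
  have step: "(v, head E e) \<in> S.follows" using follow by blast
  from follow.IH show ?case
  proof
    assume "(v, v') \<in> S.follows\<^sup>*"
    then show ?thesis
    proof (cases rule: converse_rtranclE)
      case base
      then show ?thesis using step by blast
    next
      case (step y)
      then show ?thesis using follow by auto
    qed
  next
    assume "(v', v) \<in> S.follows\<^sup>*"
    then show ?thesis using step by (meson rtrancl.rtrancl_into_rtrancl)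
  qed
qed

lemma W_no_return: "\<lbrakk>nx v = Some e; (head E e, v) \<in> (arcs_ends E)\<^sup>*\<rbrakk> \<Longrightarrow> False"
  using acyclic[of e] nx_out[of v e] by auto

text \<open>Of two vertices of the spine one is reached from the other; if they were distinct with
  the same successor, the later one would be reached from its own successor, which closes a
  cycle.\<close>

lemma W_pred_unique:
  assumes "v \<in> S.W" "v' \<in> S.W" "nx v = Some e" "nx v' = Some e'" "head E e = head E e'"
  shows "v = v'"
proof -
  have *: "x = y" if xy: "(x, y) \<in> S.follows\<^sup>*" "nx x = Some f" "nx y = Some g" "head E f = head E g" for x y f g
    using xy(1)
  proof (cases rule: converse_rtranclE)
    case (step z)
    then have "(head E g, y) \<in> S.follows\<^sup>*" using xy by auto
    then have "(head E g, y) \<in> (arcs_ends E)\<^sup>*" using rtrancl_mono[OF S.follows_arcs] by blast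
    then show ?thesis using W_no_return[OF xy(3)] by blast
  qed
  show ?thesis using W_total[OF assms(1,2)] *[of v v' e e'] *[of v' v e' e] assms by auto
qed

text \<open>Acyclicity makes the path from \<open>w\<close> to \<open>v\<close> unique: it does not
  return to \<open>w\<close>, and each later vertex has one predecessor. This justifies the
  \<open>THE\<close> in \<open>line_part\<close>.\<close>

lemma line_elt_unique: "\<lbrakk>line_elt v a; line_elt v b\<rbrakk> \<Longrightarrow> a = b"
proof (induction arbitrary: b rule: line_elt.induct)
  case start
  then show ?case
  proof (cases rule: line_elt.cases)
    case (follow v a e)
    then show ?thesis using W_no_return[of v e] S.W_reachable[of v] by simp
  qed simp
next
  case (follow v a e)
  note IH = follow.IH and hyps = follow.hyps
  from follow.prems show ?case
  proof (cases rule: line_elt.cases)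
    case start
    then show ?thesis using W_no_return[of v e] S.W_reachable[of v] hyps by simp
  next
    case (follow v' a' e')
    then have "v' = v" using W_pred_unique[of v' v e' e] hyps by simp
    then show ?thesis using follow hyps IH[of a'] by simp
  qed
qed

definition line_part :: "'v \<Rightarrow> 'a" where
  "line_part v = (THE a. line_elt v a)"

lemma line_part: "v \<in> S.W \<Longrightarrow> line_elt v (line_part v)"
  unfolding line_part_def using line_elt_exists line_elt_unique by (metis theI')

lemma line_part_start: "line_part w = p w"
  using line_elt_unique[OF line_part[OF S.W.start] line_elt.start] .

lemma line_part_follow: "\<lbrakk>v \<in> S.W; nx v = Some e\<rbrakk> \<Longrightarrow> line_part (head E e) = star A (s e) \<otimes> line_part v"
  using line_elt_unique[OF line_part line_elt.follow[OF line_part]] S.W.follow by blast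

text \<open>For the code \<open>[Inr e\<^sub>1, \<dots>, Inr e\<^sub>n, Inl v]\<close> this is the
  product of the \<open>s e\<^sub>i\<close> with the adjoint of the partial isometry of the path
  from \<open>w\<close> to \<open>v\<close>. Its source projection is \<open>p w\<close>, so these
  elements form a column of a system of matrix units.\<close>

fun path_elt :: "('v + 'e) list \<Rightarrow> 'a" where
  "path_elt (Inl v # x) = line_part v"
| "path_elt (Inr e # x) = s e \<otimes> path_elt x"
| "path_elt [] = \<zero>"

lemma line_part_props: "v \<in> S.W \<Longrightarrow> line_part v \<in> carrier A \<and> p v \<otimes> line_part v = line_part v \<and> line_part v \<otimes> p w = line_part v"
proof (induction rule: S.W.induct)
  case start
  then show ?case using w by (simp add: line_part_start p_idem)
next
  case (follow v e)
  then have e: "e \<in> arcs E" using nx_out by auto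
  then show ?case
    using follow w p_sstar[OF e] by (simp add: line_part_follow mult_assoc[symmetric]) (simp add: mult_assoc)
qed

lemma path_elt_props: "x \<in> S.X \<Longrightarrow> path_elt x \<in> carrier A \<and> p (src E x) \<otimes> path_elt x = path_elt x \<and> path_elt x \<otimes> p w = path_elt x"
proof (induction rule: S.X.induct)
  case (step x e)
  then show ?case
    using w p_tail_s[of e] by (simp add: mult_assoc[symmetric]) (simp add: mult_assoc)
qed (simp add: line_part_props)

lemma path_elt_A [simp]: "x \<in> S.X \<Longrightarrow> path_elt x \<in> carrier A"
  and path_elt_p: "x \<in> S.X \<Longrightarrow> path_elt x \<otimes> p w = path_elt x"
  using path_elt_props by auto

lemma p_path_elt:
  assumes "x \<in> S.X" "v \<in> verts E"
  shows "p v \<otimes> path_elt x = (if src E x = v then path_elt x else \<zero>)"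
proof (cases "src E x = v")
  case False
  have sv: "src E x \<in> verts E" using S.src_verts assms by blast
  have "p v \<otimes> path_elt x = (p v \<otimes> p (src E x)) \<otimes> path_elt x"
    using path_elt_props[OF assms(1)] assms(2) sv by (simp add: mult_assoc)
  then show ?thesis using p_orth[OF assms(2) sv] False assms(1) by simp
qed (use path_elt_props[OF assms(1)] in simp)

text \<open>With \<open>sstar_path_elt\<close>: \<open>s e\<close> and its adjoint act on these
  elements as \<open>T e\<close> and \<open>Ts e\<close> act on basis vectors.\<close>

lemma s_path_elt:
  assumes x: "x \<in> S.X" and e: "e \<in> arcs E"
  shows "s e \<otimes> path_elt x = (if src E x = head E e then path_elt (S.ext e x) else \<zero>)"
proof (cases "src E x = head E e")
  case True
  show ?thesis
  proof (cases "S.ext e x = Inr e # x")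
    case False
    then have t: "x = [Inl (head E e)]" "tail E e \<in> S.W" "nx (tail E e) = Some e" "S.ext e x = [Inl (tail E e)]"
      by (auto simp: S.ext_def split: if_splits)
    \<comment> \<open>Here prepending \<open>e\<close> runs back along the spine, and
      \<open>s e\<close> cancels its adjoint in \<open>line_part (head E e)\<close> by
      \<open>s_star_single\<close>.\<close>
    have "s e \<otimes> (star A (s e) \<otimes> line_part (tail E e)) = (s e \<otimes> star A (s e)) \<otimes> line_part (tail E e)"
      using e line_part_props[OF t(2)] by (simp add: mult_assoc)
    then show ?thesis using t line_part_props[OF t(2)] s_star_single[OF t(2,3)] by (simp add: line_part_follow)
  qed (use True in simp)
next
  case False
  have "s e \<otimes> path_elt x = s e \<otimes> (p (head E e) \<otimes> path_elt x)"
    using s_p[OF e] e x by (simp add: mult_assoc[symmetric])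
  then show ?thesis using p_path_elt[OF x, of "head E e"] False e by simp
qed

lemma sstar_path_elt:
  assumes y: "y \<in> S.X" and e: "e \<in> arcs E"
  shows "star A (s e) \<otimes> path_elt y = (if S.edge y = Some e then path_elt (S.next_state y) else \<zero>)"
proof (cases "S.edge y")
  case None
  then obtain v where v: "v \<in> S.W" "y = [Inl v]" "nx v = None" using S.edge_None[OF y] by blast
  then have "tail E e \<noteq> v" using e by (auto simp: nx_None_iff)
  then have "p (tail E e) \<otimes> path_elt y = \<zero>" using p_path_elt[OF y, of "tail E e"] v(2) e by simp
  moreover have "star A (s e) \<otimes> path_elt y = star A (s e) \<otimes> (p (tail E e) \<otimes> path_elt y)"
    using sstar_p_tail[OF e] e y by (simp add: mult_assoc[symmetric])
  ultimately show ?thesis using None e by simp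
next
  case (Some f)
  note ff = S.edge_Some[OF y Some]
  have uy: "path_elt y = s f \<otimes> path_elt (S.next_state y)" using s_path_elt[OF ff(3,1)] ff by simp
  have "star A (s e) \<otimes> path_elt y = (star A (s e) \<otimes> s f) \<otimes> path_elt (S.next_state y)"
    unfolding uy using e ff by (simp add: mult_assoc)
  then show ?thesis
    using Some ff e ss[OF e] s_orth[OF e ff(1)] p_path_elt[OF ff(3), of "head E e"] by (cases "e = f") auto
qed

text \<open>The factors of \<open>path_elt x\<close> are transferred one by one to
  \<open>path_elt y\<close>. An edge off the spine shortens \<open>y\<close>; one on the spine
  enters \<open>path_elt x\<close> as an adjoint and prolongs \<open>y\<close>. In the end
  \<open>p w\<close> acts on \<open>path_elt y\<close>, and the result is 0 unless the current
  \<open>y\<close> is \<open>[Inl w]\<close>.\<close>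

lemma path_elt_orthonormal:
  assumes x: "x \<in> S.X" and y: "y \<in> S.X"
  shows "star A (path_elt x) \<otimes> path_elt y = (if x = y then p w else \<zero>)"
  using x y
proof (induction arbitrary: y rule: S.X.induct)
  case (base v)
  then show ?case
  proof (induction arbitrary: y rule: S.W.induct)
    case start
    have "src E y = w \<longleftrightarrow> [Inl w] = y"
      using src_in_W[OF start] S.W.start by auto
    then show ?case using p_path_elt[OF start w] w by (auto simp: line_part_start p_star)
  next
    case (follow v e)
    have e: "e \<in> arcs E" "tail E e = v" using nx_out follow by auto
    have tv: "line_part v \<in> carrier A" using line_part_props follow by blast
    have "star A (path_elt [Inl (head E e)]) \<otimes> path_elt y = star A (line_part v) \<otimes> (s e \<otimes> path_elt y)"
      using e tv follow by (simp add: line_part_follow star_mult mult_assoc)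
    also have "\<dots> = (if [Inl (head E e)] = y then p w else \<zero>)"
    proof (cases "src E y = head E e")
      case True
      have "S.ext e y = [Inl v] \<longleftrightarrow> y = [Inl (head E e)]"
        using e follow by (auto simp: S.ext_def)
      then show ?thesis
        using follow.IH[OF S.ext_X(1)[OF follow.prems e(1) True]] s_path_elt[OF follow.prems e(1)] True by auto
    next
      case False
      then show ?thesis using s_path_elt[OF follow.prems e(1)] tv by auto
    qed
    finally show ?case .
  qed
next
  case (step x e)
  have xX: "Inr e # x \<in> S.X" using S.X.step step by blast
  have "star A (path_elt (Inr e # x)) \<otimes> path_elt y = star A (path_elt x) \<otimes> (star A (s e) \<otimes> path_elt y)"
    using step by (simp add: star_mult mult_assoc)
  also have "\<dots> = (if Inr e # x = y then p w else \<zero>)"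
  proof (cases "S.edge y = Some e")
    case True
    note ee = S.edge_Some[OF step.prems True]
    have "x = S.next_state y \<longleftrightarrow> Inr e # x = y"
      using ee(5) step.hyps by auto
    then show ?thesis using sstar_path_elt[OF step.prems step.hyps(2)] True step.IH[OF ee(3)] by simp
  next
    case False
    then show ?thesis using sstar_path_elt[OF step.prems step.hyps(2)] step by auto
  qed
  finally show ?case .
qed

definition path_unit :: "('v + 'e) list \<Rightarrow> ('v + 'e) list \<Rightarrow> 'a" where
  "path_unit x y = path_elt x \<otimes> star A (path_elt y)"

definition path_units where "path_units = {path_unit x y | x y. x \<in> S.X \<and> y \<in> S.X}"

lemma path_unit_in: "\<lbrakk>x \<in> S.X; y \<in> S.X\<rbrakk> \<Longrightarrow> path_unit x y \<in> carrier A"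
  by (simp add: path_unit_def)

lemma path_unit_star: "\<lbrakk>x \<in> S.X; y \<in> S.X\<rbrakk> \<Longrightarrow> star A (path_unit x y) = path_unit y x"
  by (simp add: path_unit_def star_mult)

lemma path_unit_mult:
  assumes "x \<in> S.X" "y \<in> S.X" "z \<in> S.X" "t \<in> S.X"
  shows "path_unit x y \<otimes> path_unit z t = (if y = z then path_unit x t else \<zero>)"
proof -
  have "path_unit x y \<otimes> path_unit z t = path_elt x \<otimes> (star A (path_elt y) \<otimes> path_elt z) \<otimes> star A (path_elt t)"
    using assms by (simp add: path_unit_def mult_assoc)
  then show ?thesis using assms path_elt_orthonormal[of y z] path_elt_p[of x] by (auto simp: path_unit_def)
qed

lemma path_units_A: "path_units \<subseteq> carrier A"
  by (auto simp: path_units_def path_unit_in)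

definition units_closure where "units_closure = closure_set (lin_span path_units)"

lemma units_closure_A: "x \<in> units_closure \<Longrightarrow> x \<in> carrier A"
  by (simp add: units_closure_def closure_set_carrier)

lemma path_units_units_closure: "path_units \<subseteq> units_closure"
  unfolding units_closure_def using closure_set_superset[of "lin_span path_units"] lin_span_carrier[OF path_units_A] by (auto intro: lin_span.base)

lemma units_closure_submodule: "submodule units_closure complex_ring A"
  unfolding units_closure_def by (rule submodule_closure_span[OF path_units_A])

lemmas units_closure_sub = submoduleE[OF units_closure_submodule]

lemma units_closure_zero: "\<zero> \<in> units_closure"
proof -
  obtain x where "x \<in> units_closure" using units_closure_sub(2) by blast
  then have "0 \<odot> x \<in> units_closure" using units_closure_sub(4)[of 0 x] by simp
  then show ?thesis using \<open>x \<in> units_closure\<close> units_closure_A by simp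
qed

lemma units_closure_mult_left:
  assumes "b \<in> carrier A" "\<And>g. g \<in> path_units \<Longrightarrow> b \<otimes> g \<in> units_closure" "x \<in> units_closure"
  shows "b \<otimes> x \<in> units_closure"
  unfolding units_closure_def
  by (rule closure_span_image[OF path_units_A, of "\<lambda>x. b \<otimes> x" "alg_norm A b"])
    (use assms norm_mult in \<open>auto simp: units_closure_def mult_distrib_left smult_mult_right\<close>)

lemma units_closure_mult_right:
  assumes "b \<in> carrier A" "\<And>g. g \<in> path_units \<Longrightarrow> g \<otimes> b \<in> units_closure" "x \<in> units_closure"
  shows "x \<otimes> b \<in> units_closure"
  unfolding units_closure_def
proof (rule closure_span_image[OF path_units_A, of "\<lambda>x. x \<otimes> b" "alg_norm A b"])
  show "alg_norm A (y \<otimes> b) \<le> alg_norm A b * alg_norm A y" if "y \<in> carrier A" for y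
    using norm_mult[OF that assms(1)] by (simp add: mult.commute)
qed (use assms in \<open>auto simp: units_closure_def mult_distrib_right smult_mult_left\<close>)

lemma units_closure_star:
  assumes "x \<in> units_closure"
  shows "star A x \<in> units_closure"
proof -
  \<comment> \<open>The star is only conjugate linear, so \<open>closure_span_image\<close> does not apply.\<close>
  have sp: "lin_span path_units \<subseteq> carrier A" using lin_span_carrier[OF path_units_A] by auto
  have "star A y \<in> units_closure" if "y \<in> lin_span path_units" for y
    using that
  proof induction
    case zero
    then show ?case using units_closure_zero by simp
  next
    case (base g)
    then obtain x y where "x \<in> S.X" "y \<in> S.X" "g = path_unit x y" by (auto simp: path_units_def)
    then have "star A g \<in> path_units" using path_unit_star by (auto simp: path_units_def)
    then show ?case using path_units_units_closure by auto
  next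
    case (add x y)
    then show ?case using star_add[of x y] subsetD[OF sp] units_closure_sub(5) by simp
  next
    case (smult x c)
    then show ?case using star_smult[of x c] subsetD[OF sp] units_closure_sub(4) by simp
  qed
  then have span: "star A y \<in> closure_set (lin_span path_units)" if "y \<in> lin_span path_units" for y
    using that by (simp add: units_closure_def)
  show ?thesis
    unfolding units_closure_def
  proof (rule closure_set_image[OF sp sp _ _ span, where L=1])
    show "alg_norm A (star A y \<ominus> star A z) \<le> 1 * alg_norm A (y \<ominus> z)" if "y \<in> carrier A" "z \<in> carrier A" for y z
      using that norm_star[of "y \<ominus> z"] by (simp add: star_minus)
  qed (use assms in \<open>simp_all add: units_closure_def\<close>)
qed

lemma units_closure_mult: assumes "x \<in> units_closure" "y \<in> units_closure" shows "x \<otimes> y \<in> units_closure"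
proof (rule units_closure_mult_right[OF units_closure_A[OF assms(2)] _ assms(1)])
  fix g assume g: "g \<in> path_units"
  show "g \<otimes> y \<in> units_closure"
  proof (rule units_closure_mult_left[OF _ _ assms(2)])
    show "g \<in> carrier A" using g path_units_A by auto
    fix h assume h: "h \<in> path_units"
    obtain a b where "g = path_unit a b" "a \<in> S.X" "b \<in> S.X" using g by (auto simp: path_units_def)
    moreover obtain c d where "h = path_unit c d" "c \<in> S.X" "d \<in> S.X" using h by (auto simp: path_units_def)
    ultimately have "g \<otimes> h = \<zero> \<or> g \<otimes> h \<in> path_units" using path_unit_mult by (auto simp: path_units_def)
    then show "g \<otimes> h \<in> units_closure" using units_closure_zero path_units_units_closure by auto
  qed
qed

text \<open>\<open>b\<close> acts on the left factor of a matrix unit; if it maps each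
  \<open>path_elt x\<close> to another such element or to 0, it does the same to matrix
  units.\<close>

lemma units_closure_left_ideal:
  assumes "b \<in> carrier A" "\<And>x. x \<in> S.X \<Longrightarrow> b \<otimes> path_elt x = \<zero> \<or> (\<exists>x'\<in>S.X. b \<otimes> path_elt x = path_elt x')" "y \<in> units_closure"
  shows "b \<otimes> y \<in> units_closure"
proof (rule units_closure_mult_left[OF assms(1) _ assms(3)])
  fix g assume "g \<in> path_units"
  then obtain x z where g: "g = path_unit x z" "x \<in> S.X" "z \<in> S.X" by (auto simp: path_units_def)
  then have "b \<otimes> g = (b \<otimes> path_elt x) \<otimes> star A (path_elt z)" using assms(1) by (simp add: path_unit_def mult_assoc)
  then have "b \<otimes> g = \<zero> \<or> b \<otimes> g \<in> path_units" using assms(2)[OF g(2)] g(3) by (auto simp: path_units_def path_unit_def)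
  then show "b \<otimes> g \<in> units_closure" using units_closure_zero path_units_units_closure by auto
qed

lemma s_units_closure: "\<lbrakk>e \<in> arcs E; x \<in> units_closure\<rbrakk> \<Longrightarrow> s e \<otimes> x \<in> units_closure"
  by (rule units_closure_left_ideal) (auto simp: s_path_elt S.ext_X)

lemma sstar_units_closure: "\<lbrakk>e \<in> arcs E; x \<in> units_closure\<rbrakk> \<Longrightarrow> star A (s e) \<otimes> x \<in> units_closure"
  by (rule units_closure_left_ideal) (auto simp: sstar_path_elt S.edge_Some)

text \<open>Taking adjoints turns this into left multiplication by the adjoint of
  \<open>s e\<close>.\<close>

lemma units_closure_s: "\<lbrakk>e \<in> arcs E; x \<in> units_closure\<rbrakk> \<Longrightarrow> x \<otimes> s e \<in> units_closure"
  using units_closure_star[OF sstar_units_closure[OF _ units_closure_star, of e x]] units_closure_A[of x] by (simp add: star_mult)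

lemma units_closure_sstar: "\<lbrakk>e \<in> arcs E; x \<in> units_closure\<rbrakk> \<Longrightarrow> x \<otimes> star A (s e) \<in> units_closure"
  using units_closure_star[OF s_units_closure[OF _ units_closure_star, of e x]] units_closure_A[of x] by (simp add: star_mult)

text \<open>\<open>p w\<close> is itself a matrix unit, and conjugation by \<open>s e\<close>
  carries membership along the spine.\<close>

lemma p_W_units_closure: "v \<in> S.W \<Longrightarrow> p v \<in> units_closure"
proof (induction rule: S.W.induct)
  case start
  have "path_unit [Inl w] [Inl w] = p w" using w by (simp add: path_unit_def line_part_start p_star p_idem)
  moreover have "path_unit [Inl w] [Inl w] \<in> path_units" unfolding path_units_def using S.Inl_in_X S.W.start by blast
  ultimately have "p w \<in> path_units" by simp
  then show ?case using path_units_units_closure by auto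
next
  case (follow v e)
  then have e: "e \<in> arcs E" "tail E e = v" using nx_out by auto
  have "p (head E e) = star A (s e) \<otimes> (p (tail E e) \<otimes> s e)" using ss[OF e(1)] p_tail_s[OF e(1)] by simp
  then show ?case using sstar_units_closure[OF e(1) units_closure_s[OF e(1)]] follow e(2) by simp
qed

lemma p_units_closure:
  assumes v: "v \<in> verts E"
  shows "p v \<in> units_closure"
proof (rule ccontr)
  assume pv: "p v \<notin> units_closure"
  \<comment> \<open>Edges out of \<open>u\<close> whose range again has its projection outside the
    closed span; \<open>nx2\<close> follows one of them whenever it can.\<close>
  define B where "B u = {e \<in> out_arcs E u. p (head E e) \<notin> units_closure}" for u
  define nx2 where "nx2 u = (if B u \<noteq> {} then Some (SOME e. e \<in> B u) else nx u)" for u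
  have nx2_B: "nx2 u = Some e \<Longrightarrow> B u \<noteq> {} \<Longrightarrow> e \<in> B u" for u e
    using some_in_eq[of "B u"] by (auto simp: nx2_def)
  have nx2_out: "e \<in> out_arcs E u" if "nx2 u = Some e" for u e
  proof (cases "B u = {}")
    case True
    then have "nx u = Some e" using that by (simp only: nx2_def simp_thms if_False)
    then show ?thesis by (rule nx_out)
  next
    case False
    then show ?thesis using nx2_B[OF that] by (simp add: B_def)
  qed
  have nx2_None: "nx2 u = None \<Longrightarrow> out_arcs E u = {}" for u
    by (auto simp: nx2_def nx_None_iff split: if_splits)
  have S2: "spine E nx2 v (\<lambda>_. 1)"
    by (rule spineI[OF v nx2_out]) (auto dest: nx2_None simp: regular_vertex_def)
  interpret S2: spine E nx2 v "\<lambda>_. 1" by (rule S2)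
  have bad: "p u \<notin> units_closure" if "u \<in> S2.W" for u
    using that
  proof induction
    \<comment> \<open>If \<open>B u\<close> were empty, each summand of (CK3) at \<open>u\<close>
      would equal \<open>s f \<otimes> p (head E f) \<otimes> star A (s f)\<close> with its middle
      factor in the closed span, and \<open>p u\<close> would be in it too.\<close>
    case (follow u e)
    have "B u \<noteq> {}"
    proof
      assume B: "B u = {}"
      have ne: "out_arcs E u \<noteq> {}" using nx2_out[OF follow.hyps(2)] by blast
      have "s f \<otimes> star A (s f) \<in> units_closure" if "f \<in> out_arcs E u" for f
      proof -
        have f: "f \<in> arcs E" "p (head E f) \<in> units_closure" using that B by (auto simp: B_def)
        have "s f \<otimes> star A (s f) = (s f \<otimes> p (head E f)) \<otimes> star A (s f)" using s_p[OF f(1)] by simp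
        then show ?thesis using units_closure_sstar[OF f(1) s_units_closure[OF f]] by simp
      qed
      then have "p u \<in> units_closure" unfolding p_sum(2)[OF ne] by (rule submodule_finsum[OF units_closure_submodule p_sum(1)[OF ne]])
      then show False using follow.IH by blast
    qed
    then show ?case using nx2_B[OF follow.hyps(2)] by (simp add: B_def)
  qed (rule pv)
  obtain u where "u \<in> S.W" "u \<in> S2.W"
    using spines_merge[OF S.spine_axioms S2] by (elim exE conjE)
  then show False using p_W_units_closure bad by blast
qed

lemma units_closure_eq: "units_closure = carrier A"
proof -
  have "cstar_subalgebra units_closure A"
    unfolding cstar_subalgebra_def
    using units_closure_submodule units_closure_mult units_closure_star closedin_closure_set[of "lin_span path_units"] lin_span_carrier[OF path_units_A]
    by (auto simp: units_closure_def)
  \<comment> \<open>For the edges use \<open>s e = s e \<otimes> p (head E e)\<close>.\<close>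
  moreover have "s ` arcs E \<union> p ` verts E \<subseteq> units_closure"
    using p_units_closure s_p s_units_closure[OF _ p_units_closure[OF head_in_verts]] by force
  moreover have "generates_cstar (s ` arcs E \<union> p ` verts E) A"
    using graph by (simp add: graph_cstar_algebra_def)
  ultimately show ?thesis unfolding generates_cstar_def by blast
qed

text \<open>The representation on the class of the spine sends \<open>path_elt x\<close> to the
  matrix unit in row \<open>x\<close> and column \<open>[Inl w]\<close>, so the abstract matrix
  units go to the concrete ones and \<open>matrix_unit_algebra\<close> applies.\<close>

theorem isomorphic: "star_isomorphic A (compact_operator_algebra (ell2 S.X))"
proof -
  obtain \<pi> where hom: "star_hom A (bounded_operator_algebra (ell2 S.X)) \<pi>"
    and \<pi>s: "\<forall>e\<in>arcs E. \<pi> (s e) = S.T e" and \<pi>p: "\<forall>v\<in>verts E. \<pi> (p v) = S.P v"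
    using S.representation_exists[OF graph] by (elim exE conjE)
  have \<pi>_mult: "\<pi> (b \<otimes> c) = \<pi> b \<otimes>\<^bsub>bounded_operator_algebra (ell2 S.X)\<^esub> \<pi> c" if "b \<in> carrier A" "c \<in> carrier A" for b c
    using hom that by (simp add: star_hom_def)
  have \<pi>_star: "\<pi> (star A b) = adjoint_operator (ell2 S.X) (ell2 S.X) (\<pi> b)" if "b \<in> carrier A" for b
    using hom that by (simp add: star_hom_def)
  have munit_eq: "munit S.X x y = (\<lambda>f\<in>carrier (ell2 S.X). \<lambda>z. f y * delta x z)" for x y
    by (auto simp: wpb_def delta_apply fun_eq_iff)
  have w0: "[Inl w] \<in> S.X" using S.W.start by simp
  have scaled: "R (\<lambda>z. k * delta x z) = (\<lambda>z. k * R (delta x) z)"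
    if "R \<in> bounded_operators (ell2 S.X) (ell2 S.X)" "x \<in> S.X" for R k x
    using ell2.bop_smult[OF that(1) delta_in[OF that(2)], of k] by simp
  have \<pi>_line_part: "\<pi> (line_part v) = munit S.X [Inl v] [Inl w]" if "v \<in> S.W" for v
    using that
  proof induction
    case start
    \<comment> \<open>\<open>[Inl w]\<close> is the only code of a path from \<open>w\<close>, so
      \<open>S.P w\<close> has rank one.\<close>
    have "S.X \<inter> {x. src E x = w} = {[Inl w]}" using src_in_W[of _] w0 S.W.start by force
    then have "S.P w = munit S.X [Inl w] [Inl w]"
      unfolding S.P_def S.D_def by (auto simp: wpb_def fun_eq_iff)
    then show ?case using \<pi>p w by (simp add: line_part_start)
  next
    case (follow v e)
    have e: "e \<in> arcs E" "tail E e = v" using nx_out follow by auto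
    have vX: "[Inl v] \<in> S.X" using follow by simp
    \<comment> \<open>\<open>Ts e\<close> moves the one nonzero row from \<open>[Inl v]\<close> to
      the next vertex of the spine.\<close>
    have "\<pi> (line_part (head E e)) = S.Ts e \<otimes>\<^bsub>bounded_operator_algebra (ell2 S.X)\<^esub> munit S.X [Inl v] [Inl w]"
      using follow line_part_props \<pi>_mult[of "star A (s e)" "line_part v"] \<pi>_star[of "s e"] \<pi>s e S.adj_T[of e] line_part_follow by simp
    also have "\<dots> = munit S.X [Inl (head E e)] [Inl w]"
      unfolding munit_eq bounded_operator_algebra_simps
      using scaled[OF S.Ts_bop[OF e(1)] vX] S.Ts_delta[OF vX e(1)] follow
      by (intro restrict_ext) (simp del: S.Ts_apply)
    finally show ?case .
  qed
  have \<pi>_path_elt: "\<pi> (path_elt x) = munit S.X x [Inl w]" if "x \<in> S.X" for x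
    using that
  proof induction
    case (step x e)
    have "\<pi> (path_elt (Inr e # x)) = S.T e \<otimes>\<^bsub>bounded_operator_algebra (ell2 S.X)\<^esub> munit S.X x [Inl w]"
      using step \<pi>_mult[of "s e" "path_elt x"] \<pi>s by simp
    also have "\<dots> = munit S.X (Inr e # x) [Inl w]"
      unfolding munit_eq bounded_operator_algebra_simps
      using scaled[OF S.T_bop[OF step.hyps(2)] step.hyps(1)] S.T_delta[OF step.hyps(1-3)] step.hyps(4)
      by (intro restrict_ext) (simp del: S.T_apply)
    finally show ?case .
  qed (simp add: \<pi>_line_part)
  interpret M: matrix_unit_algebra A S.X \<pi> path_unit
  proof
    show "star_hom A (bounded_operator_algebra (ell2 S.X)) \<pi>" by (rule hom)
    fix x y assume x: "x \<in> S.X" and y: "y \<in> S.X"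
    show "path_unit x y \<in> carrier A" "star A (path_unit x y) = path_unit y x" using x y path_unit_in path_unit_star by auto
    \<comment> \<open>The adjoint turns a column into a row, and a column times a row is the matrix
      unit.\<close>
    have "adjoint_operator (ell2 S.X) (ell2 S.X) (munit S.X y [Inl w]) = munit S.X [Inl w] y"
      using adjoint_wpb[of "\<lambda>_. [Inl w]" "{y}" "{[Inl w]}" S.X "\<lambda>_. y" 1] y w0 by (simp add: bij_betw_def)
    then have "\<pi> (path_unit x y) = munit S.X x [Inl w] \<otimes>\<^bsub>bounded_operator_algebra (ell2 S.X)\<^esub> munit S.X [Inl w] y"
      using \<pi>_mult[of "path_elt x" "star A (path_elt y)"] \<pi>_star[of "path_elt y"] x y \<pi>_path_elt by (simp add: path_unit_def)
    also have "\<dots> = munit S.X x y"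
    proof -
      have "munit S.X x [Inl w] (munit S.X [Inl w] y f) = munit S.X x y f" if f: "f \<in> carrier (ell2 S.X)" for f
      proof -
        have "munit S.X [Inl w] y f \<in> carrier (ell2 S.X)"
          using ell2.bop_in[OF munit_bounded[OF w0] f] .
        then show ?thesis using f by (auto simp: fun_eq_iff)
      qed
      then show ?thesis
        unfolding bounded_operator_algebra_simps
        by (subst (3) wpb_def) (rule restrict_ext, simp)
    qed
    finally show "\<pi> (path_unit x y) = munit S.X x y" .
    fix z t assume "z \<in> S.X" "t \<in> S.X"
    then show "path_unit x y \<otimes> path_unit z t = (if y = z then path_unit x t else \<zero>)" using x y path_unit_mult by simp
  next
    show "carrier A \<subseteq> closure_set (lin_span {path_unit x y | x y. x \<in> S.X \<and> y \<in> S.X})"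
      using units_closure_eq by (simp add: units_closure_def path_units_def)
  qed
  show ?thesis by (rule M.isomorphic_compact)
qed

end

theorem theorem4p1:
  fixes E :: "('v, 'e) pre_digraph"
    and A :: "'a cstar"
    and s :: "'e \<Rightarrow> 'a"
    and p :: "'v \<Rightarrow> 'a"
  assumes "wf_digraph E" and "verts E \<noteq> {}"
    and "graph_cstar_algebra E A s p"
    and "AF_algebra TYPE('i) TYPE('c) A"
    and "unique_irreducible_representation TYPE(('v, 'e) hilbert_carrier) A"
  shows "\<exists>H :: ('v, 'e) hilbert_carrier hilbert.
    hilbert_space H \<and> star_isomorphic A (compact_operator_algebra H)"
proof -
  interpret G: unique_rep_graph E A s p
    by (intro unique_rep_graph.intro unique_rep_graph_axioms.intro assms)
  obtain w where w: "w \<in> verts E"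
    "\<forall>u e f. (w, u) \<in> (arcs_ends E)\<^sup>* \<longrightarrow> e \<in> out_arcs E u \<longrightarrow> f \<in> out_arcs E u \<longrightarrow> e = f"
    using G.line_vertex_exists by blast
  interpret L: line_graph_algebra E A s p w
    using w G.A by (intro line_graph_algebra.intro line_graph_algebra_axioms.intro G.unique_rep_graph_axioms) blast+
  show ?thesis
    using L.isomorphic hilbert_space_ell2 by blast
qed

end
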